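(* Let $2<n<N$ be integers such that $n$ divides $N$, and let $k$ be an infinite field which contains a primitive $n$th root of unity. Then the family of Hopf algebras $\mathcal U_{(n,N,\nu,q,\alpha,\beta,\gamma)}$ over $k$ defined in the context contains infinitely many pairwise non-isomorphic Hopf algebras of dimension $Nn^2$.
   Context: Definition of $\mathcal U_{(n,N,\nu,q,\alpha,\beta,\gamma)}$. Let $n>1$, $\nu$, $N$ be positive integers with $1\le\nu<N$, $n\mid N$; let $\alpha,\beta,\gamma\in k$, $q\in k$ a primitive $n$th root of unity, $r=|q^\nu|$ the multiplicative order of $q^\nu$. If $(\alpha,\beta)\ne(0,0)$ it is assumed that $\gcd(n,\nu)=1$ (hence $r=n$) and $N\nmid\nu n$. If $\alpha=\beta=0$ it is assumed that $r>1$. The Hopf algebra $\mathcal U_{(n,N,\nu,q,\alpha,\beta,\gamma)}$ is generated as an algebra by $a,x,y$ with relations $$a^N=1,\quad xa=qax,\quad ya=q^{-1}ay,\quad yx-q^{-\nu}xy=\gamma(a^{2\nu}-1),$$ together with $x^r=0=y^r$ if $\alpha=\beta=0$, and with $x^n=\alpha(a^{\nu n}-1)$, $y^n=\beta(a^{\nu n}-1)$ if $(\alpha,\beta)\ne(0,0)$. Its structure is $\Delta(a)=a\otimes a$, $\Delta(x)=x\otimes a^\nu+1\otimes x$, $\Delta(y)=y\otimes a^\nu+1\otimes y$, $\varepsilon(a)=1$, $\varepsilon(x)=\varepsilon(y)=0$, antipode $s(a)=a^{-1}$, $s(x)=-q^{-\nu}a^{-\nu}x$, $s(y)=-q^\nu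 a^{-\nu}y$. *)

theory Defs
  imports
    "HOL-Library.Poly_Mapping"
    "HOL-Algebra.QuotRing"
    "Jordan_Normal_Form.VS_Connect"
begin

section \<open>Associative algebras over a field\<close>

text \<open>
  The ground field is a type \<open>'k\<close> of class \<^class>\<open>field\<close>, seen as a ring record through
  \<^term>\<open>class_ring\<close>. Algebras are module records; HOL-Algebra's locale \<open>algebra\<close>
  is not used since it requires commutativity.
\<close>

locale assoc_algebra = vectorspace "class_ring :: 'k::field ring" A + ring A
  for A :: "('k::field, 'a, 'm) module_scheme" (structure) +
  assumes smult_mult_left:
      "\<lbrakk>x \<in> carrier A; y \<in> carrier A\<rbrakk> \<Longrightarrow> (c \<odot> x) \<otimes> y = c \<odot> (x \<otimes> y)"
    and smult_mult_right:
      "\<lbrakk>x \<in> carrier A; y \<in> carrier A\<rbrakk> \<Longrightarrow> x \<otimes> (c \<odot> y) = c \<odot> (x \<otimes> y)"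

definition alg_hom ::
  "('k::field, 'a, 'm) module_scheme \<Rightarrow> ('k, 'b, 'n) module_scheme \<Rightarrow> ('a \<Rightarrow> 'b) set" where
  "alg_hom A B = Ring.ring_hom A B \<inter> LinearCombinations.module_hom class_ring A B"

definition base_algebra :: "('k::field, 'k) module" where
  "base_algebra =
    \<lparr>carrier = UNIV, mult = (*), one = 1, zero = 0, add = (+), smult = (*)\<rparr>"

definition opposite_algebra :: "('k, 'a, 'm) module_scheme \<Rightarrow> ('k, 'a, 'm) module_scheme" where
  "opposite_algebra A = A\<lparr>mult := (\<lambda>x y. y \<otimes>\<^bsub>A\<^esub> x)\<rparr>"

definition monoid_algebra :: "('m, 'z) monoid_scheme \<Rightarrow> ('k::field, 'm \<Rightarrow>\<^sub>0 'k) module" where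
  "monoid_algebra M =
    \<lparr>carrier = {f. Poly_Mapping.keys f \<subseteq> carrier M},
     mult = (\<lambda>f g. \<Sum>u \<in> Poly_Mapping.keys f. \<Sum>v \<in> Poly_Mapping.keys g.
       Poly_Mapping.single (u \<otimes>\<^bsub>M\<^esub> v) (Poly_Mapping.lookup f u * Poly_Mapping.lookup g v)),
     one = Poly_Mapping.single \<one>\<^bsub>M\<^esub> 1,
     zero = 0,
     add = (+),
     smult = (\<lambda>c. Poly_Mapping.map ((*) c))\<rparr>"

definition quot_algebra :: "('k, 'a, 'm) module_scheme \<Rightarrow> 'a set \<Rightarrow> ('k, 'a set) module" where
  "quot_algebra A I =
    ring.extend (A Quot I)
      (module.fields (\<lambda>c X. \<Union>x \<in> X. I +>\<^bsub>A\<^esub> (c \<odot>\<^bsub>A\<^esub> x)))"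

text \<open>
  The linear extension to \<^term>\<open>monoid_algebra M\<close> of a function on \<open>M\<close>, and the map it
  induces on a quotient. The latter is meaningful only if the extension is constant on
  cosets.
\<close>

definition lin_ext ::
  "('k::field, 'a, 'm) module_scheme \<Rightarrow> ('b \<Rightarrow> 'a) \<Rightarrow> ('b \<Rightarrow>\<^sub>0 'k) \<Rightarrow> 'a" where
  "lin_ext A \<phi> f =
    (\<Oplus>\<^bsub>A\<^esub> u \<in> Poly_Mapping.keys f. Poly_Mapping.lookup f u \<odot>\<^bsub>A\<^esub> \<phi> u)"

definition induced ::
  "('k::field, 'a, 'm) module_scheme \<Rightarrow> ('b \<Rightarrow> 'a) \<Rightarrow> ('b \<Rightarrow>\<^sub>0 'k) set \<Rightarrow> 'a" where
  "induced A \<phi> X = the_elem (lin_ext A \<phi> ` X)"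


section \<open>Tensor products\<close>

text \<open>
  \<open>A \<otimes> B\<close> is the free vector space on \<open>A \<times> B\<close> modulo the bilinear relations. Multiplying
  a bilinear relator by a pair \<open>(a, b)\<close> gives a bilinear relator again, so the subspace
  they span is the two-sided ideal they generate in the monoid algebra of \<open>A \<times> B\<close>, and
  the quotient carries the usual product \<open>(a \<otimes> b)(a' \<otimes> b') = aa' \<otimes> bb'\<close>.
\<close>

definition bilinear_relators ::
  "('k::field, 'a, 'm) module_scheme \<Rightarrow> ('k, 'b, 'n) module_scheme \<Rightarrow> ('a \<times> 'b \<Rightarrow>\<^sub>0 'k) set"
where
  "bilinear_relators A B =
    {Poly_Mapping.single (a \<oplus>\<^bsub>A\<^esub> a', b) 1
       - Poly_Mapping.single (a, b) 1 - Poly_Mapping.single (a', b) 1 | a a' b.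
       a \<in> carrier A \<and> a' \<in> carrier A \<and> b \<in> carrier B} \<union>
    {Poly_Mapping.single (a, b \<oplus>\<^bsub>B\<^esub> b') 1
       - Poly_Mapping.single (a, b) 1 - Poly_Mapping.single (a, b') 1 | a b b'.
       a \<in> carrier A \<and> b \<in> carrier B \<and> b' \<in> carrier B} \<union>
    {Poly_Mapping.single (c \<odot>\<^bsub>A\<^esub> a, b) 1 - Poly_Mapping.single (a, b) c | c a b.
       a \<in> carrier A \<and> b \<in> carrier B} \<union>
    {Poly_Mapping.single (a, c \<odot>\<^bsub>B\<^esub> b) 1 - Poly_Mapping.single (a, b) c | c a b.
       a \<in> carrier A \<and> b \<in> carrier B}"

definition bilinear_ideal ::
  "('k::field, 'a, 'm) module_scheme \<Rightarrow> ('k, 'b, 'n) module_scheme \<Rightarrow> ('a \<times> 'b \<Rightarrow>\<^sub>0 'k) set"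
where
  "bilinear_ideal A B = genideal (monoid_algebra (A \<times>\<times> B)) (bilinear_relators A B)"

definition tensor ::
  "('k::field, 'a, 'm) module_scheme \<Rightarrow> ('k, 'b, 'n) module_scheme \<Rightarrow>
    ('k, ('a \<times> 'b \<Rightarrow>\<^sub>0 'k) set) module" where
  "tensor A B = quot_algebra (monoid_algebra (A \<times>\<times> B)) (bilinear_ideal A B)"

definition pure_tensor ::
  "('k::field, 'a, 'm) module_scheme \<Rightarrow> ('k, 'b, 'n) module_scheme \<Rightarrow> 'a \<Rightarrow> 'b \<Rightarrow>
    ('a \<times> 'b \<Rightarrow>\<^sub>0 'k) set" where
  "pure_tensor A B a b =
    bilinear_ideal A B +>\<^bsub>monoid_algebra (A \<times>\<times> B)\<^esub> Poly_Mapping.single (a, b) 1"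

text \<open>\<open>f \<otimes> g\<close> with values in \<open>C \<otimes> D\<close>.\<close>

definition tensor_map ::
  "('k::field, 'c, 'm) module_scheme \<Rightarrow> ('k, 'd, 'n) module_scheme \<Rightarrow>
    ('a \<Rightarrow> 'c) \<Rightarrow> ('b \<Rightarrow> 'd) \<Rightarrow> ('a \<times> 'b \<Rightarrow>\<^sub>0 'k) set \<Rightarrow> ('c \<times> 'd \<Rightarrow>\<^sub>0 'k) set" where
  "tensor_map C D f g = induced (tensor C D) (\<lambda>(a, b). pure_tensor C D (f a) (g b))"

text \<open>The associator \<open>(A \<otimes> B) \<otimes> C \<rightarrow> A \<otimes> (B \<otimes> C)\<close>.\<close>

definition tensor_assoc ::
  "('k::field, 'a, 'm) module_scheme \<Rightarrow> ('k, 'b, 'n) module_scheme \<Rightarrow>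
    ('k, 'c, 'l) module_scheme \<Rightarrow>
    (('a \<times> 'b \<Rightarrow>\<^sub>0 'k) set \<times> 'c \<Rightarrow>\<^sub>0 'k) set \<Rightarrow> ('a \<times> ('b \<times> 'c \<Rightarrow>\<^sub>0 'k) set \<Rightarrow>\<^sub>0 'k) set"
where
  "tensor_assoc A B C =
    induced (tensor A (tensor B C))
      (\<lambda>(t, c). induced (tensor A (tensor B C))
        (\<lambda>(a, b). pure_tensor A (tensor B C) a (pure_tensor B C b c)) t)"


section \<open>Hopf algebras\<close>

record (overloaded) ('k::field, 'a) hopf = "('k, 'a) module" +
  comult :: "'a \<Rightarrow> ('a \<times> 'a \<Rightarrow>\<^sub>0 'k) set"
  counit :: "'a \<Rightarrow> 'k"
  antipode :: "'a \<Rightarrow> 'a"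

locale hopf_algebra = assoc_algebra H
  for H :: "('k::field, 'a, 'm) hopf_scheme" (structure) +
  assumes comult_hom: "comult H \<in> alg_hom H (tensor H H)"
    and counit_hom: "counit H \<in> alg_hom H base_algebra"
    and antipode_hom: "antipode H \<in> LinearCombinations.module_hom class_ring H H"
    and coassociative:
      "h \<in> carrier H \<Longrightarrow>
        tensor_assoc H H H (tensor_map (tensor H H) H (comult H) id (comult H h)) =
        tensor_map H (tensor H H) id (comult H) (comult H h)"
    and counit_left:
      "h \<in> carrier H \<Longrightarrow> induced H (\<lambda>(a, b). counit H a \<odot> b) (comult H h) = h"
    and counit_right:
      "h \<in> carrier H \<Longrightarrow> induced H (\<lambda>(a, b). counit H b \<odot> a) (comult H h) = h"
    and antipode_left:
      "h \<in> carrier H \<Longrightarrow>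
        induced H (\<lambda>(a, b). antipode H a \<otimes> b) (comult H h) = counit H h \<odot> \<one>"
    and antipode_right:
      "h \<in> carrier H \<Longrightarrow>
        induced H (\<lambda>(a, b). a \<otimes> antipode H b) (comult H h) = counit H h \<odot> \<one>"

text \<open>
  A bialgebra map between Hopf algebras automatically commutes with the antipodes.
\<close>

definition hopf_hom ::
  "('k::field, 'a, 'm) hopf_scheme \<Rightarrow> ('k, 'b, 'n) hopf_scheme \<Rightarrow> ('a \<Rightarrow> 'b) set" where
  "hopf_hom H L = {\<phi> \<in> alg_hom H L.
    \<forall>h \<in> carrier H. comult L (\<phi> h) = tensor_map L L \<phi> \<phi> (comult H h) \<and>
      counit L (\<phi> h) = counit H h}"

definition hopf_isomorphic ::
  "('k::field, 'a, 'm) hopf_scheme \<Rightarrow> ('k, 'b, 'n) hopf_scheme \<Rightarrow> bool" where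
  "hopf_isomorphic H L \<longleftrightarrow> (\<exists>\<phi> \<in> hopf_hom H L. bij_betw \<phi> (carrier H) (carrier L))"


section \<open>Roots of unity\<close>

definition primitive_root_of_unity :: "nat \<Rightarrow> 'k::field \<Rightarrow> bool" where
  "primitive_root_of_unity n q \<longleftrightarrow> 0 < n \<and> q ^ n = 1 \<and> (\<forall>m. 0 < m \<and> m < n \<longrightarrow> q ^ m \<noteq> 1)"

text \<open>Only meaningful for elements of finite order.\<close>

definition mult_order :: "'k::field \<Rightarrow> nat" where
  "mult_order z = (LEAST m. 0 < m \<and> z ^ m = 1)"


section \<open>The Hopf algebras \<open>U(n, N, \<nu>, q, \<alpha>, \<beta>, \<gamma>)\<close>\<close>

datatype gen = Gen_a | Gen_x | Gen_y

definition word_monoid :: "gen list monoid" where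
  "word_monoid = \<lparr>carrier = UNIV, mult = (@), one = []\<rparr>"

abbreviation free_alg :: "('k::field, gen list \<Rightarrow>\<^sub>0 'k) module" where
  "free_alg \<equiv> monoid_algebra word_monoid"

text \<open>The value of a word under an assignment of algebra elements to the generators.\<close>

definition word_eval :: "('a, 'z) monoid_scheme \<Rightarrow> (gen \<Rightarrow> 'a) \<Rightarrow> gen list \<Rightarrow> 'a" where
  "word_eval A \<phi> w = foldr (\<lambda>g t. \<phi> g \<otimes>\<^bsub>A\<^esub> t) w \<one>\<^bsub>A\<^esub>"

definition U_relators ::
  "nat \<Rightarrow> nat \<Rightarrow> nat \<Rightarrow> 'k::field \<Rightarrow> 'k \<Rightarrow> 'k \<Rightarrow> 'k \<Rightarrow> (gen list \<Rightarrow>\<^sub>0 'k) set" where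
  "U_relators n N \<nu> q \<alpha> \<beta> \<gamma> =
    (let mon = (\<lambda>w c. Poly_Mapping.single w c);
         a_pow = (\<lambda>m. replicate m Gen_a);
         r = mult_order (q ^ \<nu>)
     in {mon (a_pow N) 1 - mon [] 1,
         mon [Gen_x, Gen_a] 1 - mon [Gen_a, Gen_x] q,
         mon [Gen_y, Gen_a] 1 - mon [Gen_a, Gen_y] (inverse q),
         mon [Gen_y, Gen_x] 1 - mon [Gen_x, Gen_y] (inverse (q ^ \<nu>))
           - (mon (a_pow (2 * \<nu>)) \<gamma> - mon [] \<gamma>)} \<union>
        (if \<alpha> = 0 \<and> \<beta> = 0
         then {mon (replicate r Gen_x) 1, mon (replicate r Gen_y) 1}
         else {mon (replicate n Gen_x) 1 - (mon (a_pow (\<nu> * n)) \<alpha> - mon [] \<alpha>),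
               mon (replicate n Gen_y) 1 - (mon (a_pow (\<nu> * n)) \<beta> - mon [] \<beta>)}))"

definition U_ideal ::
  "nat \<Rightarrow> nat \<Rightarrow> nat \<Rightarrow> 'k::field \<Rightarrow> 'k \<Rightarrow> 'k \<Rightarrow> 'k \<Rightarrow> (gen list \<Rightarrow>\<^sub>0 'k) set" where
  "U_ideal n N \<nu> q \<alpha> \<beta> \<gamma> = genideal free_alg (U_relators n N \<nu> q \<alpha> \<beta> \<gamma>)"

definition U_algebra ::
  "nat \<Rightarrow> nat \<Rightarrow> nat \<Rightarrow> 'k::field \<Rightarrow> 'k \<Rightarrow> 'k \<Rightarrow> 'k \<Rightarrow> ('k, (gen list \<Rightarrow>\<^sub>0 'k) set) module" where
  "U_algebra n N \<nu> q \<alpha> \<beta> \<gamma> = quot_algebra free_alg (U_ideal n N \<nu> q \<alpha> \<beta> \<gamma>)"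

definition U_gen ::
  "nat \<Rightarrow> nat \<Rightarrow> nat \<Rightarrow> 'k::field \<Rightarrow> 'k \<Rightarrow> 'k \<Rightarrow> 'k \<Rightarrow> gen \<Rightarrow> (gen list \<Rightarrow>\<^sub>0 'k) set" where
  "U_gen n N \<nu> q \<alpha> \<beta> \<gamma> g =
    U_ideal n N \<nu> q \<alpha> \<beta> \<gamma> +>\<^bsub>free_alg\<^esub> Poly_Mapping.single [g] 1"

text \<open>
  \<open>\<Delta>\<close> and \<open>\<epsilon>\<close> are the algebra maps, and the antipode is the algebra map to the opposite
  algebra, with the prescribed values on the generators.
\<close>

definition U_hopf ::
  "nat \<Rightarrow> nat \<Rightarrow> nat \<Rightarrow> 'k::field \<Rightarrow> 'k \<Rightarrow> 'k \<Rightarrow> 'k \<Rightarrow> ('k, (gen list \<Rightarrow>\<^sub>0 'k) set) hopf" where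
  "U_hopf n N \<nu> q \<alpha> \<beta> \<gamma> =
    (let U = U_algebra n N \<nu> q \<alpha> \<beta> \<gamma>;
         a = U_gen n N \<nu> q \<alpha> \<beta> \<gamma> Gen_a;
         x = U_gen n N \<nu> q \<alpha> \<beta> \<gamma> Gen_x;
         y = U_gen n N \<nu> q \<alpha> \<beta> \<gamma> Gen_y;
         T = tensor U U;
         tn = pure_tensor U U;
         \<Delta> = (\<lambda>g. case g of
             Gen_a \<Rightarrow> tn a a
           | Gen_x \<Rightarrow> tn x (a [^]\<^bsub>U\<^esub> \<nu>) \<oplus>\<^bsub>T\<^esub> tn \<one>\<^bsub>U\<^esub> x
           | Gen_y \<Rightarrow> tn y (a [^]\<^bsub>U\<^esub> \<nu>) \<oplus>\<^bsub>T\<^esub> tn \<one>\<^bsub>U\<^esub> y);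
         \<epsilon> = (\<lambda>g. case g of Gen_a \<Rightarrow> 1 | Gen_x \<Rightarrow> 0 | Gen_y \<Rightarrow> 0);
         s = (\<lambda>g. case g of
             Gen_a \<Rightarrow> inv\<^bsub>U\<^esub> a
           | Gen_x \<Rightarrow> (- inverse (q ^ \<nu>)) \<odot>\<^bsub>U\<^esub> (inv\<^bsub>U\<^esub> (a [^]\<^bsub>U\<^esub> \<nu>) \<otimes>\<^bsub>U\<^esub> x)
           | Gen_y \<Rightarrow> (- (q ^ \<nu>)) \<odot>\<^bsub>U\<^esub> (inv\<^bsub>U\<^esub> (a [^]\<^bsub>U\<^esub> \<nu>) \<otimes>\<^bsub>U\<^esub> y))
     in module.extend U
          (hopf.fields
            (induced T (word_eval T \<Delta>))
            (induced base_algebra (word_eval base_algebra \<epsilon>))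
            (induced U (word_eval (opposite_algebra U) s))))"

definition U_admissible ::
  "nat \<Rightarrow> nat \<Rightarrow> nat \<Rightarrow> 'k::field \<Rightarrow> 'k \<Rightarrow> 'k \<Rightarrow> 'k \<Rightarrow> bool" where
  "U_admissible n N \<nu> q \<alpha> \<beta> \<gamma> \<longleftrightarrow>
    1 < n \<and> 1 \<le> \<nu> \<and> \<nu> < N \<and> n dvd N \<and> primitive_root_of_unity n q \<and>
    (if \<alpha> = 0 \<and> \<beta> = 0 then 1 < mult_order (q ^ \<nu>)
     else coprime n \<nu> \<and> \<not> N dvd \<nu> * n)"

definition U_family :: "nat \<Rightarrow> nat \<Rightarrow> ('k::field, (gen list \<Rightarrow>\<^sub>0 'k) set) hopf set" where
  "U_family n N =
    {U_hopf n N \<nu> q \<alpha> \<beta> \<gamma> | \<nu> q \<alpha> \<beta> \<gamma>. U_admissible n N \<nu> q \<alpha> \<beta> \<gamma>}"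

end

theory Submission
  imports Defs
begin

text \<open>
  Fix \<open>\<nu> = 1\<close>, \<open>\<alpha> = \<gamma> = 1\<close> and a primitive root \<open>q\<close>, and let \<open>\<beta>\<close> vary over the infinite field.
  The monomials \<open>a^i x^j y^k\<close> span by straightening. They are independent because there are enough
  functionals on the algebra: a function \<open>f\<close> of \<open>(i, j, k)\<close> that is \<open>N\<close>-periodic in \<open>i\<close> and satisfies the
  recursions dictated by \<open>x^n\<close> and \<open>y^n\<close> defines one, as the operators by which the generators must act
  on such functions satisfy the defining relations.

  By the \<open>q\<close>-binomial theorem the comultiplication of the monomials has structure constants independent
  of the parameters, so the group-like elements are the powers of \<open>a\<close>, and the skew primitive elements of
  type \<open>(1, a^m)\<close> are the multiples of \<open>1 - a^m\<close>, together with the combinations of \<open>x\<close> and \<open>y\<close> if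
  \<open>m = 1\<close>. Hence an isomorphism fixes \<open>a\<close>, and as \<open>q \<noteq> inverse q\<close> it maps \<open>x\<close> to \<open>u x\<close> and \<open>y\<close> to \<open>w y\<close>.
  Then \<open>\<alpha> = u^n \<alpha>'\<close>, \<open>\<beta> = w^n \<beta>'\<close>, \<open>\<gamma> = u w \<gamma>'\<close>, and \<open>\<alpha> = \<alpha>' = \<gamma> = \<gamma>' = 1\<close> forces \<open>\<beta> = \<beta>'\<close>.
\<close>

text \<open>Both the tensor product and the algebra are quotients of monoid algebras by generated
  ideals, and maps out of them are read off as \<open>the_elem\<close> of the image of a coset;
  nothing can be computed before such a map is known to be constant on cosets. One theory of
  presentations settles this for both. It tests linear maps on products \<open>u r v\<close>,
  because bilinear maps and the functionals of the basis argument need not be multiplicative. As the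
  relations are checked in a general target algebra, \<Delta>, \<epsilon> and the antipode arise
  from one universal property, and the Hopf axioms need checking on generators only. The relations
  for x^n and y^n survive \<Delta> because the inner Gaussian binomials vanish at a primitive root.
  Information is extracted from equations between tensors by pairs of coordinate functionals,
  without a basis of the tensor square. The bound 2 < n separates q from its inverse; n < N keeps
  a^n different from 1, so that \<alpha> and \<beta> can be recovered from x^n and y^n. The nonzero
  \<gamma> ties together the scalings of x and y, which would otherwise be independent.\<close>

section \<open>Algebras over a field\<close>

text \<open>The locale \<open>assoc_algebra\<close> with the ground field as a type rather than a record.\<close>

locale kalgebra = ring A
  for A :: "('k::field, 'a, 'm) module_scheme" (structure) +
  assumes smult_closed [simp, intro]: "x \<in> carrier A \<Longrightarrow> c \<odot> x \<in> carrier A"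
    and smult_add_left: "x \<in> carrier A \<Longrightarrow> (c + d) \<odot> x = c \<odot> x \<oplus> d \<odot> x"
    and smult_add_right: "\<lbrakk>x \<in> carrier A; y \<in> carrier A\<rbrakk> \<Longrightarrow> c \<odot> (x \<oplus> y) = c \<odot> x \<oplus> c \<odot> y"
    and smult_smult [simp]: "x \<in> carrier A \<Longrightarrow> c \<odot> (d \<odot> x) = (c * d) \<odot> x"
    and smult_1 [simp]: "x \<in> carrier A \<Longrightarrow> 1 \<odot> x = x"
    and smult_mult_left [simp]:
      "\<lbrakk>x \<in> carrier A; y \<in> carrier A\<rbrakk> \<Longrightarrow> (c \<odot> x) \<otimes> y = c \<odot> (x \<otimes> y)"
    and smult_mult_right [simp]:
      "\<lbrakk>x \<in> carrier A; y \<in> carrier A\<rbrakk> \<Longrightarrow> x \<otimes> (c \<odot> y) = c \<odot> (x \<otimes> y)"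

lemma kalgebra_imp_assoc_algebra:
  fixes A :: "('k::field, 'a, 'm) module_scheme" (structure)
  assumes "kalgebra A"
  shows "assoc_algebra A"
proof -
  interpret kalgebra A by fact
  have "Module.module (class_ring :: 'k ring) A"
    by (rule moduleI)
      (auto simp: class_cring.is_cring is_abelian_group smult_add_left smult_add_right)
  moreover have "assoc_algebra_axioms A"
    by unfold_locales auto
  ultimately show ?thesis
    by (simp add: assoc_algebra_def vectorspace_def class_field ring_axioms)
qed

context kalgebra begin

lemma smult_0 [simp]: "x \<in> carrier A \<Longrightarrow> 0 \<odot> x = \<zero>"
  using smult_add_left[of x 0 0] by (simp add: add.r_cancel_one')

lemma smult_zero [simp]: "c \<odot> \<zero> = \<zero>"
  using smult_add_right[of \<zero> \<zero> c] by (simp add: add.r_cancel_one')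

lemma smult_minus [simp]: "x \<in> carrier A \<Longrightarrow> (- c) \<odot> x = \<ominus> (c \<odot> x)"
  using smult_add_left[of x "- c" c] by (simp add: minus_equality)

lemma smult_a_inv: "x \<in> carrier A \<Longrightarrow> c \<odot> (\<ominus> x) = \<ominus> (c \<odot> x)"
  using smult_add_right[of "\<ominus> x" x c] by (simp add: minus_equality l_neg)

lemma minus_eq_smult: "x \<in> carrier A \<Longrightarrow> \<ominus> x = (- 1) \<odot> x"
  by simp

lemma smult_finsum:
  "f \<in> S \<rightarrow> carrier A \<Longrightarrow> c \<odot> (\<Oplus>u\<in>S. f u) = (\<Oplus>u\<in>S. c \<odot> f u)"
  by (induct S rule: infinite_finite_induct)
    (auto simp: smult_add_right Pi_iff)

end

lemma kalgebra_base: "kalgebra base_algebra"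
proof -
  have "ring (base_algebra :: ('k::field, 'k) module)"
    apply (rule ringI)
       apply (rule abelian_groupI)
           apply (auto simp: base_algebra_def algebra_simps)
     apply (metis add.right_inverse add.commute)
    apply (rule monoidI) apply auto
    done
  then show ?thesis
    by (rule kalgebra.intro) (unfold_locales, auto simp: base_algebra_def algebra_simps)
qed

lemma base_algebra_simps [simp]:
  "carrier base_algebra = UNIV"
  "x \<otimes>\<^bsub>base_algebra\<^esub> y = x * y"
  "\<one>\<^bsub>base_algebra\<^esub> = 1"
  "\<zero>\<^bsub>base_algebra\<^esub> = 0"
  "x \<oplus>\<^bsub>base_algebra\<^esub> y = x + y"
  "c \<odot>\<^bsub>base_algebra\<^esub> x = c * x"
  by (simp_all add: base_algebra_def)

lemma base_algebra_finsum [simp]: "finsum base_algebra f S = sum f S"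
proof -
  interpret kalgebra base_algebra by (rule kalgebra_base)
  show ?thesis by (induct S rule: infinite_finite_induct) auto
qed

lemma base_algebra_a_inv [simp]: "\<ominus>\<^bsub>base_algebra\<^esub> x = - x"
proof -
  interpret kalgebra base_algebra by (rule kalgebra_base)
  show ?thesis by (rule minus_equality) auto
qed

lemma base_algebra_pow [simp]: "x [^]\<^bsub>base_algebra\<^esub> (m::nat) = x ^ m"
  by (induct m) (simp_all add: Group.nat_pow_def)

lemma kalgebra_opposite:
  assumes "kalgebra A"
  shows "kalgebra (opposite_algebra A)"
proof -
  interpret kalgebra A by fact
  have "abelian_group (opposite_algebra A)"
    unfolding opposite_algebra_def
    by (rule abelian_groupI)
      (auto simp: a_assoc intro: a_comm bexI[where x = "\<ominus>\<^bsub>A\<^esub> x" for x] l_neg)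
  moreover have "Group.monoid (opposite_algebra A)"
    unfolding opposite_algebra_def by (rule monoidI) (auto simp: m_assoc)
  ultimately have "ring (opposite_algebra A)"
    by (rule ringI) (auto simp: opposite_algebra_def l_distr r_distr)
  then show ?thesis
    by (rule kalgebra.intro)
      (unfold_locales, auto simp: opposite_algebra_def smult_add_left smult_add_right)
qed

lemma opposite_algebra_simps [simp]:
  "carrier (opposite_algebra A) = carrier A"
  "x \<otimes>\<^bsub>opposite_algebra A\<^esub> y = y \<otimes>\<^bsub>A\<^esub> x"
  "\<one>\<^bsub>opposite_algebra A\<^esub> = \<one>\<^bsub>A\<^esub>"
  "\<zero>\<^bsub>opposite_algebra A\<^esub> = \<zero>\<^bsub>A\<^esub>"
  "x \<oplus>\<^bsub>opposite_algebra A\<^esub> y = x \<oplus>\<^bsub>A\<^esub> y"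
  "c \<odot>\<^bsub>opposite_algebra A\<^esub> x = c \<odot>\<^bsub>A\<^esub> x"
  by (simp_all add: opposite_algebra_def)

subsection \<open>Linear maps and algebra maps\<close>

abbreviation linear_maps ::
  "('k::field, 'a, 'm) module_scheme \<Rightarrow> ('k, 'b, 'n) module_scheme \<Rightarrow> ('a \<Rightarrow> 'b) set" where
  "linear_maps \<equiv> LinearCombinations.module_hom class_ring"

lemma linear_mapsI:
  fixes A :: "('k::field, 'a, 'm) module_scheme"
  assumes "\<And>x. x \<in> carrier A \<Longrightarrow> f x \<in> carrier B"
    "\<And>x y. \<lbrakk>x \<in> carrier A; y \<in> carrier A\<rbrakk> \<Longrightarrow> f (x \<oplus>\<^bsub>A\<^esub> y) = f x \<oplus>\<^bsub>B\<^esub> f y"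
    "\<And>c x. x \<in> carrier A \<Longrightarrow> f (c \<odot>\<^bsub>A\<^esub> x) = c \<odot>\<^bsub>B\<^esub> f x"
  shows "f \<in> linear_maps A B"
  using assms by (auto simp: LinearCombinations.module_hom_def)

lemma linear_mapsD:
  fixes A :: "('k::field, 'a, 'm) module_scheme"
  assumes "f \<in> linear_maps A B"
  shows "x \<in> carrier A \<Longrightarrow> f x \<in> carrier B"
    "\<lbrakk>x \<in> carrier A; y \<in> carrier A\<rbrakk> \<Longrightarrow> f (x \<oplus>\<^bsub>A\<^esub> y) = f x \<oplus>\<^bsub>B\<^esub> f y"
    "x \<in> carrier A \<Longrightarrow> f (c \<odot>\<^bsub>A\<^esub> x) = c \<odot>\<^bsub>B\<^esub> f x"
  using assms by (auto simp: LinearCombinations.module_hom_def)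

lemma linear_maps_zero:
  assumes "kalgebra A" "kalgebra B" "f \<in> linear_maps A B"
  shows "f \<zero>\<^bsub>A\<^esub> = \<zero>\<^bsub>B\<^esub>"
proof -
  interpret A: kalgebra A by fact
  interpret B: kalgebra B by fact
  show ?thesis using linear_mapsD(3)[OF assms(3), of "\<zero>\<^bsub>A\<^esub>" 0] linear_mapsD(1)[OF assms(3)]
    by simp
qed

lemma linear_maps_a_inv:
  assumes "kalgebra A" "kalgebra B" "f \<in> linear_maps A B" "x \<in> carrier A"
  shows "f (\<ominus>\<^bsub>A\<^esub> x) = \<ominus>\<^bsub>B\<^esub> f x"
proof -
  interpret A: kalgebra A by fact
  interpret B: kalgebra B by fact
  show ?thesis using linear_mapsD[OF assms(3)] assms(4)
    by (simp only: A.minus_eq_smult B.minus_eq_smult)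
qed

lemma linear_maps_minus:
  assumes "kalgebra A" "kalgebra B" "f \<in> linear_maps A B" "x \<in> carrier A" "y \<in> carrier A"
  shows "f (x \<ominus>\<^bsub>A\<^esub> y) = f x \<ominus>\<^bsub>B\<^esub> f y"
proof -
  interpret A: kalgebra A by fact
  interpret B: kalgebra B by fact
  show ?thesis using linear_mapsD[OF assms(3)] linear_maps_a_inv[OF assms(1-3)] assms(4,5)
    by (simp add: A.minus_eq B.minus_eq)
qed

lemma linear_maps_finsum:
  assumes "kalgebra A" "kalgebra B" "f \<in> linear_maps A B" "g \<in> S \<rightarrow> carrier A"
  shows "f (finsum A g S) = finsum B (\<lambda>u. f (g u)) S"
proof -
  interpret A: kalgebra A by fact
  interpret B: kalgebra B by fact
  show ?thesis using assms(4)
  proof (induct S rule: infinite_finite_induct)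
    case (insert x F)
    then show ?case using linear_mapsD[OF assms(3)] by (simp add: Pi_iff)
  qed (auto simp: linear_maps_zero[OF assms(1-3)])
qed

lemma linear_maps_comp:
  assumes "f \<in> linear_maps A B" "g \<in> linear_maps B C"
  shows "(\<lambda>x. g (f x)) \<in> linear_maps A C"
  by (rule linear_mapsI) (simp_all add: linear_mapsD[OF assms(1)] linear_mapsD[OF assms(2)])

lemma linear_maps_id: "(\<lambda>x. x) \<in> linear_maps A A"
  by (rule linear_mapsI) auto

lemma alg_homI:
  fixes A :: "('k::field, 'a, 'm) module_scheme"
  assumes "f \<in> linear_maps A B"
    "\<And>x y. \<lbrakk>x \<in> carrier A; y \<in> carrier A\<rbrakk> \<Longrightarrow> f (x \<otimes>\<^bsub>A\<^esub> y) = f x \<otimes>\<^bsub>B\<^esub> f y"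
    "f \<one>\<^bsub>A\<^esub> = \<one>\<^bsub>B\<^esub>"
  shows "f \<in> alg_hom A B"
  using assms unfolding alg_hom_def by (auto intro!: ring_hom_memI simp: linear_mapsD)

lemma alg_homD:
  fixes A :: "('k::field, 'a, 'm) module_scheme"
  assumes "f \<in> alg_hom A B"
  shows "f \<in> linear_maps A B"
    "\<lbrakk>x \<in> carrier A; y \<in> carrier A\<rbrakk> \<Longrightarrow> f (x \<otimes>\<^bsub>A\<^esub> y) = f x \<otimes>\<^bsub>B\<^esub> f y"
    "f \<one>\<^bsub>A\<^esub> = \<one>\<^bsub>B\<^esub>"
    "x \<in> carrier A \<Longrightarrow> f x \<in> carrier B"
    "\<lbrakk>x \<in> carrier A; y \<in> carrier A\<rbrakk> \<Longrightarrow> f (x \<oplus>\<^bsub>A\<^esub> y) = f x \<oplus>\<^bsub>B\<^esub> f y"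
    "x \<in> carrier A \<Longrightarrow> f (c \<odot>\<^bsub>A\<^esub> x) = c \<odot>\<^bsub>B\<^esub> f x"
  using assms unfolding alg_hom_def
  by (auto simp: ring_hom_mult ring_hom_one linear_mapsD)

lemma alg_hom_comp:
  assumes "f \<in> alg_hom A B" "g \<in> alg_hom B C"
  shows "(\<lambda>x. g (f x)) \<in> alg_hom A C"
  by (rule alg_homI)
    (simp_all add: alg_homD[OF assms(1)] alg_homD[OF assms(2)]
      linear_maps_comp[OF alg_homD(1)[OF assms(1)] alg_homD(1)[OF assms(2)]])

lemma alg_hom_id: "(\<lambda>x. x) \<in> alg_hom A A"
  by (rule alg_homI) (auto intro: linear_maps_id)

lemma alg_hom_pow:
  assumes "kalgebra A" "kalgebra B" "f \<in> alg_hom A B" "x \<in> carrier A"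
  shows "f (x [^]\<^bsub>A\<^esub> (m::nat)) = f x [^]\<^bsub>B\<^esub> m"
proof -
  interpret A: kalgebra A by fact
  interpret B: kalgebra B by fact
  show ?thesis using assms(4)
    by (induct m) (simp_all add: alg_homD[OF assms(3)])
qed

subsection \<open>Linear extension\<close>

lemma lookup_scale [simp]: "Poly_Mapping.lookup (Poly_Mapping.map ((*) (c::'k::field)) f) u = c * Poly_Mapping.lookup f u"
  by (simp add: Poly_Mapping.map.rep_eq when_def)

lemma keys_scale: "Poly_Mapping.keys (Poly_Mapping.map ((*) (c::'k::field)) f) \<subseteq> Poly_Mapping.keys f"
  by (auto simp: in_keys_iff)

lemma scale_single [simp]:
  "Poly_Mapping.map ((*) (c::'k::field)) (Poly_Mapping.single u d) = Poly_Mapping.single u (c * d)"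
  by (rule poly_mapping_eqI) (simp add: lookup_single when_def)

lemma keys_single_subset: "u \<in> S \<Longrightarrow> Poly_Mapping.keys (Poly_Mapping.single u c) \<subseteq> S"
  by auto

lemma keys_add_subset:
  "Poly_Mapping.keys f \<subseteq> S \<Longrightarrow> Poly_Mapping.keys g \<subseteq> S \<Longrightarrow> Poly_Mapping.keys (f + g) \<subseteq> S"
  using keys_add[of f g] by blast

lemma keys_diff_subset:
  fixes f g :: "'a \<Rightarrow>\<^sub>0 'k::ab_group_add"
  assumes "Poly_Mapping.keys f \<subseteq> S" "Poly_Mapping.keys g \<subseteq> S"
  shows "Poly_Mapping.keys (f - g) \<subseteq> S"
proof
  fix x assume "x \<in> Poly_Mapping.keys (f - g)"
  then have "Poly_Mapping.lookup f x \<noteq> 0 \<or> Poly_Mapping.lookup g x \<noteq> 0"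
    by (auto simp: in_keys_iff lookup_minus)
  then show "x \<in> S" using assms by (auto simp: in_keys_iff)
qed

lemma keys_subset_induct [consumes 1, case_names zero add]:
  fixes f :: "'b \<Rightarrow>\<^sub>0 'k::field"
  assumes "Poly_Mapping.keys f \<subseteq> S"
    and "P 0"
    and "\<And>f u c. Poly_Mapping.keys f \<subseteq> S \<Longrightarrow> u \<in> S \<Longrightarrow> P f \<Longrightarrow> P (f + Poly_Mapping.single u c)"
  shows "P f"
  using assms(1)
proof (induct f rule: update_induct)
  case const
  show ?case by fact
next
  case (update f a b)
  have eq: "Poly_Mapping.update a b f = f + Poly_Mapping.single a b"
    using update(1) by (intro poly_mapping_eqI)
      (auto simp: lookup_update lookup_add lookup_single when_def in_keys_iff)
  have "Poly_Mapping.keys (Poly_Mapping.update a b f) = insert a (Poly_Mapping.keys f)"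
    using update(2) by (simp add: keys_update)
  then show ?case using update assms(3) unfolding eq by auto
qed

context kalgebra begin

text \<open>\<open>lin_ext\<close> sums over the support, which changes under addition. Over a
  common finite superset the summands can be compared one by one; the extra ones vanish.\<close>

lemma lin_ext_superset:
  assumes "finite T" "Poly_Mapping.keys f \<subseteq> T" "\<phi> \<in> T \<rightarrow> carrier A"
  shows "lin_ext A \<phi> f = (\<Oplus>u\<in>T. Poly_Mapping.lookup f u \<odot> \<phi> u)"
  unfolding lin_ext_def
  using assms
  by (intro add.finprod_mono_neutral_cong_left) (auto simp: in_keys_iff Pi_iff)

lemma lin_ext_closed:
  "Poly_Mapping.keys f \<subseteq> S \<Longrightarrow> \<phi> \<in> S \<rightarrow> carrier A \<Longrightarrow> lin_ext A \<phi> f \<in> carrier A"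
  unfolding lin_ext_def by (intro finsum_closed) auto

lemma lin_ext_add:
  assumes "Poly_Mapping.keys f \<subseteq> S" "Poly_Mapping.keys g \<subseteq> S" "\<phi> \<in> S \<rightarrow> carrier A"
  shows "lin_ext A \<phi> (f + g) = lin_ext A \<phi> f \<oplus> lin_ext A \<phi> g"
proof -
  let ?T = "Poly_Mapping.keys f \<union> Poly_Mapping.keys g"
  have T: "finite ?T" "\<phi> \<in> ?T \<rightarrow> carrier A" using assms by auto
  have "lin_ext A \<phi> (f + g) = (\<Oplus>u\<in>?T. Poly_Mapping.lookup f u \<odot> \<phi> u \<oplus> Poly_Mapping.lookup g u \<odot> \<phi> u)"
    unfolding lin_ext_superset[OF T(1) Poly_Mapping.keys_add T(2)]
    by (rule finsum_cong') (use T in \<open>auto simp: lookup_add smult_add_left Pi_iff\<close>)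
  also have "\<dots> = lin_ext A \<phi> f \<oplus> lin_ext A \<phi> g"
    using T by (subst finsum_addf) (auto simp: lin_ext_superset[of ?T] Pi_iff)
  finally show ?thesis .
qed

lemma lin_ext_scale:
  assumes "Poly_Mapping.keys f \<subseteq> S" "\<phi> \<in> S \<rightarrow> carrier A"
  shows "lin_ext A \<phi> (Poly_Mapping.map ((*) c) f) = c \<odot> lin_ext A \<phi> f"
proof -
  let ?T = "Poly_Mapping.keys f"
  have T: "finite ?T" "\<phi> \<in> ?T \<rightarrow> carrier A" using assms by auto
  have "lin_ext A \<phi> (Poly_Mapping.map ((*) c) f) = (\<Oplus>u\<in>?T. c \<odot> (Poly_Mapping.lookup f u \<odot> \<phi> u))"
    unfolding lin_ext_superset[OF T(1) keys_scale T(2)]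
    by (rule finsum_cong') (use T in \<open>auto simp: Pi_iff\<close>)
  also have "\<dots> = c \<odot> lin_ext A \<phi> f"
    unfolding lin_ext_def by (subst smult_finsum) (use T in \<open>auto simp: Pi_iff\<close>)
  finally show ?thesis .
qed

lemma lin_ext_zero [simp]: "lin_ext A \<phi> 0 = \<zero>"
  by (simp add: lin_ext_def)

lemma lin_ext_single: "\<phi> u \<in> carrier A \<Longrightarrow> lin_ext A \<phi> (Poly_Mapping.single u c) = c \<odot> \<phi> u"
  by (subst lin_ext_superset[of "{u}"]) auto

lemma lin_ext_diff:
  assumes "Poly_Mapping.keys f \<subseteq> S" "Poly_Mapping.keys g \<subseteq> S" "\<phi> \<in> S \<rightarrow> carrier A"
  shows "lin_ext A \<phi> (f - g) = lin_ext A \<phi> f \<ominus> lin_ext A \<phi> g"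
proof -
  have "lin_ext A \<phi> f = lin_ext A \<phi> (f - g) \<oplus> lin_ext A \<phi> g"
    using lin_ext_add[OF keys_diff_subset[OF assms(1,2)] assms(2,3)] by simp
  then show ?thesis
    using lin_ext_closed[OF assms(1,3)] lin_ext_closed[OF assms(2,3)]
      lin_ext_closed[OF keys_diff_subset[OF assms(1,2)] assms(3)]
    by (simp add: minus_eq a_assoc r_neg)
qed

end

subsection \<open>Monoid algebras\<close>

lemma monoid_algebra_simps [simp]:
  "carrier (monoid_algebra M) = {f. Poly_Mapping.keys f \<subseteq> carrier M}"
  "\<one>\<^bsub>monoid_algebra M\<^esub> = Poly_Mapping.single \<one>\<^bsub>M\<^esub> 1"
  "\<zero>\<^bsub>monoid_algebra M\<^esub> = 0"
  "f \<oplus>\<^bsub>monoid_algebra M\<^esub> g = f + g"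
  "c \<odot>\<^bsub>monoid_algebra M\<^esub> f = Poly_Mapping.map ((*) c) f"
  by (simp_all add: monoid_algebra_def)

lemma monoid_algebra_mult:
  "f \<otimes>\<^bsub>monoid_algebra M\<^esub> g = (\<Sum>u \<in> Poly_Mapping.keys f. \<Sum>v \<in> Poly_Mapping.keys g.
       Poly_Mapping.single (u \<otimes>\<^bsub>M\<^esub> v) (Poly_Mapping.lookup f u * Poly_Mapping.lookup g v))"
  by (simp add: monoid_algebra_def)

lemma monoid_algebra_mult_zero [simp]:
  "0 \<otimes>\<^bsub>monoid_algebra M\<^esub> g = 0" "f \<otimes>\<^bsub>monoid_algebra M\<^esub> 0 = 0"
  by (simp_all add: monoid_algebra_mult)

lemma monoid_algebra_mult_single [simp]:
  "Poly_Mapping.single u c \<otimes>\<^bsub>monoid_algebra M\<^esub> Poly_Mapping.single v d =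
    Poly_Mapping.single (u \<otimes>\<^bsub>M\<^esub> v) (c * d)"
  by (cases "c = 0"; cases "d = 0") (simp_all add: monoid_algebra_mult)

lemma monoid_algebra_l_distr:
  "(f + f') \<otimes>\<^bsub>monoid_algebra M\<^esub> g = f \<otimes>\<^bsub>monoid_algebra M\<^esub> g + f' \<otimes>\<^bsub>monoid_algebra M\<^esub> g"
  unfolding monoid_algebra_mult
  by (rule setsum_keys_plus_distrib[where f = "\<lambda>u c. \<Sum>v \<in> Poly_Mapping.keys g.
       Poly_Mapping.single (u \<otimes>\<^bsub>M\<^esub> v) (c * Poly_Mapping.lookup g v)"])
    (simp_all add: distrib_right single_add sum.distrib)

lemma monoid_algebra_r_distr:
  "f \<otimes>\<^bsub>monoid_algebra M\<^esub> (g + g') = f \<otimes>\<^bsub>monoid_algebra M\<^esub> g + f \<otimes>\<^bsub>monoid_algebra M\<^esub> g'"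
  unfolding monoid_algebra_mult sum.distrib[symmetric]
  by (rule sum.cong[OF refl], rule setsum_keys_plus_distrib[where f = "\<lambda>v c.
       Poly_Mapping.single (u \<otimes>\<^bsub>M\<^esub> v) (Poly_Mapping.lookup f u * c)" for u])
    (simp_all add: distrib_left single_add)

lemma keys_sum_subset:
  "(\<And>u. u \<in> I \<Longrightarrow> Poly_Mapping.keys (h u) \<subseteq> S) \<Longrightarrow> Poly_Mapping.keys (\<Sum>u\<in>I. h u) \<subseteq> S"
  by (induct I rule: infinite_finite_induct) (simp_all add: keys_add_subset)

lemma monoid_algebra_mult_closed:
  assumes "monoid M" "Poly_Mapping.keys f \<subseteq> carrier M" "Poly_Mapping.keys g \<subseteq> carrier M"
  shows "Poly_Mapping.keys (f \<otimes>\<^bsub>monoid_algebra M\<^esub> g) \<subseteq> carrier M"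
proof -
  interpret monoid M by fact
  show ?thesis
    unfolding monoid_algebra_mult
    using assms by (intro keys_sum_subset keys_single_subset) auto
qed

lemma scale_add:
  "Poly_Mapping.map ((*) (c::'k::field)) (f + g) = Poly_Mapping.map ((*) c) f + Poly_Mapping.map ((*) c) g"
  by (rule poly_mapping_eqI) (simp add: lookup_add algebra_simps)

lemma scale_zero [simp]: "Poly_Mapping.map ((*) (c::'k::field)) 0 = 0"
  by (rule poly_mapping_eqI) (simp)

text \<open>The axioms are multilinear, so induction on the support of each argument reduces them to
  single terms, where they are the monoid axioms and the field axioms.\<close>

lemma kalgebra_monoid_algebra:
  assumes "monoid M"
  shows "kalgebra (monoid_algebra M :: ('k::field, 'm \<Rightarrow>\<^sub>0 'k) module)"
proof -
  interpret M: monoid M by fact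
  let ?A = "monoid_algebra M :: ('k::field, 'm \<Rightarrow>\<^sub>0 'k) module"
  note cl = monoid_algebra_mult_closed[OF assms]
  have "abelian_group ?A"
  proof (rule abelian_groupI)
    fix f assume "f \<in> carrier ?A"
    then have "- f \<in> carrier ?A" "- f + f = 0" by (auto simp: in_keys_iff)
    then show "\<exists>g\<in>carrier ?A. g \<oplus>\<^bsub>?A\<^esub> f = \<zero>\<^bsub>?A\<^esub>" by (intro bexI[of _ "- f"]) simp_all
  qed (simp_all add: keys_add_subset ac_simps)
  moreover have "monoid ?A"
  proof (rule monoidI)
    fix f g h :: "'m \<Rightarrow>\<^sub>0 'k" assume a: "f \<in> carrier ?A" "g \<in> carrier ?A" "h \<in> carrier ?A"
    then have f: "Poly_Mapping.keys f \<subseteq> carrier M" and g: "Poly_Mapping.keys g \<subseteq> carrier M"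
      and h: "Poly_Mapping.keys h \<subseteq> carrier M" by auto
    show "f \<otimes>\<^bsub>?A\<^esub> g \<otimes>\<^bsub>?A\<^esub> h = f \<otimes>\<^bsub>?A\<^esub> (g \<otimes>\<^bsub>?A\<^esub> h)"
      using f
    proof (induct f rule: keys_subset_induct)
      case (add f u c)
      have "Poly_Mapping.single u c \<otimes>\<^bsub>?A\<^esub> g \<otimes>\<^bsub>?A\<^esub> h = Poly_Mapping.single u c \<otimes>\<^bsub>?A\<^esub> (g \<otimes>\<^bsub>?A\<^esub> h)"
        using g
      proof (induct g rule: keys_subset_induct)
        case (add g v d)
        have "Poly_Mapping.single u c \<otimes>\<^bsub>?A\<^esub> Poly_Mapping.single v d \<otimes>\<^bsub>?A\<^esub> h =
          Poly_Mapping.single u c \<otimes>\<^bsub>?A\<^esub> (Poly_Mapping.single v d \<otimes>\<^bsub>?A\<^esub> h)"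
          using h \<open>u \<in> carrier M\<close> \<open>v \<in> carrier M\<close>
          by (induct h rule: keys_subset_induct)
            (auto simp: monoid_algebra_l_distr monoid_algebra_r_distr M.m_assoc mult.assoc)
        with add show ?case by (simp add: monoid_algebra_l_distr monoid_algebra_r_distr)
      qed auto
      with add show ?case by (simp add: monoid_algebra_l_distr monoid_algebra_r_distr)
    qed auto
    show "\<one>\<^bsub>?A\<^esub> \<otimes>\<^bsub>?A\<^esub> f = f"
      using f by (induct f rule: keys_subset_induct) (auto simp: monoid_algebra_r_distr)
    show "f \<otimes>\<^bsub>?A\<^esub> \<one>\<^bsub>?A\<^esub> = f"
      using f by (induct f rule: keys_subset_induct) (auto simp: monoid_algebra_l_distr)
  qed (use cl in simp_all)
  ultimately have "ring ?A"
    by (rule ringI) (auto simp: monoid_algebra_l_distr monoid_algebra_r_distr)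
  moreover have "kalgebra_axioms ?A"
  proof (rule kalgebra_axioms.intro)
    fix f g :: "'m \<Rightarrow>\<^sub>0 'k" and c assume "f \<in> carrier ?A" "g \<in> carrier ?A"
    then have f: "Poly_Mapping.keys f \<subseteq> carrier M" and g: "Poly_Mapping.keys g \<subseteq> carrier M" by auto
    have *: "Poly_Mapping.single u (c*d) \<otimes>\<^bsub>?A\<^esub> g = c \<odot>\<^bsub>?A\<^esub> (Poly_Mapping.single u d \<otimes>\<^bsub>?A\<^esub> g)"
      if "u \<in> carrier M" for u d
      using g
      by (induct g rule: keys_subset_induct)
       (use that in \<open>auto simp: monoid_algebra_r_distr scale_add mult.assoc\<close>)
    show "c \<odot>\<^bsub>?A\<^esub> f \<otimes>\<^bsub>?A\<^esub> g = c \<odot>\<^bsub>?A\<^esub> (f \<otimes>\<^bsub>?A\<^esub> g)"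
      using f
      by (induct f rule: keys_subset_induct)
       (use * in \<open>auto simp: monoid_algebra_l_distr scale_add\<close>)
    have **: "Poly_Mapping.single u d \<otimes>\<^bsub>?A\<^esub> (c \<odot>\<^bsub>?A\<^esub> g) = c \<odot>\<^bsub>?A\<^esub> (Poly_Mapping.single u d \<otimes>\<^bsub>?A\<^esub> g)"
      if "u \<in> carrier M" for u d
      using g
      by (induct g rule: keys_subset_induct)
       (use that in \<open>auto simp: monoid_algebra_r_distr scale_add mult.left_commute\<close>)
    show "f \<otimes>\<^bsub>?A\<^esub> (c \<odot>\<^bsub>?A\<^esub> g) = c \<odot>\<^bsub>?A\<^esub> (f \<otimes>\<^bsub>?A\<^esub> g)"
      using f
      by (induct f rule: keys_subset_induct)
       (use ** in \<open>auto simp: monoid_algebra_l_distr scale_add\<close>)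
    show "c \<odot>\<^bsub>?A\<^esub> f \<in> carrier ?A" using f keys_scale[of c f] by auto
    show "c \<odot>\<^bsub>?A\<^esub> (f \<oplus>\<^bsub>?A\<^esub> g) = c \<odot>\<^bsub>?A\<^esub> f \<oplus>\<^bsub>?A\<^esub> c \<odot>\<^bsub>?A\<^esub> g"
      by (simp add: scale_add)
    fix d
    show "(c + d) \<odot>\<^bsub>?A\<^esub> f = c \<odot>\<^bsub>?A\<^esub> f \<oplus>\<^bsub>?A\<^esub> d \<odot>\<^bsub>?A\<^esub> f"
      "c \<odot>\<^bsub>?A\<^esub> (d \<odot>\<^bsub>?A\<^esub> f) = (c * d) \<odot>\<^bsub>?A\<^esub> f"
      "1 \<odot>\<^bsub>?A\<^esub> f = f"
      by (simp_all add: poly_mapping_eq_iff fun_eq_iff lookup_add algebra_simps)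
  qed
  ultimately show ?thesis by (rule kalgebra.intro)
qed

text \<open>A record with the same operations but other extra fields is not equal to the ring it
  came from, so the ring axioms are carried over operation by operation. It serves quotients and
  \<open>module.extend\<close>.\<close>

lemma ring_transfer:
  fixes R :: "('a, 'm) ring_scheme" and S :: "('a, 'n) ring_scheme"
  assumes "ring R" and eq: "carrier S = carrier R" "\<And>x y. x \<otimes>\<^bsub>S\<^esub> y = x \<otimes>\<^bsub>R\<^esub> y" "\<one>\<^bsub>S\<^esub> = \<one>\<^bsub>R\<^esub>"
    "\<And>x y. x \<oplus>\<^bsub>S\<^esub> y = x \<oplus>\<^bsub>R\<^esub> y" "\<zero>\<^bsub>S\<^esub> = \<zero>\<^bsub>R\<^esub>"
  shows "ring S"
proof -
  interpret ring R by fact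
  have "abelian_group S"
    by (rule abelian_groupI)
      (auto simp: eq a_assoc intro: a_comm bexI[where x = "\<ominus>\<^bsub>R\<^esub> x" for x] l_neg)
  moreover have "Group.monoid S" by (rule monoidI) (auto simp: eq m_assoc)
  ultimately show ?thesis by (rule ringI) (auto simp: eq l_distr r_distr)
qed

subsection \<open>Quotients\<close>

lemma quot_algebra_simps:
  "carrier (quot_algebra A I) = a_rcosets\<^bsub>A\<^esub> I"
  "X \<otimes>\<^bsub>quot_algebra A I\<^esub> Y = rcoset_mult A I X Y"
  "\<one>\<^bsub>quot_algebra A I\<^esub> = I +>\<^bsub>A\<^esub> \<one>\<^bsub>A\<^esub>"
  "\<zero>\<^bsub>quot_algebra A I\<^esub> = I"
  "X \<oplus>\<^bsub>quot_algebra A I\<^esub> Y = X <+>\<^bsub>A\<^esub> Y"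
  "c \<odot>\<^bsub>quot_algebra A I\<^esub> X = (\<Union>x \<in> X. I +>\<^bsub>A\<^esub> (c \<odot>\<^bsub>A\<^esub> x))"
  by (simp_all add: quot_algebra_def FactRing_def ring.defs module.defs)

text \<open>The scalar product is a union over all representatives. They give the same coset because
  the ideal is closed under scalars, \<open>c h\<close> being the product of \<open>c 1\<close> and
  \<open>h\<close>; so the union collapses.\<close>

lemma (in kalgebra) quot_algebra_smult:
  assumes "ideal I A" "x \<in> carrier A"
  shows "c \<odot>\<^bsub>quot_algebra A I\<^esub> (I +> x) = I +> (c \<odot> x)"
proof -
  interpret I: ideal I A by fact
  have *: "I +> (c \<odot> y) = I +> (c \<odot> x)" if y: "y \<in> I +> x" for y
  proof -
    from y obtain h where h: "h \<in> I" "y = h \<oplus> x"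
      by (auto simp: a_r_coset_def r_coset_def)
    then have hc: "h \<in> carrier A" by simp
    have "c \<odot> h = (c \<odot> \<one>) \<otimes> h" using hc by simp
    then have "c \<odot> h \<in> I" using h I.I_l_closed[of h "c \<odot> \<one>"] by simp
    moreover have "c \<odot> y = c \<odot> h \<oplus> c \<odot> x" using h hc assms by (simp add: smult_add_right)
    ultimately have "c \<odot> y \<in> I +> (c \<odot> x)" by (auto simp: a_r_coset_def r_coset_def)
    then show ?thesis using assms by (metis I.a_repr_independence' smult_closed)
  qed
  have "(\<Union>y\<in>I +> x. I +> (c \<odot> y)) = (\<Union>y\<in>I +> x. I +> (c \<odot> x))"
    by (rule SUP_cong[OF refl *])
  moreover have "I +> x \<noteq> {}" using I.a_rcos_self[OF assms(2)] by blast
  ultimately have "(\<Union>y\<in>I +> x. I +> (c \<odot> y)) = I +> (c \<odot> x)" by (simp only: UN_constant if_False)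
  then show ?thesis unfolding quot_algebra_simps .
qed

lemma (in kalgebra) quot_algebra_cosets:
  assumes "ideal I A"
  shows "carrier (quot_algebra A I) = (\<lambda>x. I +> x) ` carrier A"
    "\<lbrakk>x \<in> carrier A; y \<in> carrier A\<rbrakk> \<Longrightarrow> (I +> x) \<otimes>\<^bsub>quot_algebra A I\<^esub> (I +> y) = I +> (x \<otimes> y)"
    "\<lbrakk>x \<in> carrier A; y \<in> carrier A\<rbrakk> \<Longrightarrow> (I +> x) \<oplus>\<^bsub>quot_algebra A I\<^esub> (I +> y) = I +> (x \<oplus> y)"
    "x \<in> carrier A \<Longrightarrow> I +> x = \<zero>\<^bsub>quot_algebra A I\<^esub> \<longleftrightarrow> x \<in> I"
proof -
  interpret I: ideal I A by fact
  show "carrier (quot_algebra A I) = (\<lambda>x. I +> x) ` carrier A"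
    by (auto simp: quot_algebra_simps A_RCOSETS_def' )
  show "\<lbrakk>x \<in> carrier A; y \<in> carrier A\<rbrakk> \<Longrightarrow> (I +> x) \<otimes>\<^bsub>quot_algebra A I\<^esub> (I +> y) = I +> (x \<otimes> y)"
    by (simp add: quot_algebra_simps I.rcoset_mult_add)
  show "\<lbrakk>x \<in> carrier A; y \<in> carrier A\<rbrakk> \<Longrightarrow> (I +> x) \<oplus>\<^bsub>quot_algebra A I\<^esub> (I +> y) = I +> (x \<oplus> y)"
    by (simp add: quot_algebra_simps I.a_rcos_sum)
  show "x \<in> carrier A \<Longrightarrow> I +> x = \<zero>\<^bsub>quot_algebra A I\<^esub> \<longleftrightarrow> x \<in> I"
    unfolding quot_algebra_simps
    by (metis I.a_rcos_const I.a_rcos_self)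
qed

lemma kalgebra_quot_algebra:
  assumes "kalgebra A" "ideal I A"
  shows "kalgebra (quot_algebra A I)"
proof -
  interpret kalgebra A by fact
  interpret I: ideal I A by fact
  note c = quot_algebra_cosets[OF assms(2)] quot_algebra_smult[OF assms(2)]
  have "ring (quot_algebra A I)"
    by (rule ring_transfer[OF I.quotient_is_ring]) (simp_all add: quot_algebra_def ring.defs module.defs)
  moreover have "kalgebra_axioms (quot_algebra A I)"
    by (rule kalgebra_axioms.intro)
      (auto simp: c smult_add_left smult_add_right)
  ultimately show ?thesis by (rule kalgebra.intro)
qed

subsection \<open>Presentations\<close>

text \<open>\<open>presented\<close> has both \<open>tensor\<close> and \<open>U_algebra\<close> as
  instances: the monoid is the product of two multiplicative monoids in the first case and the words
  in the generators in the second.\<close>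

definition relator_ideal :: "('m, 'z) monoid_scheme \<Rightarrow> ('m \<Rightarrow>\<^sub>0 'k::field) set \<Rightarrow> ('m \<Rightarrow>\<^sub>0 'k) set" where
  "relator_ideal M R = genideal (monoid_algebra M) R"

definition presented ::
  "('m, 'z) monoid_scheme \<Rightarrow> ('m \<Rightarrow>\<^sub>0 'k::field) set \<Rightarrow> ('k, ('m \<Rightarrow>\<^sub>0 'k) set) module" where
  "presented M R = quot_algebra (monoid_algebra M) (relator_ideal M R)"

definition pres_class ::
  "('m, 'z) monoid_scheme \<Rightarrow> ('m \<Rightarrow>\<^sub>0 'k::field) set \<Rightarrow> ('m \<Rightarrow>\<^sub>0 'k) \<Rightarrow> ('m \<Rightarrow>\<^sub>0 'k) set" where
  "pres_class M R f = relator_ideal M R +>\<^bsub>monoid_algebra M\<^esub> f"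

text \<open>A linear map vanishes on the ideal generated by \<open>R\<close> as soon as it vanishes on the
  elements \<open>u r v\<close> with \<open>u\<close>, \<open>v\<close> in the monoid.\<close>

definition compatible ::
  "('m, 'z) monoid_scheme \<Rightarrow> ('m \<Rightarrow>\<^sub>0 'k::field) set \<Rightarrow> ('k, 'a, 'n) module_scheme \<Rightarrow> ('m \<Rightarrow> 'a) \<Rightarrow> bool"
  where "compatible M R V \<phi> \<longleftrightarrow> \<phi> \<in> carrier M \<rightarrow> carrier V \<and>
    (\<forall>r\<in>R. \<forall>u\<in>carrier M. \<forall>v\<in>carrier M.
      lin_ext V \<phi> (Poly_Mapping.single u 1 \<otimes>\<^bsub>monoid_algebra M\<^esub> r \<otimes>\<^bsub>monoid_algebra M\<^esub> Poly_Mapping.single v 1) = \<zero>\<^bsub>V\<^esub>)"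

lemma lin_ext_linear:
  assumes "kalgebra V" "\<phi> \<in> carrier M \<rightarrow> carrier V"
  shows "lin_ext V \<phi> \<in> linear_maps (monoid_algebra M) V"
proof -
  interpret V: kalgebra V by fact
  show ?thesis
    by (rule linear_mapsI)
      (use assms(2) in \<open>auto simp: V.lin_ext_closed V.lin_ext_add V.lin_ext_scale\<close>)
qed

lemma lin_ext_mult:
  assumes "monoid M" "kalgebra V" "\<phi> \<in> carrier M \<rightarrow> carrier V"
    "\<And>u v. u \<in> carrier M \<Longrightarrow> v \<in> carrier M \<Longrightarrow> \<phi> (u \<otimes>\<^bsub>M\<^esub> v) = \<phi> u \<otimes>\<^bsub>V\<^esub> \<phi> v"
    "Poly_Mapping.keys f \<subseteq> carrier M" "Poly_Mapping.keys g \<subseteq> carrier M"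
  shows "lin_ext V \<phi> (f \<otimes>\<^bsub>monoid_algebra M\<^esub> g) = lin_ext V \<phi> f \<otimes>\<^bsub>V\<^esub> lin_ext V \<phi> g"
proof -
  interpret V: kalgebra V by fact
  interpret M: monoid M by fact
  note \<phi> = assms(3)[THEN PiE]
  have \<phi>: "\<phi> u \<in> carrier V" if "u \<in> carrier M" for u using assms(3) that by auto
  note cl = V.lin_ext_closed[OF _ assms(3)] monoid_algebra_mult_closed[OF assms(1)]
  note ad = V.lin_ext_add[OF _ _ assms(3)]
  show ?thesis using assms(5)
  proof (induct f rule: keys_subset_induct)
    case zero then show ?case using cl(1)[OF assms(6)] by simp
  next
    case (add f u c)
    have "lin_ext V \<phi> (Poly_Mapping.single u c \<otimes>\<^bsub>monoid_algebra M\<^esub> g)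
      = c \<odot>\<^bsub>V\<^esub> \<phi> u \<otimes>\<^bsub>V\<^esub> lin_ext V \<phi> g"
      using assms(6)
    proof (induct g rule: keys_subset_induct)
      case zero then show ?case using add \<phi> by simp
    next
      case (add g v d)
      then show ?case using \<open>u \<in> carrier M\<close>
        by (simp add: monoid_algebra_r_distr ad cl V.lin_ext_single \<phi> V.r_distr assms(4) V.smult_add_right mult.commute)
    qed
    then show ?case using add assms(6)
      by (simp add: monoid_algebra_l_distr ad cl V.lin_ext_single \<phi> V.l_distr)
  qed
qed

locale presentation = monoid M for M :: "('m, 'z) monoid_scheme" (structure) +
  fixes R :: "('m \<Rightarrow>\<^sub>0 'k::field) set"
  assumes relators: "r \<in> R \<Longrightarrow> Poly_Mapping.keys r \<subseteq> carrier M"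
begin

abbreviation "F \<equiv> monoid_algebra M :: ('k, 'm \<Rightarrow>\<^sub>0 'k) module"
abbreviation "P \<equiv> presented M R"
abbreviation "cl \<equiv> pres_class M R"

sublocale F: kalgebra F by (rule kalgebra_monoid_algebra) (rule monoid_axioms)

lemma ideal_relator_ideal: "ideal (relator_ideal M R) F"
  unfolding relator_ideal_def by (rule F.genideal_ideal) (use relators in auto)

sublocale P: kalgebra P
  unfolding presented_def by (rule kalgebra_quot_algebra[OF F.kalgebra_axioms ideal_relator_ideal])

lemma carrier_presented: "carrier P = cl ` {f. Poly_Mapping.keys f \<subseteq> carrier M}"
  using F.quot_algebra_cosets(1)[OF ideal_relator_ideal]
  unfolding presented_def pres_class_def by simp

lemma pres_class_closed: "Poly_Mapping.keys f \<subseteq> carrier M \<Longrightarrow> cl f \<in> carrier P"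
  unfolding carrier_presented by auto

lemma pres_class_add: "\<lbrakk>Poly_Mapping.keys f \<subseteq> carrier M; Poly_Mapping.keys g \<subseteq> carrier M\<rbrakk> \<Longrightarrow>
   cl (f + g) = cl f \<oplus>\<^bsub>P\<^esub> cl g"
  using F.quot_algebra_cosets(3)[OF ideal_relator_ideal, of f g]
  unfolding presented_def pres_class_def by simp

lemma pres_class_mult: "\<lbrakk>Poly_Mapping.keys f \<subseteq> carrier M; Poly_Mapping.keys g \<subseteq> carrier M\<rbrakk> \<Longrightarrow>
   cl (f \<otimes>\<^bsub>F\<^esub> g) = cl f \<otimes>\<^bsub>P\<^esub> cl g"
  using F.quot_algebra_cosets(2)[OF ideal_relator_ideal, of f g]
  unfolding presented_def pres_class_def by simp

lemma pres_class_scale: "Poly_Mapping.keys f \<subseteq> carrier M \<Longrightarrow>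
   cl (Poly_Mapping.map ((*) c) f) = c \<odot>\<^bsub>P\<^esub> cl f"
  using F.quot_algebra_smult[OF ideal_relator_ideal, of f c]
  unfolding presented_def pres_class_def by simp

lemma pres_class_one: "cl (Poly_Mapping.single \<one> 1) = \<one>\<^bsub>P\<^esub>"
  unfolding presented_def pres_class_def quot_algebra_simps by simp

lemma pres_class_eq_zero_iff: "Poly_Mapping.keys f \<subseteq> carrier M \<Longrightarrow> cl f = \<zero>\<^bsub>P\<^esub> \<longleftrightarrow> f \<in> relator_ideal M R"
  using F.quot_algebra_cosets(4)[OF ideal_relator_ideal, of f]
  unfolding presented_def pres_class_def by simp

lemma pres_class_relator: "r \<in> R \<Longrightarrow> cl r = \<zero>\<^bsub>P\<^esub>"
  using pres_class_eq_zero_iff[OF relators] F.genideal_self[of R] relators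
  by (auto simp: relator_ideal_def)

lemma pres_class_zero: "cl 0 = \<zero>\<^bsub>P\<^esub>"
  using pres_class_scale[of 0 0] pres_class_closed[of 0] by simp

lemma pres_class_diff:
  assumes "Poly_Mapping.keys f \<subseteq> carrier M" "Poly_Mapping.keys g \<subseteq> carrier M"
  shows "cl (f - g) = cl f \<ominus>\<^bsub>P\<^esub> cl g"
proof -
  have "cl f = cl (f - g) \<oplus>\<^bsub>P\<^esub> cl g"
    using pres_class_add[OF keys_diff_subset[OF assms] assms(2)] by simp
  then show ?thesis
    using pres_class_closed[OF assms(1)] pres_class_closed[OF assms(2)]
      pres_class_closed[OF keys_diff_subset[OF assms]]
    by (simp add: P.minus_eq P.a_assoc P.r_neg)
qed

lemma pres_class_single: "u \<in> carrier M \<Longrightarrow>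
  cl (Poly_Mapping.single u c) = c \<odot>\<^bsub>P\<^esub> cl (Poly_Mapping.single u 1)"
  using pres_class_scale[of "Poly_Mapping.single u 1" c] by simp

lemma presented_induct [consumes 1, case_names single add smult]:
  assumes "z \<in> carrier P"
    and s: "\<And>u. u \<in> carrier M \<Longrightarrow> Q (cl (Poly_Mapping.single u 1))"
    and a: "\<And>y z. y \<in> carrier P \<Longrightarrow> z \<in> carrier P \<Longrightarrow> Q y \<Longrightarrow> Q z \<Longrightarrow> Q (y \<oplus>\<^bsub>P\<^esub> z)"
    and m: "\<And>c z. z \<in> carrier P \<Longrightarrow> Q z \<Longrightarrow> Q (c \<odot>\<^bsub>P\<^esub> z)"
  shows "Q z"
proof -
  obtain f where f: "Poly_Mapping.keys f \<subseteq> carrier M" "z = cl f"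
    using assms(1) unfolding carrier_presented by auto
  show ?thesis unfolding f(2) using f(1)
  proof (induct f rule: keys_subset_induct)
    case zero
    \<comment> \<open>Zero is 0 times the unit, so the rule needs no separate case for it.\<close>
    then show ?case
      using m[of "\<one>\<^bsub>P\<^esub>" 0] s[OF one_closed] by (simp add: pres_class_zero pres_class_one)
  next
    case (add f u c)
    then show ?case
      by (subst pres_class_add, simp, simp, subst pres_class_single, simp)
        (intro a m s, simp_all add: pres_class_closed)
  qed
qed

text \<open>J, the set of f with all p f q in the kernel of the linear extension, is the largest
  two-sided ideal inside that kernel. It contains R: compatibility gives this for monoid elements p
  and q, linearity for all others. Hence it contains the generated ideal, and p = q = 1
  concludes.\<close>

lemma compatible_relator_ideal:
  assumes V: "kalgebra V" and \<phi>: "compatible M R V \<phi>" and f: "f \<in> relator_ideal M R"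
  shows "lin_ext V \<phi> f = \<zero>\<^bsub>V\<^esub>"
proof -
  interpret V: kalgebra V by fact
  have \<phi>1: "\<phi> \<in> carrier M \<rightarrow> carrier V" using \<phi> by (auto simp: compatible_def)
  note lin = lin_ext_linear[OF V \<phi>1]
  note linD = linear_mapsD[OF lin]
  define J where "J = {f \<in> carrier F. \<forall>p\<in>carrier F. \<forall>q\<in>carrier F. lin_ext V \<phi> (p \<otimes>\<^bsub>F\<^esub> f \<otimes>\<^bsub>F\<^esub> q) = \<zero>\<^bsub>V\<^esub>}"
  have "ideal J F"
  proof (rule idealI)
    show "ring F" by (rule F.ring_axioms)
    show "subgroup J (add_monoid F)"
    proof (rule subgroup.intro)
      fix x assume x: "x \<in> J"
      then have xc: "x \<in> carrier F" by (auto simp: J_def)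
      have "\<ominus>\<^bsub>F\<^esub> x \<in> J"
        using x unfolding J_def
        by (auto simp del: monoid_algebra_simps simp: F.r_minus F.l_minus linear_maps_a_inv[OF F.kalgebra_axioms V lin])
      then show "inv\<^bsub>add_monoid F\<^esub> x \<in> J" by (simp add: a_inv_def)
    qed (auto simp del: monoid_algebra_simps simp: J_def F.l_distr F.r_distr linD
        linear_maps_zero[OF F.kalgebra_axioms V lin])
    fix f x assume f: "f \<in> J" and x: "x \<in> carrier F"
    then have fc: "f \<in> carrier F" by (simp add: J_def del: monoid_algebra_simps)
    have J: "lin_ext V \<phi> (p \<otimes>\<^bsub>F\<^esub> f \<otimes>\<^bsub>F\<^esub> q) = \<zero>\<^bsub>V\<^esub>" if "p \<in> carrier F" "q \<in> carrier F" for p q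
      using f that by (simp add: J_def del: monoid_algebra_simps)
    have "lin_ext V \<phi> (p \<otimes>\<^bsub>F\<^esub> (x \<otimes>\<^bsub>F\<^esub> f) \<otimes>\<^bsub>F\<^esub> q) = \<zero>\<^bsub>V\<^esub>" if "p \<in> carrier F" "q \<in> carrier F" for p q
      using J[of "p \<otimes>\<^bsub>F\<^esub> x" q] x fc that
      by (simp add: F.m_assoc F.m_closed del: monoid_algebra_simps)
    then show "x \<otimes>\<^bsub>F\<^esub> f \<in> J"
      using x fc F.m_closed[OF x fc] by (simp add: J_def del: monoid_algebra_simps)
    have "lin_ext V \<phi> (p \<otimes>\<^bsub>F\<^esub> (f \<otimes>\<^bsub>F\<^esub> x) \<otimes>\<^bsub>F\<^esub> q) = \<zero>\<^bsub>V\<^esub>" if "p \<in> carrier F" "q \<in> carrier F" for p q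
      using J[of p "x \<otimes>\<^bsub>F\<^esub> q"] x fc that
      by (simp add: F.m_assoc F.m_closed del: monoid_algebra_simps)
    then show "f \<otimes>\<^bsub>F\<^esub> x \<in> J"
      using x fc F.m_closed[OF fc x] by (simp add: J_def del: monoid_algebra_simps)
  qed
  moreover have "R \<subseteq> J"
  proof
    fix r assume r: "r \<in> R"
    then have rc: "r \<in> carrier F" using relators by simp
    have 1: "lin_ext V \<phi> (p \<otimes>\<^bsub>F\<^esub> r \<otimes>\<^bsub>F\<^esub> Poly_Mapping.single v 1) = \<zero>\<^bsub>V\<^esub>"
      if p: "Poly_Mapping.keys p \<subseteq> carrier M" and v: "v \<in> carrier M" for p v
      using p
    proof (induct p rule: keys_subset_induct)
      case (add f u c)
      have "f \<in> carrier F" "Poly_Mapping.single u 1 \<in> carrier F" "Poly_Mapping.single v 1 \<in> carrier F"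
        using add v by auto
      note C = this rc
      have e: "f + Poly_Mapping.single u c = f \<oplus>\<^bsub>F\<^esub> c \<odot>\<^bsub>F\<^esub> Poly_Mapping.single u 1" by simp
      have "lin_ext V \<phi> (Poly_Mapping.single u 1 \<otimes>\<^bsub>F\<^esub> r \<otimes>\<^bsub>F\<^esub> Poly_Mapping.single v 1) = \<zero>\<^bsub>V\<^esub>"
        using \<phi> r add v by (auto simp: compatible_def)
      then show ?case
        unfolding e using C add(3)
        by (simp del: monoid_algebra_simps monoid_algebra_mult_single
            add: F.l_distr F.r_distr linD)
    qed auto
    have 2: "lin_ext V \<phi> (p \<otimes>\<^bsub>F\<^esub> r \<otimes>\<^bsub>F\<^esub> q) = \<zero>\<^bsub>V\<^esub>"
      if p: "Poly_Mapping.keys p \<subseteq> carrier M" and q: "Poly_Mapping.keys q \<subseteq> carrier M" for p q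
      using q
    proof (induct q rule: keys_subset_induct)
      case (add f u c)
      have "f \<in> carrier F" "Poly_Mapping.single u 1 \<in> carrier F" "p \<in> carrier F"
        using add p by auto
      note C = this rc
      have e: "f + Poly_Mapping.single u c = f \<oplus>\<^bsub>F\<^esub> c \<odot>\<^bsub>F\<^esub> Poly_Mapping.single u 1" by simp
      show ?case
        unfolding e using C add(3) 1[OF p add(2)]
        by (simp del: monoid_algebra_simps monoid_algebra_mult_single
            add: F.l_distr F.r_distr linD)
    qed auto
    show "r \<in> J" unfolding J_def using rc 2 by simp
  qed
  ultimately have "f \<in> J" using f F.genideal_minimal unfolding relator_ideal_def by auto
  then have c: "f \<in> carrier F \<and> (\<forall>p\<in>carrier F. \<forall>q\<in>carrier F. lin_ext V \<phi> (p \<otimes>\<^bsub>F\<^esub> f \<otimes>\<^bsub>F\<^esub> q) = \<zero>\<^bsub>V\<^esub>)"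
    unfolding J_def by (rule CollectD)
  have "lin_ext V \<phi> (\<one>\<^bsub>F\<^esub> \<otimes>\<^bsub>F\<^esub> f \<otimes>\<^bsub>F\<^esub> \<one>\<^bsub>F\<^esub>) = \<zero>\<^bsub>V\<^esub>"
    by (rule c[THEN conjunct2, THEN bspec, OF F.one_closed, THEN bspec, OF F.one_closed])
  then show ?thesis
    by (simp only: F.l_one[OF c[THEN conjunct1]] F.r_one[OF c[THEN conjunct1]])
qed

text \<open>Two representatives of a coset differ by an element of the ideal, which the linear
  extension kills. The image of the coset is therefore a singleton, and \<open>the_elem\<close> has
  its intended value.\<close>

lemma induced_pres_class:
  assumes V: "kalgebra V" and \<phi>: "compatible M R V \<phi>" and f: "Poly_Mapping.keys f \<subseteq> carrier M"
  shows "induced V \<phi> (cl f) = lin_ext V \<phi> f"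
proof -
  interpret V: kalgebra V by fact
  interpret I: ideal "relator_ideal M R" F by (rule ideal_relator_ideal)
  have \<phi>1: "\<phi> \<in> carrier M \<rightarrow> carrier V" using \<phi> by (auto simp: compatible_def)
  have *: "lin_ext V \<phi> g = lin_ext V \<phi> f" if "g \<in> cl f" for g
  proof -
    from that obtain h where h: "h \<in> relator_ideal M R" "g = h + f"
      by (auto simp: pres_class_def a_r_coset_def r_coset_def)
    have "Poly_Mapping.keys h \<subseteq> carrier M" using I.a_Hcarr[OF h(1)] by simp
    then show ?thesis
      using V.lin_ext_add[OF _ f \<phi>1, of h] V.lin_ext_closed[OF f \<phi>1]
        compatible_relator_ideal[OF V \<phi> h(1)] h by simp
  qed
  have "f \<in> cl f" unfolding pres_class_def using I.a_rcos_self[of f] f by simp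
  moreover have "lin_ext V \<phi> ` cl f = (\<lambda>_. lin_ext V \<phi> f) ` cl f" by (rule image_cong[OF refl *])
  ultimately have "lin_ext V \<phi> ` cl f = {lin_ext V \<phi> f}" by (simp only: image_constant)
  then show ?thesis by (simp add: induced_def)
qed

lemma induced_single:
  assumes V: "kalgebra V" and \<phi>: "compatible M R V \<phi>" and u: "u \<in> carrier M"
  shows "induced V \<phi> (cl (Poly_Mapping.single u 1)) = \<phi> u"
proof -
  interpret V: kalgebra V by fact
  have "\<phi> u \<in> carrier V" using \<phi> u by (auto simp: compatible_def)
  then show ?thesis using u by (simp add: induced_pres_class[OF V \<phi>] V.lin_ext_single)
qed

lemma induced_linear:
  assumes V: "kalgebra V" and \<phi>: "compatible M R V \<phi>"
  shows "induced V \<phi> \<in> linear_maps P V"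
proof -
  have \<phi>1: "\<phi> \<in> carrier M \<rightarrow> carrier V" using \<phi> by (auto simp: compatible_def)
  note lin = linear_mapsD[OF lin_ext_linear[OF V \<phi>1]]
  note i = induced_pres_class[OF V \<phi>]
  show ?thesis
  proof (rule linear_mapsI)
    fix x y c assume "x \<in> carrier P" "y \<in> carrier P"
    then obtain f g where f: "Poly_Mapping.keys f \<subseteq> carrier M" "x = cl f"
      and g: "Poly_Mapping.keys g \<subseteq> carrier M" "y = cl g"
      unfolding carrier_presented by auto
    show "induced V \<phi> x \<in> carrier V" using f lin(1)[of f] by (simp add: i)
    show "induced V \<phi> (x \<oplus>\<^bsub>P\<^esub> y) = induced V \<phi> x \<oplus>\<^bsub>V\<^esub> induced V \<phi> y"
      using f g lin(2)[of f g] by (simp add: i pres_class_add[symmetric] keys_add_subset)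
    show "induced V \<phi> (c \<odot>\<^bsub>P\<^esub> x) = c \<odot>\<^bsub>V\<^esub> induced V \<phi> x"
      using f lin(3)[of f c] keys_scale[of c f] by (simp add: i pres_class_scale[symmetric])
  qed
qed

lemma induced_alg_hom:
  assumes V: "kalgebra V" and \<phi>: "compatible M R V \<phi>"
    and m: "\<And>u v. u \<in> carrier M \<Longrightarrow> v \<in> carrier M \<Longrightarrow> \<phi> (u \<otimes> v) = \<phi> u \<otimes>\<^bsub>V\<^esub> \<phi> v"
    and o: "\<phi> \<one> = \<one>\<^bsub>V\<^esub>"
  shows "induced V \<phi> \<in> alg_hom P V"
proof (rule alg_homI)
  have \<phi>1: "\<phi> \<in> carrier M \<rightarrow> carrier V" using \<phi> by (auto simp: compatible_def)
  note i = induced_pres_class[OF V \<phi>]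
  show "induced V \<phi> \<in> linear_maps P V" by (rule induced_linear[OF V \<phi>])
  show "induced V \<phi> \<one>\<^bsub>P\<^esub> = \<one>\<^bsub>V\<^esub>"
    using induced_single[OF V \<phi> one_closed] by (simp add: pres_class_one o)
  fix x y assume "x \<in> carrier P" "y \<in> carrier P"
  then obtain f g where f: "Poly_Mapping.keys f \<subseteq> carrier M" "x = cl f"
    and g: "Poly_Mapping.keys g \<subseteq> carrier M" "y = cl g"
    unfolding carrier_presented by auto
  show "induced V \<phi> (x \<otimes>\<^bsub>P\<^esub> y) = induced V \<phi> x \<otimes>\<^bsub>V\<^esub> induced V \<phi> y"
    using f g lin_ext_mult[OF monoid_axioms V \<phi>1 m f(1) g(1)]
    by (simp add: i pres_class_mult[symmetric] monoid_algebra_mult_closed[OF monoid_axioms])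
qed

text \<open>For a multiplicative assignment the value at \<open>u r v\<close> is a product with the
  value at \<open>r\<close> as a factor, so the relators alone have to be tested.\<close>

lemma compatibleI_mult:
  assumes V: "kalgebra V" and \<phi>: "\<phi> \<in> carrier M \<rightarrow> carrier V"
    and m: "\<And>u v. u \<in> carrier M \<Longrightarrow> v \<in> carrier M \<Longrightarrow> \<phi> (u \<otimes> v) = \<phi> u \<otimes>\<^bsub>V\<^esub> \<phi> v"
    and r: "\<And>r. r \<in> R \<Longrightarrow> lin_ext V \<phi> r = \<zero>\<^bsub>V\<^esub>"
  shows "compatible M R V \<phi>"
proof -
  interpret V: kalgebra V by fact
  have "lin_ext V \<phi> (Poly_Mapping.single u 1 \<otimes>\<^bsub>F\<^esub> r \<otimes>\<^bsub>F\<^esub> Poly_Mapping.single v 1) = \<zero>\<^bsub>V\<^esub>"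
    if "r \<in> R" "u \<in> carrier M" "v \<in> carrier M" for r u v
  proof -
    let ?s = "\<lambda>u. Poly_Mapping.single u 1 :: 'm \<Rightarrow>\<^sub>0 'k"
    have k: "Poly_Mapping.keys (?s u) \<subseteq> carrier M" "Poly_Mapping.keys (?s v) \<subseteq> carrier M"
      "Poly_Mapping.keys r \<subseteq> carrier M"
      using that relators by auto
    have k': "Poly_Mapping.keys (?s u \<otimes>\<^bsub>F\<^esub> r) \<subseteq> carrier M"
      by (rule monoid_algebra_mult_closed[OF monoid_axioms k(1,3)])
    show ?thesis
      using lin_ext_mult[OF monoid_axioms V \<phi> m k' k(2)] lin_ext_mult[OF monoid_axioms V \<phi> m k(1,3)]
        V.lin_ext_closed[OF k(1) \<phi>] V.lin_ext_closed[OF k(2) \<phi>] r[OF that(1)]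
      by (simp del: monoid_algebra_simps)
  qed
  then show ?thesis using \<phi> unfolding compatible_def by blast
qed

end

section \<open>Tensor products\<close>

definition bilinear_map ::
  "('k::field, 'a, 'm) module_scheme \<Rightarrow> ('k, 'b, 'n) module_scheme \<Rightarrow> ('k, 'c, 'l) module_scheme \<Rightarrow>
    ('a \<Rightarrow> 'b \<Rightarrow> 'c) \<Rightarrow> bool" where
  "bilinear_map A B V f \<longleftrightarrow>
    (\<forall>b\<in>carrier B. (\<lambda>a. f a b) \<in> linear_maps A V) \<and> (\<forall>a\<in>carrier A. f a \<in> linear_maps B V)"

lemma bilinear_mapI:
  fixes A :: "('k::field, 'a, 'm) module_scheme"
  assumes "\<And>a b. \<lbrakk>a \<in> carrier A; b \<in> carrier B\<rbrakk> \<Longrightarrow> f a b \<in> carrier V"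
    "\<And>a a' b. \<lbrakk>a \<in> carrier A; a' \<in> carrier A; b \<in> carrier B\<rbrakk> \<Longrightarrow> f (a \<oplus>\<^bsub>A\<^esub> a') b = f a b \<oplus>\<^bsub>V\<^esub> f a' b"
    "\<And>a b b'. \<lbrakk>a \<in> carrier A; b \<in> carrier B; b' \<in> carrier B\<rbrakk> \<Longrightarrow> f a (b \<oplus>\<^bsub>B\<^esub> b') = f a b \<oplus>\<^bsub>V\<^esub> f a b'"
    "\<And>c a b. \<lbrakk>a \<in> carrier A; b \<in> carrier B\<rbrakk> \<Longrightarrow> f (c \<odot>\<^bsub>A\<^esub> a) b = c \<odot>\<^bsub>V\<^esub> f a b"
    "\<And>c a b. \<lbrakk>a \<in> carrier A; b \<in> carrier B\<rbrakk> \<Longrightarrow> f a (c \<odot>\<^bsub>B\<^esub> b) = c \<odot>\<^bsub>V\<^esub> f a b"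
  shows "bilinear_map A B V f"
  unfolding bilinear_map_def using assms by (auto intro!: linear_mapsI)

lemma bilinear_mapD:
  fixes A :: "('k::field, 'a, 'm) module_scheme"
  assumes "bilinear_map A B V f"
  shows "\<lbrakk>a \<in> carrier A; b \<in> carrier B\<rbrakk> \<Longrightarrow> f a b \<in> carrier V"
    "\<lbrakk>a \<in> carrier A; a' \<in> carrier A; b \<in> carrier B\<rbrakk> \<Longrightarrow> f (a \<oplus>\<^bsub>A\<^esub> a') b = f a b \<oplus>\<^bsub>V\<^esub> f a' b"
    "\<lbrakk>a \<in> carrier A; b \<in> carrier B; b' \<in> carrier B\<rbrakk> \<Longrightarrow> f a (b \<oplus>\<^bsub>B\<^esub> b') = f a b \<oplus>\<^bsub>V\<^esub> f a b'"
    "\<lbrakk>a \<in> carrier A; b \<in> carrier B\<rbrakk> \<Longrightarrow> f (c \<odot>\<^bsub>A\<^esub> a) b = c \<odot>\<^bsub>V\<^esub> f a b"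
    "\<lbrakk>a \<in> carrier A; b \<in> carrier B\<rbrakk> \<Longrightarrow> f a (c \<odot>\<^bsub>B\<^esub> b) = c \<odot>\<^bsub>V\<^esub> f a b"
proof -
  have 1: "b \<in> carrier B \<Longrightarrow> (\<lambda>a. f a b) \<in> linear_maps A V" for b
    using assms by (auto simp: bilinear_map_def)
  have 2: "a \<in> carrier A \<Longrightarrow> f a \<in> linear_maps B V" for a
    using assms by (auto simp: bilinear_map_def)
  show "\<lbrakk>a \<in> carrier A; b \<in> carrier B\<rbrakk> \<Longrightarrow> f a b \<in> carrier V"
    using linear_mapsD(1)[OF 2] by blast
  show "\<lbrakk>a \<in> carrier A; a' \<in> carrier A; b \<in> carrier B\<rbrakk> \<Longrightarrow> f (a \<oplus>\<^bsub>A\<^esub> a') b = f a b \<oplus>\<^bsub>V\<^esub> f a' b"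
    using linear_mapsD(2)[OF 1] by blast
  show "\<lbrakk>a \<in> carrier A; b \<in> carrier B; b' \<in> carrier B\<rbrakk> \<Longrightarrow> f a (b \<oplus>\<^bsub>B\<^esub> b') = f a b \<oplus>\<^bsub>V\<^esub> f a b'"
    using linear_mapsD(2)[OF 2] by blast
  show "\<lbrakk>a \<in> carrier A; b \<in> carrier B\<rbrakk> \<Longrightarrow> f (c \<odot>\<^bsub>A\<^esub> a) b = c \<odot>\<^bsub>V\<^esub> f a b"
    using linear_mapsD(3)[OF 1] by blast
  show "\<lbrakk>a \<in> carrier A; b \<in> carrier B\<rbrakk> \<Longrightarrow> f a (c \<odot>\<^bsub>B\<^esub> b) = c \<odot>\<^bsub>V\<^esub> f a b"
    using linear_mapsD(3)[OF 2] by blast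
qed

lemma monoid_algebra_l_diff:
  fixes f f' g :: "'m \<Rightarrow>\<^sub>0 'k::field"
  shows "(f - f') \<otimes>\<^bsub>monoid_algebra M\<^esub> g = f \<otimes>\<^bsub>monoid_algebra M\<^esub> g - f' \<otimes>\<^bsub>monoid_algebra M\<^esub> g"
  using monoid_algebra_l_distr[where f = "f - f'" and f' = f' and g = g and M = M] by simp

lemma monoid_algebra_r_diff:
  fixes f g g' :: "'m \<Rightarrow>\<^sub>0 'k::field"
  shows "f \<otimes>\<^bsub>monoid_algebra M\<^esub> (g - g') = f \<otimes>\<^bsub>monoid_algebra M\<^esub> g - f \<otimes>\<^bsub>monoid_algebra M\<^esub> g'"
  using monoid_algebra_r_distr[where f = f and g = "g - g'" and g' = g' and M = M] by simp

lemma (in kalgebra) add_minus_minus: "\<lbrakk>x \<in> carrier A; y \<in> carrier A\<rbrakk> \<Longrightarrow> x \<oplus> y \<ominus> x \<ominus> y = \<zero>"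
  by (simp add: minus_eq a_comm[of x y] a_assoc r_neg)

locale two_algebras = A: kalgebra A + B: kalgebra B
  for A :: "('k::field, 'a, 'm) module_scheme" and B :: "('k, 'b, 'n) module_scheme"
begin

sublocale pr: presentation "A \<times>\<times> B" "bilinear_relators A B"
proof -
  interpret monoid "A \<times>\<times> B" by (rule DirProd_monoid) (rule A.is_monoid B.is_monoid)+
  show "presentation (A \<times>\<times> B) (bilinear_relators A B)"
    unfolding bilinear_relators_def
    by unfold_locales
      (elim UnE CollectE exE conjE; hypsubst; intro keys_diff_subset keys_single_subset; simp)
qed

lemma tensor_eq: "tensor A B = presented (A \<times>\<times> B) (bilinear_relators A B)"
  by (simp add: tensor_def presented_def bilinear_ideal_def relator_ideal_def)

lemma pure_eq: "pure_tensor A B a b = pres_class (A \<times>\<times> B) (bilinear_relators A B) (Poly_Mapping.single (a, b) 1)"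
  by (simp add: pure_tensor_def pres_class_def bilinear_ideal_def relator_ideal_def)

sublocale T: kalgebra "tensor A B" unfolding tensor_eq by (rule pr.P.kalgebra_axioms)

lemma pure_closed: "\<lbrakk>a \<in> carrier A; b \<in> carrier B\<rbrakk> \<Longrightarrow> pure_tensor A B a b \<in> carrier (tensor A B)"
  unfolding pure_eq tensor_eq by (rule pr.pres_class_closed) simp

lemma pure_mult: "\<lbrakk>a \<in> carrier A; b \<in> carrier B; a' \<in> carrier A; b' \<in> carrier B\<rbrakk> \<Longrightarrow>
  pure_tensor A B a b \<otimes>\<^bsub>tensor A B\<^esub> pure_tensor A B a' b' = pure_tensor A B (a \<otimes>\<^bsub>A\<^esub> a') (b \<otimes>\<^bsub>B\<^esub> b')"
  unfolding pure_eq tensor_eq by (subst pr.pres_class_mult[symmetric]) simp_all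

lemma pure_one: "\<one>\<^bsub>tensor A B\<^esub> = pure_tensor A B \<one>\<^bsub>A\<^esub> \<one>\<^bsub>B\<^esub>"
  unfolding pure_eq tensor_eq using pr.pres_class_one by simp

lemma relator_add_eq:
  assumes "Poly_Mapping.single x 1 - Poly_Mapping.single y 1 - Poly_Mapping.single z 1 \<in> bilinear_relators A B"
    "x \<in> carrier (A \<times>\<times> B)" "y \<in> carrier (A \<times>\<times> B)" "z \<in> carrier (A \<times>\<times> B)"
  shows "pr.cl (Poly_Mapping.single x 1) = pr.cl (Poly_Mapping.single y 1) \<oplus>\<^bsub>pr.P\<^esub> pr.cl (Poly_Mapping.single z 1)"
proof -
  let ?s = "\<lambda>x. Poly_Mapping.single x (1::'k)"
  have k: "Poly_Mapping.keys (?s x) \<subseteq> carrier (A \<times>\<times> B)" "Poly_Mapping.keys (?s y) \<subseteq> carrier (A \<times>\<times> B)"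
    "Poly_Mapping.keys (?s z) \<subseteq> carrier (A \<times>\<times> B)" using assms by auto
  have r: "pr.cl (?s x - ?s y - ?s z) = \<zero>\<^bsub>pr.P\<^esub>"
    by (rule pr.pres_class_relator) (rule assms(1))
  have "pr.cl (?s x) = pr.cl ((?s x - ?s y - ?s z) + (?s y + ?s z))" by simp
  also have "\<dots> = pr.cl (?s x - ?s y - ?s z) \<oplus>\<^bsub>pr.P\<^esub> (pr.cl (?s y) \<oplus>\<^bsub>pr.P\<^esub> pr.cl (?s z))"
    using k by (simp only: pr.pres_class_add keys_diff_subset keys_add_subset)
  finally show ?thesis using r k pr.pres_class_closed by simp
qed

lemma relator_smult_eq:
  assumes "Poly_Mapping.single x 1 - Poly_Mapping.single y c \<in> bilinear_relators A B"
    "x \<in> carrier (A \<times>\<times> B)" "y \<in> carrier (A \<times>\<times> B)"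
  shows "pr.cl (Poly_Mapping.single x 1) = c \<odot>\<^bsub>pr.P\<^esub> pr.cl (Poly_Mapping.single y 1)"
proof -
  have k: "Poly_Mapping.keys (Poly_Mapping.single x (1::'k)) \<subseteq> carrier (A \<times>\<times> B)"
    "Poly_Mapping.keys (Poly_Mapping.single y c) \<subseteq> carrier (A \<times>\<times> B)"
    using assms by auto
  have "pr.cl (Poly_Mapping.single x 1) =
    pr.cl ((Poly_Mapping.single x 1 - Poly_Mapping.single y c) + Poly_Mapping.single y c)" by simp
  also have "\<dots> = pr.cl (Poly_Mapping.single x 1 - Poly_Mapping.single y c) \<oplus>\<^bsub>pr.P\<^esub> pr.cl (Poly_Mapping.single y c)"
    using k by (simp only: pr.pres_class_add keys_diff_subset)
  also have "\<dots> = pr.cl (Poly_Mapping.single y c)"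
    using pr.pres_class_relator[OF assms(1)] k pr.pres_class_closed by simp
  finally show ?thesis by (simp only: pr.pres_class_single[OF assms(3), of c])
qed

lemma bilinear_pure: "bilinear_map A B (tensor A B) (pure_tensor A B)"
proof (rule bilinear_mapI)
  fix a a' b assume a: "a \<in> carrier A" "a' \<in> carrier A" "b \<in> carrier B"
  show "pure_tensor A B (a \<oplus>\<^bsub>A\<^esub> a') b = pure_tensor A B a b \<oplus>\<^bsub>tensor A B\<^esub> pure_tensor A B a' b"
    unfolding pure_eq tensor_eq
    by (rule relator_add_eq, unfold bilinear_relators_def, use a in blast, use a in auto)
next
  fix a b b' assume a: "a \<in> carrier A" "b \<in> carrier B" "b' \<in> carrier B"
  show "pure_tensor A B a (b \<oplus>\<^bsub>B\<^esub> b') = pure_tensor A B a b \<oplus>\<^bsub>tensor A B\<^esub> pure_tensor A B a b'"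
    unfolding pure_eq tensor_eq
    by (rule relator_add_eq, unfold bilinear_relators_def, use a in blast, use a in auto)
next
  fix c a b assume a: "a \<in> carrier A" "b \<in> carrier B"
  show "pure_tensor A B (c \<odot>\<^bsub>A\<^esub> a) b = c \<odot>\<^bsub>tensor A B\<^esub> pure_tensor A B a b"
    unfolding pure_eq tensor_eq
    by (rule relator_smult_eq, unfold bilinear_relators_def, use a in blast, use a in auto)
  show "pure_tensor A B a (c \<odot>\<^bsub>B\<^esub> b) = c \<odot>\<^bsub>tensor A B\<^esub> pure_tensor A B a b"
    unfolding pure_eq tensor_eq
    by (rule relator_smult_eq, unfold bilinear_relators_def, use a in blast, use a in auto)
qed (rule pure_closed)

lemmas pure_add_left = bilinear_mapD(2)[OF bilinear_pure]
  and pure_add_right = bilinear_mapD(3)[OF bilinear_pure]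
  and pure_smult_left = bilinear_mapD(4)[OF bilinear_pure]
  and pure_smult_right = bilinear_mapD(5)[OF bilinear_pure]

text \<open>Scalars are absorbed into the left factor, so pure tensors span already under addition.
  The proof carries an arbitrary scalar along, since the induction over presentations has a scaling
  step.\<close>

lemma tensor_induct [consumes 1, case_names pure add]:
  assumes "t \<in> carrier (tensor A B)"
    and s: "\<And>a b. a \<in> carrier A \<Longrightarrow> b \<in> carrier B \<Longrightarrow> Q (pure_tensor A B a b)"
    and a: "\<And>y z. y \<in> carrier (tensor A B) \<Longrightarrow> z \<in> carrier (tensor A B) \<Longrightarrow> Q y \<Longrightarrow> Q z \<Longrightarrow> Q (y \<oplus>\<^bsub>tensor A B\<^esub> z)"
  shows "Q t"
proof -
  have "Q (c \<odot>\<^bsub>tensor A B\<^esub> t)" for c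
    using assms(1)[unfolded tensor_eq]
  proof (induct t arbitrary: c rule: pr.presented_induct)
    case (single u)
    then obtain x y where u: "u = (x, y)" "x \<in> carrier A" "y \<in> carrier B" by auto
    have "Q (pure_tensor A B (c \<odot>\<^bsub>A\<^esub> x) y)" using u by (intro s) auto
    then show ?case using u by (simp add: pure_smult_left pure_eq[symmetric])
  next
    case (add y z)
    then show ?case unfolding tensor_eq[symmetric] by (simp add: T.smult_add_right a)
  next
    case (smult d z)
    then show ?case unfolding tensor_eq[symmetric] by simp
  qed
  from this[of 1] show ?thesis using assms(1) by simp
qed

lemma tensor_linear_eqI:
  assumes "f \<in> linear_maps (tensor A B) V" "g \<in> linear_maps (tensor A B) V"
    "\<And>a b. a \<in> carrier A \<Longrightarrow> b \<in> carrier B \<Longrightarrow> f (pure_tensor A B a b) = g (pure_tensor A B a b)"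
    "t \<in> carrier (tensor A B)"
  shows "f t = g t"
  using assms(4)
  by (induct t rule: tensor_induct) (simp_all add: assms(3) linear_mapsD[OF assms(1)] linear_mapsD[OF assms(2)])

text \<open>A bilinear map is not multiplicative, so the two-sided test is carried out directly:
  multiplying a relator by pairs from both sides gives a relator of the same kind with other
  entries.\<close>

lemma compatible_bilinear:
  assumes V: "kalgebra V" and f: "bilinear_map A B V f"
  shows "compatible (A \<times>\<times> B) (bilinear_relators A B) V (\<lambda>(a, b). f a b)"
proof -
  interpret V: kalgebra V by fact
  let ?s = "Poly_Mapping.single :: 'a \<times> 'b \<Rightarrow> 'k \<Rightarrow> _"
  let ?\<phi> = "\<lambda>(a, b). f a b"
  note b = bilinear_mapD[OF f]
  have \<phi>: "?\<phi> \<in> carrier (A \<times>\<times> B) \<rightarrow> carrier V" using b(1) by auto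
  have 3: "lin_ext V ?\<phi> (?s (a1, b1) 1 - ?s (a2, b2) 1 - ?s (a3, b3) 1) = f a1 b1 \<ominus>\<^bsub>V\<^esub> f a2 b2 \<ominus>\<^bsub>V\<^esub> f a3 b3"
    if "a1 \<in> carrier A" "a2 \<in> carrier A" "a3 \<in> carrier A"
      "b1 \<in> carrier B" "b2 \<in> carrier B" "b3 \<in> carrier B" for a1 a2 a3 b1 b2 b3
    using that by (simp add: V.lin_ext_diff[OF _ _ \<phi>] keys_diff_subset V.lin_ext_single b)
  have 2: "lin_ext V ?\<phi> (?s (a1, b1) 1 - ?s (a2, b2) c) = f a1 b1 \<ominus>\<^bsub>V\<^esub> c \<odot>\<^bsub>V\<^esub> f a2 b2"
    if "a1 \<in> carrier A" "a2 \<in> carrier A" "b1 \<in> carrier B" "b2 \<in> carrier B" for a1 a2 b1 b2 c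
    using that by (simp add: V.lin_ext_diff[OF _ _ \<phi>] V.lin_ext_single b)
  show ?thesis
    unfolding compatible_def
  proof (intro conjI ballI)
    fix r u v assume r: "r \<in> bilinear_relators A B"
      and "u \<in> carrier (A \<times>\<times> B)" "v \<in> carrier (A \<times>\<times> B)"
    then obtain p p' s s' where u: "u = (p, p')" "p \<in> carrier A" "p' \<in> carrier B"
      and v: "v = (s, s')" "s \<in> carrier A" "s' \<in> carrier B" by auto
    note c = u(2,3) v(2,3)
    note dist = A.l_distr A.r_distr B.l_distr B.r_distr
    consider (1) a a' b where "r = ?s (a \<oplus>\<^bsub>A\<^esub> a', b) 1 - ?s (a, b) 1 - ?s (a', b) 1"
        "a \<in> carrier A" "a' \<in> carrier A" "b \<in> carrier B"
      | (2) a b b' where "r = ?s (a, b \<oplus>\<^bsub>B\<^esub> b') 1 - ?s (a, b) 1 - ?s (a, b') 1"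
        "a \<in> carrier A" "b \<in> carrier B" "b' \<in> carrier B"
      | (3) a b c where "r = ?s (c \<odot>\<^bsub>A\<^esub> a, b) 1 - ?s (a, b) c" "a \<in> carrier A" "b \<in> carrier B"
      | (4) a b c where "r = ?s (a, c \<odot>\<^bsub>B\<^esub> b) 1 - ?s (a, b) c" "a \<in> carrier A" "b \<in> carrier B"
      using r unfolding bilinear_relators_def by auto
    then show "lin_ext V ?\<phi> (?s u 1 \<otimes>\<^bsub>monoid_algebra (A \<times>\<times> B)\<^esub> r \<otimes>\<^bsub>monoid_algebra (A \<times>\<times> B)\<^esub> ?s v 1) = \<zero>\<^bsub>V\<^esub>"
    proof cases
      case 1
      then show ?thesis unfolding 1 u(1) v(1) using c
        by (simp add: monoid_algebra_l_diff monoid_algebra_r_diff 3 dist b V.add_minus_minus)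
    next
      case 2
      then show ?thesis unfolding 2 u(1) v(1) using c
        by (simp add: monoid_algebra_l_diff monoid_algebra_r_diff 3 dist b V.add_minus_minus)
    next
      case 3
      then show ?thesis unfolding 3 u(1) v(1) using c
        by (simp add: monoid_algebra_l_diff monoid_algebra_r_diff 2 b V.minus_eq V.r_neg)
    next
      case 4
      then show ?thesis unfolding 4 u(1) v(1) using c
        by (simp add: monoid_algebra_l_diff monoid_algebra_r_diff 2 b V.minus_eq V.r_neg)
    qed
  qed (use \<phi> in blast)
qed

lemma induced_bilinear:
  assumes V: "kalgebra V" and f: "bilinear_map A B V f"
  shows "induced V (\<lambda>(a, b). f a b) \<in> linear_maps (tensor A B) V"
    "\<lbrakk>a \<in> carrier A; b \<in> carrier B\<rbrakk> \<Longrightarrow> induced V (\<lambda>(a, b). f a b) (pure_tensor A B a b) = f a b"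
  unfolding tensor_eq pure_eq
  using pr.induced_linear[OF V compatible_bilinear[OF V f]]
    pr.induced_single[OF V compatible_bilinear[OF V f], of "(a, b)"] by auto

lemma induced_bilinear_alg_hom:
  assumes V: "kalgebra V" and f: "bilinear_map A B V f"
    and m: "\<And>a a' b b'. \<lbrakk>a \<in> carrier A; b \<in> carrier B; a' \<in> carrier A; b' \<in> carrier B\<rbrakk> \<Longrightarrow>
      f (a \<otimes>\<^bsub>A\<^esub> a') (b \<otimes>\<^bsub>B\<^esub> b') = f a b \<otimes>\<^bsub>V\<^esub> f a' b'"
    and o: "f \<one>\<^bsub>A\<^esub> \<one>\<^bsub>B\<^esub> = \<one>\<^bsub>V\<^esub>"
  shows "induced V (\<lambda>(a, b). f a b) \<in> alg_hom (tensor A B) V"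
  unfolding tensor_eq
  by (rule pr.induced_alg_hom[OF V compatible_bilinear[OF V f]]) (auto simp: m o)

end

lemma two_algebrasI: "kalgebra A \<Longrightarrow> kalgebra B \<Longrightarrow> two_algebras A B"
  by (simp add: two_algebras_def)

lemma kalgebra_tensor: "kalgebra A \<Longrightarrow> kalgebra B \<Longrightarrow> kalgebra (tensor A B)"
proof -
  assume "kalgebra A" "kalgebra B"
  then interpret two_algebras A B by (rule two_algebrasI)
  show ?thesis by (rule T.kalgebra_axioms)
qed

lemma bilinear_map_comp:
  assumes "bilinear_map C D V g" "f \<in> linear_maps A C" "h \<in> linear_maps B D"
  shows "bilinear_map A B V (\<lambda>a b. g (f a) (h b))"
  by (rule bilinear_mapI)
    (simp_all add: linear_mapsD[OF assms(2)] linear_mapsD[OF assms(3)] bilinear_mapD[OF assms(1)])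

lemma bilinear_map_mult: "kalgebra A \<Longrightarrow> bilinear_map A A A (\<lambda>a b. a \<otimes>\<^bsub>A\<^esub> b)"
proof -
  assume "kalgebra A"
  then interpret kalgebra A .
  show ?thesis by (rule bilinear_mapI) (simp_all add: l_distr r_distr)
qed

lemma bilinear_map_smult: "kalgebra A \<Longrightarrow> bilinear_map base_algebra A A (\<lambda>c b. c \<odot>\<^bsub>A\<^esub> b)"
proof -
  assume "kalgebra A"
  then interpret kalgebra A .
  show ?thesis by (rule bilinear_mapI) (simp_all add: smult_add_left smult_add_right mult.commute)
qed

lemma bilinear_map_swap: "bilinear_map A B V f \<Longrightarrow> bilinear_map B A V (\<lambda>b a. f a b)"
  by (auto simp: bilinear_map_def)

lemma tensor_map_linear:
  assumes k: "kalgebra A" "kalgebra B" "kalgebra C" "kalgebra D"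
    and f: "f \<in> linear_maps A C" and g: "g \<in> linear_maps B D"
  shows "tensor_map C D f g \<in> linear_maps (tensor A B) (tensor C D)"
    "\<lbrakk>a \<in> carrier A; b \<in> carrier B\<rbrakk> \<Longrightarrow> tensor_map C D f g (pure_tensor A B a b) = pure_tensor C D (f a) (g b)"
proof -
  interpret AB: two_algebras A B by (rule two_algebrasI) fact+
  interpret CD: two_algebras C D by (rule two_algebrasI) fact+
  note b = bilinear_map_comp[OF CD.bilinear_pure f g]
  show "tensor_map C D f g \<in> linear_maps (tensor A B) (tensor C D)"
    "\<lbrakk>a \<in> carrier A; b \<in> carrier B\<rbrakk> \<Longrightarrow> tensor_map C D f g (pure_tensor A B a b) = pure_tensor C D (f a) (g b)"
    unfolding tensor_map_def
    using AB.induced_bilinear[OF CD.T.kalgebra_axioms b] by auto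
qed

lemma tensor_map_alg_hom:
  assumes k: "kalgebra A" "kalgebra B" "kalgebra C" "kalgebra D"
    and f: "f \<in> alg_hom A C" and g: "g \<in> alg_hom B D"
  shows "tensor_map C D f g \<in> alg_hom (tensor A B) (tensor C D)"
proof -
  interpret AB: two_algebras A B by (rule two_algebrasI) fact+
  interpret CD: two_algebras C D by (rule two_algebrasI) fact+
  note b = bilinear_map_comp[OF CD.bilinear_pure alg_homD(1)[OF f] alg_homD(1)[OF g]]
  show ?thesis
    unfolding tensor_map_def
    by (rule AB.induced_bilinear_alg_hom[OF CD.T.kalgebra_axioms b])
      (simp_all add: alg_homD[OF f] alg_homD[OF g] CD.pure_mult CD.pure_one)
qed

text \<open>\<open>tensor_assoc\<close> nests two induced maps. The inner one, \<open>K t c\<close>,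
  is linear in \<open>t\<close> by construction; its linearity in \<open>c\<close> and its
  multiplicativity are proved by induction on tensors, because they are visible on pure tensors
  only. This makes \<open>K\<close> eligible for the outer one.\<close>

lemma tensor_assoc_alg_hom:
  assumes k: "kalgebra A" "kalgebra B" "kalgebra C"
  shows "tensor_assoc A B C \<in> alg_hom (tensor (tensor A B) C) (tensor A (tensor B C))"
    "\<lbrakk>a \<in> carrier A; b \<in> carrier B; c \<in> carrier C\<rbrakk> \<Longrightarrow>
      tensor_assoc A B C (pure_tensor (tensor A B) C (pure_tensor A B a b) c) =
      pure_tensor A (tensor B C) a (pure_tensor B C b c)"
proof -
  interpret AB: two_algebras A B by (rule two_algebrasI) fact+
  interpret BC: two_algebras B C by (rule two_algebrasI) fact+
  interpret AB_C: two_algebras "tensor A B" C by (rule two_algebrasI) (rule AB.T.kalgebra_axioms k)+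
  interpret A_BC: two_algebras A "tensor B C" by (rule two_algebrasI) (rule BC.T.kalgebra_axioms k)+
  let ?T = "tensor A (tensor B C)"
  let ?p = "\<lambda>a b c. pure_tensor A (tensor B C) a (pure_tensor B C b c)"
  define K where "K t c = induced ?T (\<lambda>(a, b). ?p a b c) t" for t c
  note ps = AB.pure_closed BC.pure_closed A_BC.pure_closed
    BC.pure_add_left BC.pure_add_right A_BC.pure_add_left A_BC.pure_add_right
    BC.pure_smult_left BC.pure_smult_right A_BC.pure_smult_left A_BC.pure_smult_right
  have b: "bilinear_map A B ?T (\<lambda>a b. ?p a b c)" if "c \<in> carrier C" for c
    by (rule bilinear_mapI) (use that in \<open>simp_all add: ps\<close>)
  have K1: "(\<lambda>t. K t c) \<in> linear_maps (tensor A B) ?T" if "c \<in> carrier C" for c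
    using AB.induced_bilinear(1)[OF A_BC.T.kalgebra_axioms b[OF that]] unfolding K_def .
  have K2: "K (pure_tensor A B a b) c = ?p a b c" if "c \<in> carrier C" "a \<in> carrier A" "b \<in> carrier B" for a b c
    using AB.induced_bilinear(2)[OF A_BC.T.kalgebra_axioms b[OF that(1)]] that unfolding K_def by simp
  note KD = linear_mapsD[OF K1]
  have Kb: "bilinear_map (tensor A B) C ?T K"
  proof (rule bilinear_mapI)
    fix t c c' assume t: "t \<in> carrier (tensor A B)" and c: "c \<in> carrier C" "c' \<in> carrier C"
    show "K t (c \<oplus>\<^bsub>C\<^esub> c') = K t c \<oplus>\<^bsub>?T\<^esub> K t c'"
      using t
    proof (induct t rule: AB.tensor_induct)
      case (pure a b)
      then show ?case using c by (simp add: K2 ps)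
    next
      case (add y z)
      then show ?case using c by (simp add: KD A_BC.T.a_ac)
    qed
  next
    fix t c d assume t: "t \<in> carrier (tensor A B)" and c: "c \<in> carrier C"
    show "K t (d \<odot>\<^bsub>C\<^esub> c) = d \<odot>\<^bsub>?T\<^esub> K t c"
      using t
    proof (induct t rule: AB.tensor_induct)
      case (pure a b)
      then show ?case using c by (simp add: K2 ps)
    next
      case (add y z)
      then show ?case using c by (simp add: KD A_BC.T.smult_add_right)
    qed
  qed (use KD in auto)
  have Km: "K (t \<otimes>\<^bsub>tensor A B\<^esub> t') (c \<otimes>\<^bsub>C\<^esub> c') = K t c \<otimes>\<^bsub>?T\<^esub> K t' c'"
    if t: "t \<in> carrier (tensor A B)" and t': "t' \<in> carrier (tensor A B)" and c: "c \<in> carrier C" "c' \<in> carrier C"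
    for t t' c c'
    using t
  proof (induct t rule: AB.tensor_induct)
    case (pure a b)
    show ?case using t'
    proof (induct t' rule: AB.tensor_induct)
      case (pure a' b')
      then show ?case using c \<open>a \<in> carrier A\<close> \<open>b \<in> carrier B\<close>
        by (simp add: K2 AB.pure_mult BC.pure_mult A_BC.pure_mult ps)
    next
      case (add y z)
      then show ?case using c \<open>a \<in> carrier A\<close> \<open>b \<in> carrier B\<close>
        by (simp add: KD AB.T.r_distr A_BC.T.r_distr ps)
    qed
  next
    case (add y z)
    then show ?case using c t' by (simp add: KD AB.T.l_distr A_BC.T.l_distr)
  qed
  have Ko: "K \<one>\<^bsub>tensor A B\<^esub> \<one>\<^bsub>C\<^esub> = \<one>\<^bsub>?T\<^esub>"
    by (simp add: AB.pure_one A_BC.pure_one BC.pure_one K2)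
  have eq: "tensor_assoc A B C = induced ?T (\<lambda>(t, c). K t c)"
    unfolding tensor_assoc_def K_def ..
  show "tensor_assoc A B C \<in> alg_hom (tensor (tensor A B) C) ?T"
    unfolding eq by (rule AB_C.induced_bilinear_alg_hom[OF A_BC.T.kalgebra_axioms Kb Km Ko])
  show "\<lbrakk>a \<in> carrier A; b \<in> carrier B; c \<in> carrier C\<rbrakk> \<Longrightarrow>
      tensor_assoc A B C (pure_tensor (tensor A B) C (pure_tensor A B a b) c) = ?p a b c"
    unfolding eq using AB_C.induced_bilinear(2)[OF A_BC.T.kalgebra_axioms Kb] K2
    by (simp add: AB.pure_closed)
qed

section \<open>Hopf algebras from algebra maps\<close>

text \<open>\<open>U_hopf\<close> extends the algebra by the Hopf fields, while tensors, linear maps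
  and algebra maps look only at the algebra fields. These rewrite rules move every statement about
  the extended record back to the algebra.\<close>

lemma module_extend_simps [simp]:
  "carrier (module.extend U e) = carrier U"
  "(\<otimes>\<^bsub>module.extend U e\<^esub>) = (\<otimes>\<^bsub>U\<^esub>)"
  "\<one>\<^bsub>module.extend U e\<^esub> = \<one>\<^bsub>U\<^esub>"
  "\<zero>\<^bsub>module.extend U e\<^esub> = \<zero>\<^bsub>U\<^esub>"
  "(\<oplus>\<^bsub>module.extend U e\<^esub>) = (\<oplus>\<^bsub>U\<^esub>)"
  "(\<odot>\<^bsub>module.extend U e\<^esub>) = (\<odot>\<^bsub>U\<^esub>)"
  by (simp_all add: module.defs)

lemma hopf_extend_simps [simp]:
  "comult (module.extend U (hopf.fields \<Delta> \<epsilon> S)) = \<Delta>"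
  "counit (module.extend U (hopf.fields \<Delta> \<epsilon> S)) = \<epsilon>"
  "antipode (module.extend U (hopf.fields \<Delta> \<epsilon> S)) = S"
  by (simp_all add: module.defs hopf.defs)

lemma finsum_extend [simp]: "finsum (module.extend U e) f S = finsum U f S"
  by (simp add: finsum_def finprod_def)

lemma induced_extend [simp]: "induced (module.extend U e) = induced U"
  by (intro ext) (simp add: induced_def lin_ext_def[abs_def])

lemma DirProd_extend [simp]:
  "module.extend U e \<times>\<times> B = U \<times>\<times> B" "B \<times>\<times> module.extend U e = B \<times>\<times> U"
  by (simp_all add: DirProd_def)

lemma bilinear_relators_extend [simp]:
  "bilinear_relators (module.extend U e) B = bilinear_relators U B"
  "bilinear_relators B (module.extend U e) = bilinear_relators B U"
  by (simp_all add: bilinear_relators_def)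

lemma tensor_extend [simp]:
  "tensor (module.extend U e) B = tensor U B"
  "tensor B (module.extend U e) = tensor B U"
  by (simp_all add: tensor_def bilinear_ideal_def)

lemma pure_tensor_extend [simp]:
  "pure_tensor (module.extend U e) B = pure_tensor U B"
  "pure_tensor B (module.extend U e) = pure_tensor B U"
  by (intro ext, simp add: pure_tensor_def bilinear_ideal_def)+

lemma tensor_map_extend [simp]:
  "tensor_map (module.extend U e) B = tensor_map U B"
  "tensor_map B (module.extend U e) = tensor_map B U"
  by (intro ext, simp add: tensor_map_def)+

lemma tensor_assoc_extend [simp]:
  "tensor_assoc (module.extend U e) B C = tensor_assoc U B C"
  "tensor_assoc B (module.extend U e) C = tensor_assoc B U C"
  "tensor_assoc B C (module.extend U e) = tensor_assoc B C U"
  by (intro ext, simp add: tensor_assoc_def)+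

lemma linear_maps_extend [simp]:
  "linear_maps (module.extend U e) B = linear_maps U B"
  "linear_maps B (module.extend U e) = linear_maps B U"
  by (simp_all add: LinearCombinations.module_hom_def)

lemma alg_hom_extend [simp]:
  "alg_hom (module.extend U e) B = alg_hom U B"
  "alg_hom B (module.extend U e) = alg_hom B U"
  by (simp_all add: alg_hom_def Ring.ring_hom_def)

lemma kalgebra_extend:
  assumes "kalgebra U"
  shows "kalgebra (module.extend U e)"
proof -
  interpret kalgebra U by fact
  have "ring (module.extend U e)" by (rule ring_transfer[OF ring_axioms]) simp_all
  then show ?thesis
    by (rule kalgebra.intro)
      (rule kalgebra_axioms.intro, simp_all add: smult_add_left smult_add_right)
qed

text \<open>Three algebra maps without any Hopf axiom. The locale isolates the fact that the axioms
  hold everywhere once they hold on generators.\<close>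

locale hopf_data = kalgebra U for U :: "('k::field, 'a) module" (structure) +
  fixes \<Delta> :: "'a \<Rightarrow> ('a \<times> 'a \<Rightarrow>\<^sub>0 'k) set" and \<epsilon> :: "'a \<Rightarrow> 'k" and S :: "'a \<Rightarrow> 'a"
  assumes \<Delta>: "\<Delta> \<in> alg_hom U (tensor U U)"
    and \<epsilon>: "\<epsilon> \<in> alg_hom U base_algebra"
    and S: "S \<in> alg_hom U (opposite_algebra U)"
begin

sublocale UU: two_algebras U U by (rule two_algebrasI) (rule kalgebra_axioms)+
sublocale UU_U: two_algebras "tensor U U" U
  by (rule two_algebrasI) (rule UU.T.kalgebra_axioms kalgebra_axioms)+
sublocale U_UU: two_algebras U "tensor U U"
  by (rule two_algebrasI) (rule UU.T.kalgebra_axioms kalgebra_axioms)+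

abbreviation "pt \<equiv> pure_tensor U U"
abbreviation "T \<equiv> tensor U U"

lemma S_linear: "S \<in> linear_maps U U"
  using alg_homD(1)[OF S] by (simp add: LinearCombinations.module_hom_def)

lemma S_mult: "\<lbrakk>x \<in> carrier U; y \<in> carrier U\<rbrakk> \<Longrightarrow> S (x \<otimes> y) = S y \<otimes> S x"
  using alg_homD(2)[OF S] by simp

lemma S_one: "S \<one> = \<one>"
  using alg_homD(3)[OF S] by simp

lemmas \<Delta>D = alg_homD[OF \<Delta>] and \<epsilon>D = alg_homD[OF \<epsilon>, simplified] and SD = linear_mapsD[OF S_linear]

definition "coassoc_left h = tensor_assoc U U U (tensor_map (tensor U U) U \<Delta> id (\<Delta> h))"
definition "coassoc_right h = tensor_map U (tensor U U) id \<Delta> (\<Delta> h)"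
definition "counit_map_left h = induced U (\<lambda>(a, b). \<epsilon> a \<odot> b) (\<Delta> h)"
definition "counit_map_right h = induced U (\<lambda>(a, b). \<epsilon> b \<odot> a) (\<Delta> h)"
text \<open>Unlike the four maps before, these are not composed with \<Delta>: the convolutions are
  not algebra maps, and their behaviour on products has to be stated for arbitrary tensors.\<close>

definition "conv_left = induced U (\<lambda>(a, b). S a \<otimes> b)"
definition "conv_right = induced U (\<lambda>(a, b). a \<otimes> S b)"

lemma id_alg_hom: "id \<in> alg_hom U U"
  using alg_hom_id[of U] by (simp add: id_def)

lemma coassoc_left_alg_hom: "coassoc_left \<in> alg_hom U (tensor U (tensor U U))"
  unfolding coassoc_left_def[abs_def]
  by (rule alg_hom_comp[OF \<Delta>], rule alg_hom_comp[OF tensor_map_alg_hom tensor_assoc_alg_hom(1)])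
    (rule kalgebra_axioms UU.T.kalgebra_axioms \<Delta> id_alg_hom)+

lemma coassoc_right_alg_hom: "coassoc_right \<in> alg_hom U (tensor U (tensor U U))"
  unfolding coassoc_right_def[abs_def]
  by (rule alg_hom_comp[OF \<Delta>], rule tensor_map_alg_hom)
    (rule kalgebra_axioms UU.T.kalgebra_axioms \<Delta> id_alg_hom)+

lemma id_linear: "id \<in> linear_maps U U" using alg_homD(1)[OF id_alg_hom] .

lemmas map_left = tensor_map_linear[OF kalgebra_axioms kalgebra_axioms UU.T.kalgebra_axioms kalgebra_axioms
    alg_homD(1)[OF \<Delta>] id_linear]
lemmas map_right = tensor_map_linear[OF kalgebra_axioms kalgebra_axioms kalgebra_axioms UU.T.kalgebra_axioms
    id_linear alg_homD(1)[OF \<Delta>]]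
lemmas assoc_hom = tensor_assoc_alg_hom[OF kalgebra_axioms kalgebra_axioms kalgebra_axioms]

lemma bilinear_counit_left: "bilinear_map U U U (\<lambda>a b. \<epsilon> a \<odot> b)"
  by (rule bilinear_map_comp[OF bilinear_map_smult[OF kalgebra_axioms] alg_homD(1)[OF \<epsilon>] linear_maps_id])

lemma bilinear_counit_right: "bilinear_map U U U (\<lambda>a b. \<epsilon> b \<odot> a)"
  by (rule bilinear_map_swap) (rule bilinear_counit_left)

lemma counit_map_left_alg_hom: "counit_map_left \<in> alg_hom U U"
  unfolding counit_map_left_def[abs_def]
  by (rule alg_hom_comp[OF \<Delta> UU.induced_bilinear_alg_hom[OF kalgebra_axioms bilinear_counit_left]])
    (simp_all add: \<epsilon>D mult.commute)

lemma counit_map_right_alg_hom: "counit_map_right \<in> alg_hom U U"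
  unfolding counit_map_right_def[abs_def]
  by (rule alg_hom_comp[OF \<Delta> UU.induced_bilinear_alg_hom[OF kalgebra_axioms bilinear_counit_right]])
    (simp_all add: \<epsilon>D mult.commute)

lemmas counit_left_pure = UU.induced_bilinear(2)[OF kalgebra_axioms bilinear_counit_left]
lemmas counit_left_linear = UU.induced_bilinear(1)[OF kalgebra_axioms bilinear_counit_left]
lemmas counit_right_pure = UU.induced_bilinear(2)[OF kalgebra_axioms bilinear_counit_right]
lemmas counit_right_linear = UU.induced_bilinear(1)[OF kalgebra_axioms bilinear_counit_right]

lemma bilinear_conv_left: "bilinear_map U U U (\<lambda>a b. S a \<otimes> b)"
  by (rule bilinear_map_comp[OF bilinear_map_mult[OF kalgebra_axioms] S_linear linear_maps_id])

lemma bilinear_conv_right: "bilinear_map U U U (\<lambda>a b. a \<otimes> S b)"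
  by (rule bilinear_map_comp[OF bilinear_map_mult[OF kalgebra_axioms] linear_maps_id S_linear])

lemma conv_left_pure: "\<lbrakk>a \<in> carrier U; b \<in> carrier U\<rbrakk> \<Longrightarrow> conv_left (pt a b) = S a \<otimes> b"
  unfolding conv_left_def by (rule UU.induced_bilinear(2)[OF kalgebra_axioms bilinear_conv_left])

lemma conv_right_pure: "\<lbrakk>a \<in> carrier U; b \<in> carrier U\<rbrakk> \<Longrightarrow> conv_right (pt a b) = a \<otimes> S b"
  unfolding conv_right_def by (rule UU.induced_bilinear(2)[OF kalgebra_axioms bilinear_conv_right])

lemma conv_left_linear: "conv_left \<in> linear_maps T U"
  unfolding conv_left_def by (rule UU.induced_bilinear(1)[OF kalgebra_axioms bilinear_conv_left])

lemma conv_right_linear: "conv_right \<in> linear_maps T U"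
  unfolding conv_right_def by (rule UU.induced_bilinear(1)[OF kalgebra_axioms bilinear_conv_right])

lemmas convD = linear_mapsD[OF conv_left_linear] linear_mapsD[OF conv_right_linear]

text \<open>As S reverses products, S(a' a) b' b = S(a) (S(a') b') b: the contribution of the left
  factor of the product ends up nested in the middle.\<close>

lemma conv_left_mult_pure:
  assumes "t \<in> carrier T" "a \<in> carrier U" "b \<in> carrier U"
  shows "conv_left (t \<otimes>\<^bsub>T\<^esub> pt a b) = S a \<otimes> conv_left t \<otimes> b"
  using assms(1)
proof (induct t rule: UU.tensor_induct)
  case (pure a' b')
  then show ?case using assms by (simp add: UU.pure_mult conv_left_pure S_mult SD m_assoc)
next
  case (add y z)
  then show ?case using assms by (simp add: UU.T.l_distr UU.pure_closed convD SD l_distr r_distr)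
qed

text \<open>If the antipode axiom holds at h, the nested middle term is the scalar \<epsilon>(h),
  which can be pulled out. This makes the axiom pass to products.\<close>

lemma conv_left_mult:
  assumes "h \<in> carrier U" "conv_left (\<Delta> h) = \<epsilon> h \<odot> \<one>" "t \<in> carrier T"
  shows "conv_left (\<Delta> h \<otimes>\<^bsub>T\<^esub> t) = \<epsilon> h \<odot> conv_left t"
  using assms(3)
proof (induct t rule: UU.tensor_induct)
  case (pure a b)
  then show ?case using assms by (simp add: conv_left_mult_pure \<Delta>D SD conv_left_pure)
next
  case (add y z)
  then show ?case using assms by (simp add: UU.T.r_distr \<Delta>D convD smult_add_right)
qed

lemma conv_right_mult_pure:
  assumes "t \<in> carrier T" "a \<in> carrier U" "b \<in> carrier U"
  shows "conv_right (pt a b \<otimes>\<^bsub>T\<^esub> t) = a \<otimes> conv_right t \<otimes> S b"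
  using assms(1)
proof (induct t rule: UU.tensor_induct)
  case (pure a' b')
  then show ?case using assms by (simp add: UU.pure_mult conv_right_pure S_mult SD m_assoc)
next
  case (add y z)
  then show ?case using assms by (simp add: UU.T.r_distr UU.pure_closed convD SD l_distr r_distr)
qed

lemma conv_right_mult:
  assumes "h \<in> carrier U" "conv_right (\<Delta> h) = \<epsilon> h \<odot> \<one>" "t \<in> carrier T"
  shows "conv_right (t \<otimes>\<^bsub>T\<^esub> \<Delta> h) = \<epsilon> h \<odot> conv_right t"
  using assms(3)
proof (induct t rule: UU.tensor_induct)
  case (pure a b)
  then show ?case using assms by (simp add: conv_right_mult_pure \<Delta>D SD conv_right_pure)
next
  case (add y z)
  then show ?case using assms by (simp add: UU.T.l_distr \<Delta>D convD smult_add_right)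
qed

text \<open>The axioms at a single element. By the closure lemmas that follow, the elements
  satisfying them form a unital subalgebra, so that only generators remain to be checked.\<close>

definition "hopf_at h \<longleftrightarrow> coassoc_left h = coassoc_right h \<and> counit_map_left h = h \<and> counit_map_right h = h
  \<and> conv_left (\<Delta> h) = \<epsilon> h \<odot> \<one> \<and> conv_right (\<Delta> h) = \<epsilon> h \<odot> \<one>"

lemmas hD = alg_homD[OF coassoc_left_alg_hom] alg_homD[OF coassoc_right_alg_hom]
  alg_homD[OF counit_map_left_alg_hom] alg_homD[OF counit_map_right_alg_hom]

lemma hopf_at_one: "hopf_at \<one>"
  by (simp add: hopf_at_def hD \<Delta>D \<epsilon>D UU.pure_one conv_left_pure conv_right_pure S_one)

lemma hopf_at_add: "\<lbrakk>hopf_at x; hopf_at y; x \<in> carrier U; y \<in> carrier U\<rbrakk> \<Longrightarrow> hopf_at (x \<oplus> y)"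
  by (simp add: hopf_at_def hD \<Delta>D \<epsilon>D convD smult_add_left)

lemma hopf_at_smult: "\<lbrakk>hopf_at x; x \<in> carrier U\<rbrakk> \<Longrightarrow> hopf_at (c \<odot> x)"
  by (simp add: hopf_at_def hD \<Delta>D \<epsilon>D convD)

lemma hopf_at_mult: "\<lbrakk>hopf_at x; hopf_at y; x \<in> carrier U; y \<in> carrier U\<rbrakk> \<Longrightarrow> hopf_at (x \<otimes> y)"
  by (simp add: hopf_at_def hD \<Delta>D \<epsilon>D conv_left_mult conv_right_mult mult.commute)

lemma hopf_at_grouplike:
  assumes "g \<in> carrier U" "\<Delta> g = pt g g" "\<epsilon> g = 1" "S g \<otimes> g = \<one>" "g \<otimes> S g = \<one>"
  shows "hopf_at g"
  using assms
  by (simp add: hopf_at_def coassoc_left_def coassoc_right_def counit_map_left_def counit_map_right_def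
      map_left map_right assoc_hom UU.pure_closed counit_left_pure counit_right_pure
      conv_left_pure conv_right_pure)

text \<open>The last two assumptions are the antipode axioms evaluated at \<Delta>(x) = x \<otimes>
  g + 1 \<otimes> x, using S(1) = 1.\<close>

lemma hopf_at_skew_primitive:
  assumes "g \<in> carrier U" "\<Delta> g = pt g g" "\<epsilon> g = 1"
    and x: "x \<in> carrier U" "\<Delta> x = pt x g \<oplus>\<^bsub>T\<^esub> pt \<one> x" "\<epsilon> x = 0"
    and "S x \<otimes> g \<oplus> x = \<zero>" "x \<otimes> S g \<oplus> S x = \<zero>"
  shows "hopf_at x"
  using assms
  by (simp add: hopf_at_def coassoc_left_def coassoc_right_def counit_map_left_def counit_map_right_def
      map_left map_right assoc_hom UU.pure_closed counit_left_pure counit_right_pure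
      linear_mapsD[OF map_left(1)] linear_mapsD[OF map_right(1)] alg_homD[OF assoc_hom(1)]
      linear_mapsD[OF counit_left_linear] linear_mapsD[OF counit_right_linear]
      conv_left_pure conv_right_pure convD \<Delta>D \<epsilon>D UU.pure_one SD S_one
      UU_U.pure_add_left U_UU.pure_add_right UU_U.pure_closed U_UU.pure_closed U_UU.T.a_assoc)

lemma hopf_algebraI:
  assumes "\<And>h. h \<in> carrier U \<Longrightarrow> hopf_at h"
  shows "hopf_algebra (module.extend U (hopf.fields \<Delta> \<epsilon> S))"
proof -
  have *: "coassoc_left h = coassoc_right h" "counit_map_left h = h" "counit_map_right h = h"
     "conv_left (\<Delta> h) = \<epsilon> h \<odot> \<one>" "conv_right (\<Delta> h) = \<epsilon> h \<odot> \<one>" if "h \<in> carrier U" for h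
    using assms[OF that] by (auto simp: hopf_at_def)
  note d = coassoc_left_def coassoc_right_def counit_map_left_def counit_map_right_def
    conv_left_def conv_right_def
  show ?thesis
    by (rule hopf_algebra.intro[OF kalgebra_imp_assoc_algebra[OF kalgebra_extend[OF kalgebra_axioms]]],
        rule hopf_algebra_axioms.intro)
      (simp_all add: \<Delta> \<epsilon> S_linear *[unfolded d])
qed

end

section \<open>Gaussian binomial coefficients\<close>

text \<open>Gaussian binomials by the Pascal rule: at a root of unity the quotient of q-factorials
  may be 0/0, whereas the recursion makes sense for every q.\<close>

fun qbinom :: "'k::field \<Rightarrow> nat \<Rightarrow> nat \<Rightarrow> 'k" where
  "qbinom q m 0 = 1"
| "qbinom q 0 (Suc s) = 0"
| "qbinom q (Suc m) (Suc s) = qbinom q m s + q ^ Suc s * qbinom q m (Suc s)"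

lemma qbinom_0 [simp]: "m < s \<Longrightarrow> qbinom q m s = 0"
  by (induct q m s rule: qbinom.induct) auto

lemma qbinom_self [simp]: "qbinom q m m = 1"
  by (induct m) auto

text \<open>The ratio of neighbouring Gaussian binomials in one row, written without division so
  that it holds at roots of unity too.\<close>

lemma qbinom_step:
  "s \<le> m \<Longrightarrow> (q ^ Suc s - 1) * qbinom q m (Suc s) = (q ^ (m - s) - 1) * qbinom q m s"
proof (induct m arbitrary: s)
  case 0
  then show ?case by simp
next
  case (Suc m)
  \<comment> \<open>The absorption identity between rows m and m + 1, obtained from the induction
    hypothesis for row m; it yields the ratio in row m + 1.\<close>
  have II: "(q ^ Suc s - 1) * qbinom q (Suc m) (Suc s) = (q ^ Suc m - 1) * qbinom q m s" if "s \<le> m" for s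
  proof -
    have e: "q ^ Suc s * q ^ (m - s) = q ^ Suc m"
      using that by (simp add: power_add[symmetric] del: power_Suc)
    have "(q ^ Suc s - 1) * qbinom q (Suc m) (Suc s) =
      (q ^ Suc s - 1) * qbinom q m s + q ^ Suc s * ((q ^ Suc s - 1) * qbinom q m (Suc s))"
      by (simp only: qbinom.simps) (simp add: algebra_simps)
    also have "\<dots> = (q ^ Suc s - 1) * qbinom q m s + q ^ Suc s * ((q ^ (m - s) - 1) * qbinom q m s)"
      by (simp only: Suc(1)[OF that])
    also have "\<dots> = (q ^ Suc s * q ^ (m - s) - 1) * qbinom q m s" by (simp add: algebra_simps)
    finally show ?thesis unfolding e .
  qed
  show ?case
  proof (cases s)
    case 0
    then show ?thesis using II[of 0] by simp
  next
    case (Suc t)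
    show ?thesis
    proof (cases "s = Suc m")
      case True
      then show ?thesis by simp
    next
      case False
      with Suc \<open>s \<le> Suc m\<close> have t: "Suc t \<le> m" "t \<le> m" by auto
      have e: "q ^ Suc t * q ^ (m - t) = q ^ Suc m"
        using t by (simp add: power_add[symmetric] del: power_Suc)
      have "(q ^ (m - t) - 1) * qbinom q (Suc m) (Suc t) =
        (q ^ (m - t) - 1) * qbinom q m t + (q ^ Suc t * q ^ (m - t) - q ^ Suc t) * qbinom q m (Suc t)"
        by (simp only: qbinom.simps) (simp add: algebra_simps)
      also have "\<dots> = (q ^ Suc t - 1) * qbinom q m (Suc t) + (q ^ Suc m - q ^ Suc t) * qbinom q m (Suc t)"
        unfolding e by (simp only: Suc.hyps[OF t(2)])
      also have "\<dots> = (q ^ Suc m - 1) * qbinom q m (Suc t)" by (simp add: algebra_simps)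
      also have "\<dots> = (q ^ Suc (Suc t) - 1) * qbinom q (Suc m) (Suc (Suc t))"
        using II[OF t(1)] by simp
      finally show ?thesis using Suc by simp
    qed
  qed
qed

lemma qbinom_absorb:
  assumes "s \<le> m"
  shows "(q ^ Suc s - 1) * qbinom q (Suc m) (Suc s) = (q ^ Suc m - 1) * qbinom q m s"
proof -
  have e: "q ^ Suc s * q ^ (m - s) = q ^ Suc m"
    using assms by (simp add: power_add[symmetric] del: power_Suc)
  have "(q ^ Suc s - 1) * qbinom q (Suc m) (Suc s) =
    (q ^ Suc s - 1) * qbinom q m s + q ^ Suc s * ((q ^ Suc s - 1) * qbinom q m (Suc s))"
    by (simp only: qbinom.simps) (simp add: algebra_simps)
  also have "\<dots> = (q ^ Suc s * q ^ (m - s) - 1) * qbinom q m s"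
    by (simp only: qbinom_step[OF assms]) (simp add: algebra_simps)
  finally show ?thesis unfolding e .
qed

lemma primitive_root_power_neq_1:
  "primitive_root_of_unity n q \<Longrightarrow> 0 < m \<Longrightarrow> m < n \<Longrightarrow> q ^ m \<noteq> 1"
  by (simp add: primitive_root_of_unity_def)

text \<open>In the absorption identity for row n the right-hand side carries the factor q^n - 1 = 0,
  while q^s - 1 is invertible for 0 < s < n.\<close>

lemma qbinom_primitive_root:
  assumes "primitive_root_of_unity n q" "0 < s" "s < n"
  shows "qbinom q n s = 0"
proof -
  obtain t m where t: "s = Suc t" "n = Suc m" using assms by (cases s; cases n) auto
  have "(q ^ Suc t - 1) * qbinom q (Suc m) (Suc t) = 0"
    using qbinom_absorb[of t m q] t assms by (simp add: primitive_root_of_unity_def)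
  moreover have "q ^ Suc t \<noteq> 1" using primitive_root_power_neq_1[OF assms] t by simp
  ultimately show ?thesis using t by simp
qed

text \<open>Absorption again: below row n all factors q^i - 1 with i > 0 are nonzero, in every
  characteristic. This later allows division by structure constants of the comultiplication.\<close>

lemma qbinom_nonzero:
  assumes "primitive_root_of_unity n q"
  shows "s \<le> j \<Longrightarrow> j < n \<Longrightarrow> qbinom q j s \<noteq> 0"
proof (induct j arbitrary: s)
  case (Suc j)
  show ?case
  proof (cases s)
    case (Suc t)
    have "(q ^ Suc j - 1) * qbinom q j t \<noteq> 0"
      using Suc Suc.prems Suc.hyps[of t] primitive_root_power_neq_1[OF assms, of "Suc j"] by simp
    then show ?thesis using qbinom_absorb[of t j q] Suc Suc.prems by auto
  qed simp
qed simp

context kalgebra begin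

lemma q_commute_pow:
  assumes "x \<in> carrier A" "y \<in> carrier A" "y \<otimes> x = q \<odot> (x \<otimes> y)"
  shows "y \<otimes> x [^] (s::nat) = q ^ s \<odot> (x [^] s \<otimes> y)"
proof (induct s)
  case 0
  then show ?case using assms by simp
next
  case (Suc s)
  have "y \<otimes> x [^] Suc s = (y \<otimes> x [^] s) \<otimes> x" using assms by (simp add: m_assoc)
  also have "\<dots> = q ^ s \<odot> (x [^] s \<otimes> (y \<otimes> x))" using assms Suc by (simp add: m_assoc)
  also have "\<dots> = q ^ Suc s \<odot> (x [^] Suc s \<otimes> y)" using assms by (simp add: m_assoc mult.commute)
  finally show ?case .
qed

lemma q_commute_pow_pow:
  assumes "x \<in> carrier A" "y \<in> carrier A" "y \<otimes> x = q \<odot> (x \<otimes> y)"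
  shows "y [^] (t::nat) \<otimes> x [^] (s::nat) = q ^ (t * s) \<odot> (x [^] s \<otimes> y [^] t)"
proof (induct t)
  case 0
  then show ?case using assms by simp
next
  case (Suc t)
  have "y [^] Suc t \<otimes> x [^] s = y [^] t \<otimes> (y \<otimes> x [^] s)" using assms by (simp add: m_assoc)
  also have "\<dots> = q ^ s \<odot> ((y [^] t \<otimes> x [^] s) \<otimes> y)"
    using assms q_commute_pow[OF assms] by (simp add: m_assoc)
  also have "\<dots> = q ^ (Suc t * s) \<odot> (x [^] s \<otimes> y [^] Suc t)"
    using assms Suc by (simp add: m_assoc power_add)
  finally show ?case .
qed

theorem q_binomial:
  assumes x: "x \<in> carrier A" and y: "y \<in> carrier A" and c: "y \<otimes> x = q \<odot> (x \<otimes> y)"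
  shows "(x \<oplus> y) [^] (m::nat) = (\<Oplus>s\<in>{..m}. qbinom q m s \<odot> (x [^] s \<otimes> y [^] (m - s)))"
proof (induct m)
  case 0
  then show ?case using assms by simp
next
  case (Suc m)
  let ?t = "\<lambda>s r. x [^] (s::nat) \<otimes> y [^] (r::nat)"
  have t: "?t s r \<in> carrier A" for s r using x y by simp
  have yt: "y \<otimes> ?t s (m - s) = q ^ s \<odot> ?t s (Suc m - s)" if "s \<in> {..m}" for s
  proof -
    have "y \<otimes> ?t s (m - s) = (y \<otimes> x [^] s) \<otimes> y [^] (m - s)" using x y by (simp add: m_assoc)
    also have "\<dots> = q ^ s \<odot> (x [^] s \<otimes> (y \<otimes> y [^] (m - s)))"
      using x y q_commute_pow[OF assms, of s] by (simp add: m_assoc)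
    also have "y \<otimes> y [^] (m - s) = y [^] (Suc m - s)"
      using that y by (simp only: nat_pow_Suc2[symmetric] Suc_diff_le atMost_iff)
    finally show ?thesis .
  qed
  have xt: "x \<otimes> ?t s r = ?t (Suc s) r" for s r
    using x y by (simp only: nat_pow_Suc2 m_assoc nat_pow_closed m_closed)
  have "(x \<oplus> y) [^] Suc m = (x \<oplus> y) \<otimes> (\<Oplus>s\<in>{..m}. qbinom q m s \<odot> ?t s (m - s))"
    using x y by (simp only: nat_pow_Suc2 a_closed Suc)
  also have "\<dots> = (\<Oplus>s\<in>{..m}. qbinom q m s \<odot> ?t (Suc s) (m - s)) \<oplus>
      (\<Oplus>s\<in>{..m}. (q ^ s * qbinom q m s) \<odot> ?t s (Suc m - s))" (is "_ = ?X \<oplus> ?Y")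
  proof -
    have "x \<otimes> (\<Oplus>s\<in>{..m}. qbinom q m s \<odot> ?t s (m - s)) = (\<Oplus>s\<in>{..m}. x \<otimes> (qbinom q m s \<odot> ?t s (m - s)))"
      by (rule finsum_rdistr) (use t x in auto)
    also have "\<dots> = ?X" by (rule finsum_cong') (use t x y xt in auto)
    finally have 1: "x \<otimes> (\<Oplus>s\<in>{..m}. qbinom q m s \<odot> ?t s (m - s)) = ?X" .
    have "y \<otimes> (\<Oplus>s\<in>{..m}. qbinom q m s \<odot> ?t s (m - s)) = (\<Oplus>s\<in>{..m}. y \<otimes> (qbinom q m s \<odot> ?t s (m - s)))"
      by (rule finsum_rdistr) (use t y in auto)
    also have "\<dots> = ?Y" by (rule finsum_cong') (use t y yt in \<open>auto simp: mult.commute\<close>)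
    finally have 2: "y \<otimes> (\<Oplus>s\<in>{..m}. qbinom q m s \<odot> ?t s (m - s)) = ?Y" .
    show ?thesis unfolding 1[symmetric] 2[symmetric]
      by (rule l_distr) (use x y t in \<open>auto intro!: finsum_closed\<close>)
  qed
  \<comment> \<open>The added term has coefficient \<open>qbinom q m (Suc m)\<close>, which is 0.
    Splitting off s = 0 afterwards shifts the index of this sum to that of \<open>?X\<close>, so
    that the Pascal rule applies termwise.\<close>
  also have "?Y = (\<Oplus>s\<in>{..Suc m}. (q ^ s * qbinom q m s) \<odot> ?t s (Suc m - s))"
    by (subst finsum_Suc) (use t x y in auto)
  also have "\<dots> = (\<Oplus>s\<in>{..m}. (q ^ Suc s * qbinom q m (Suc s)) \<odot> ?t (Suc s) (m - s)) \<oplus> ?t 0 (Suc m)" (is "_ = ?Z \<oplus> _")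
    by (subst finsum_Suc2) (use t x y in auto)
  also have "?X \<oplus> (?Z \<oplus> ?t 0 (Suc m)) = (?X \<oplus> ?Z) \<oplus> ?t 0 (Suc m)"
    by (rule a_assoc[symmetric]) (use t x y in \<open>auto intro!: finsum_closed\<close>)
  also have "?X \<oplus> ?Z = (\<Oplus>s\<in>{..m}. qbinom q m s \<odot> ?t (Suc s) (m - s) \<oplus> (q ^ Suc s * qbinom q m (Suc s)) \<odot> ?t (Suc s) (m - s))"
    by (rule finsum_addf[symmetric]) (use t x y in auto)
  also have "\<dots> = (\<Oplus>s\<in>{..m}. qbinom q (Suc m) (Suc s) \<odot> ?t (Suc s) (Suc m - Suc s))"
    by (rule finsum_cong') (use t x y in \<open>auto simp: smult_add_left simp del: nat_pow_Suc\<close>)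
  also have "\<dots> \<oplus> ?t 0 (Suc m) = (\<Oplus>s\<in>{..Suc m}. qbinom q (Suc m) s \<odot> ?t s (Suc m - s))"
    by (subst finsum_Suc2) (use t x y in auto)
  finally show ?case .
qed

lemma q_binomial_primitive_root:
  assumes q: "primitive_root_of_unity n q" and x: "x \<in> carrier A" and y: "y \<in> carrier A"
    and c: "y \<otimes> x = q \<odot> (x \<otimes> y)"
  shows "(x \<oplus> y) [^] n = x [^] n \<oplus> y [^] n"
proof -
  obtain m where m: "n = Suc m" using q by (cases n) (auto simp: primitive_root_of_unity_def)
  let ?f = "\<lambda>s. qbinom q n s \<odot> (x [^] s \<otimes> y [^] (n - s))"
  have f: "?f s \<in> carrier A" for s using x y by simp
  have "(x \<oplus> y) [^] n = (\<Oplus>s\<in>{..n}. ?f s)" by (rule q_binomial[OF x y c])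
  also have "\<dots> = (\<Oplus>s\<in>{0,n}. ?f s)"
    by (rule add.finprod_mono_neutral_cong_right)
      (use x y f qbinom_primitive_root[OF q] in auto)
  also have "\<dots> = x [^] n \<oplus> y [^] n"
    using x y m by (simp add: a_comm del: nat_pow_Suc)
  finally show ?thesis .
qed

end

section \<open>Skew primitive elements\<close>

lemma primitive_root_inverse:
  "primitive_root_of_unity n (q::'k::field) \<Longrightarrow> primitive_root_of_unity n (inverse q)"
  by (simp add: primitive_root_of_unity_def power_inverse)

lemma primitive_root_nonzero: "primitive_root_of_unity n (q::'k::field) \<Longrightarrow> q \<noteq> 0"
  by (auto simp: primitive_root_of_unity_def power_0_left split: if_splits)

text \<open>The exponent is n(n-1)/2. For n = 2m the power q^m is a square root of 1 other than 1,
  hence -1, and it is raised to the odd power n - 1; for odd n the exponent is a multiple of n. The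
  sign occurs in the nth power of the antipode of x.\<close>

lemma primitive_root_power_sum:
  assumes q: "primitive_root_of_unity n (q::'k::field)"
  shows "(-1) ^ n * q ^ (\<Sum>i<n. i) = -1"
proof -
  have n: "0 < n" "q ^ n = 1" using q by (auto simp: primitive_root_of_unity_def)
  have s: "2 * (\<Sum>i<n. i) = n * (n - 1)"
    by (induct n) (auto simp: algebra_simps)
  show ?thesis
  proof (cases "even n")
    case True
    then obtain m where m: "n = 2 * m" by auto
    with s have "(\<Sum>i<n. i) = m * (n - 1)" by simp
    moreover have "q ^ m = -1"
    proof -
      have "(q ^ m)\<^sup>2 = 1" using n m by (simp add: power_mult[symmetric] mult.commute)
      moreover have "q ^ m \<noteq> 1" using primitive_root_power_neq_1[OF q, of m] m n by simp
      ultimately show ?thesis by (simp add: power2_eq_1_iff)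
    qed
    moreover have "odd (n - 1)" using True n by simp
    ultimately show ?thesis using True by (simp add: power_mult)
  next
    case False
    then obtain m where m: "n = Suc (2 * m)" by (auto elim: oddE)
    with s have "(\<Sum>i<n. i) = n * m" by simp
    then have "q ^ (\<Sum>i<n. i) = 1" using n(2) by (simp add: power_mult)
    then show ?thesis using False by simp
  qed
qed

context kalgebra begin

lemma smult_diff_right: "\<lbrakk>x \<in> carrier A; y \<in> carrier A\<rbrakk> \<Longrightarrow> c \<odot> (x \<ominus> y) = c \<odot> x \<ominus> c \<odot> y"
  by (simp add: minus_eq smult_add_right smult_a_inv)

lemma add_diff_diff:
  "\<lbrakk>u \<in> carrier A; v \<in> carrier A; w \<in> carrier A\<rbrakk> \<Longrightarrow> (u \<ominus> v) \<oplus> (v \<ominus> w) = u \<ominus> w"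
  by (simp add: minus_eq a_assoc r_neg1)

lemma smult_pow: "x \<in> carrier A \<Longrightarrow> (c \<odot> x) [^] (m::nat) = c ^ m \<odot> x [^] m"
  by (induct m) (simp_all add: mult.commute)

lemma mult_pow_q_commute:
  assumes "b \<in> carrier A" "x \<in> carrier A" "x \<otimes> b = p \<odot> (b \<otimes> x)"
  shows "(b \<otimes> x) [^] (m::nat) = p ^ (\<Sum>i<m. i) \<odot> (b [^] m \<otimes> x [^] m)"
proof (induct m)
  case (Suc m)
  have "(b \<otimes> x) [^] Suc m = p ^ (\<Sum>i<m. i) \<odot> (b [^] m \<otimes> (x [^] m \<otimes> b) \<otimes> x)"
    using assms(1,2) Suc by (simp add: m_assoc)
  also have "x [^] m \<otimes> b = p ^ m \<odot> (b \<otimes> x [^] m)"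
    using q_commute_pow_pow[OF assms, of m 1] assms by simp
  finally show ?case using assms(1,2) by (simp add: m_assoc power_add)
qed simp

lemma opposite_pow: "x \<in> carrier A \<Longrightarrow> x [^]\<^bsub>opposite_algebra A\<^esub> (m::nat) = x [^] m"
proof -
  interpret O: kalgebra "opposite_algebra A" by (rule kalgebra_opposite) (rule kalgebra_axioms)
  assume x: "x \<in> carrier A"
  show ?thesis
  proof (induct m)
    case (Suc m)
    then show ?case by (simp only: nat_pow_Suc2[OF x] O.nat_pow_Suc opposite_algebra_simps)
  qed simp
qed

lemma inverse_pow:
  assumes a: "a \<in> carrier A" and b: "b \<in> carrier A" and ba: "b \<otimes> a = \<one>"
  shows "b [^] (m::nat) \<otimes> a [^] m = \<one>"
proof (induct m)
  case (Suc m)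
  have e: "a [^] Suc m = a \<otimes> a [^] m" by (rule nat_pow_Suc2[OF a])
  have "b [^] Suc m \<otimes> a [^] Suc m = b [^] m \<otimes> ((b \<otimes> a) \<otimes> a [^] m)"
    unfolding e using a b by (simp add: m_assoc)
  then show ?case using a ba Suc by simp
qed simp

lemma opposite_minus: "\<lbrakk>x \<in> carrier A; y \<in> carrier A\<rbrakk> \<Longrightarrow> x \<ominus>\<^bsub>opposite_algebra A\<^esub> y = x \<ominus> y"
proof -
  assume x: "x \<in> carrier A" "y \<in> carrier A"
  interpret O: kalgebra "opposite_algebra A" by (rule kalgebra_opposite) (rule kalgebra_axioms)
  have "\<ominus>\<^bsub>opposite_algebra A\<^esub> y = \<ominus> y"
    by (rule O.minus_equality) (use x in \<open>simp_all add: l_neg\<close>)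
  then show ?thesis by (simp add: a_minus_def)
qed

text \<open>The antipode sends \<open>x\<close> to \<open>-p a\<inverse> x\<close> with \<open>p\<close> inverse to \<open>q\<close>.\<close>

lemma antipode_pow:
  assumes q: "primitive_root_of_unity n p" and ab: "a \<in> carrier A" "b \<in> carrier A" "b \<otimes> a = \<one>" "a \<otimes> b = \<one>"
    and x: "x \<in> carrier A" "x \<otimes> b = p \<odot> (b \<otimes> x)" "x [^] n = \<alpha> \<odot> (a [^] n \<ominus> \<one>)"
  shows "((- p) \<odot> (b \<otimes> x)) [^] n = \<alpha> \<odot> (b [^] n \<ominus> \<one>)"
proof -
  have n: "p ^ n = 1" using q by (simp add: primitive_root_of_unity_def)
  note ba = inverse_pow[OF ab(1,2,3)]
  have "((- p) \<odot> (b \<otimes> x)) [^] n = ((- p) ^ n * p ^ (\<Sum>i<n. i)) \<odot> (b [^] n \<otimes> x [^] n)"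
    using ab x(1,2) by (simp add: smult_pow mult_pow_q_commute del: smult_minus)
  also have "(- p) ^ n * p ^ (\<Sum>i<n. i) = -1"
    using primitive_root_power_sum[OF q] n by (simp add: power_minus[of p])
  also have "b [^] n \<otimes> x [^] n = \<alpha> \<odot> (b [^] n \<otimes> (a [^] n \<ominus> \<one>))"
    using x ab by simp
  also have "b [^] n \<otimes> (a [^] n \<ominus> \<one>) = \<one> \<ominus> b [^] n"
    using ab ba[of n] by (simp add: minus_eq r_distr r_minus)
  also have "(-1) \<odot> (\<alpha> \<odot> (\<one> \<ominus> b [^] n)) = \<alpha> \<odot> ((-1) \<odot> (\<one> \<ominus> b [^] n))"
    using ab by (simp del: smult_minus)
  also have "(-1) \<odot> (\<one> \<ominus> b [^] n) = b [^] n \<ominus> \<one>"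
    using ab by (simp add: minus_eq minus_add a_comm)
  finally show ?thesis .
qed

end

lemma pure_pow:
  assumes "kalgebra A" "kalgebra B" "a \<in> carrier A" "b \<in> carrier B"
  shows "pure_tensor A B a b [^]\<^bsub>tensor A B\<^esub> (m::nat) = pure_tensor A B (a [^]\<^bsub>A\<^esub> m) (b [^]\<^bsub>B\<^esub> m)"
proof -
  interpret two_algebras A B by (rule two_algebrasI) fact+
  show ?thesis using assms
    by (induct m) (simp_all add: pure_one pure_mult)
qed

context two_algebras begin

lemma pure_diff_left: "\<lbrakk>a \<in> carrier A; a' \<in> carrier A; b \<in> carrier B\<rbrakk> \<Longrightarrow>
  pure_tensor A B (a \<ominus>\<^bsub>A\<^esub> a') b = pure_tensor A B a b \<ominus>\<^bsub>tensor A B\<^esub> pure_tensor A B a' b"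
  by (simp add: A.minus_eq T.minus_eq pure_add_left A.minus_eq_smult T.minus_eq_smult pure_smult_left pure_closed
      del: A.smult_minus T.smult_minus)

lemma pure_diff_right: "\<lbrakk>a \<in> carrier A; b' \<in> carrier B; b \<in> carrier B\<rbrakk> \<Longrightarrow>
  pure_tensor A B a (b \<ominus>\<^bsub>B\<^esub> b') = pure_tensor A B a b \<ominus>\<^bsub>tensor A B\<^esub> pure_tensor A B a b'"
  by (simp add: B.minus_eq T.minus_eq pure_add_right B.minus_eq_smult T.minus_eq_smult pure_smult_right pure_closed
      del: B.smult_minus T.smult_minus)

end

text \<open>There is no comultiplication yet: \<open>X\<close> is the prospective value of
  \<Delta>(x), and it has to satisfy, with g \<otimes> g, the same relations as x with g. The scalar
  is q for x and its inverse for y.\<close>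

locale skew_primitive = kalgebra U for U :: "('k::field, 'a) module" (structure) +
  fixes g x :: 'a and p :: 'k
  assumes g: "g \<in> carrier U" and x: "x \<in> carrier U" and xg: "x \<otimes> g = p \<odot> (g \<otimes> x)"
begin

interpretation two_algebras U U by (rule two_algebrasI) (rule kalgebra_axioms)+

abbreviation "X \<equiv> pure_tensor U U x g \<oplus>\<^bsub>tensor U U\<^esub> pure_tensor U U \<one> x"

lemma X_closed: "X \<in> carrier (tensor U U)"
  using g x by (simp add: pure_closed)

lemma X_commute: "X \<otimes>\<^bsub>tensor U U\<^esub> pure_tensor U U g g = p \<odot>\<^bsub>tensor U U\<^esub> (pure_tensor U U g g \<otimes>\<^bsub>tensor U U\<^esub> X)"
  using g x xg
  by (simp add: pure_closed pure_mult T.l_distr T.r_distr T.smult_add_right pure_smult_left pure_smult_right)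

lemma X_parts_commute: "pure_tensor U U \<one> x \<otimes>\<^bsub>tensor U U\<^esub> pure_tensor U U x g =
    p \<odot>\<^bsub>tensor U U\<^esub> (pure_tensor U U x g \<otimes>\<^bsub>tensor U U\<^esub> pure_tensor U U \<one> x)"
  using g x xg by (simp add: pure_mult pure_smult_right)

text \<open>The two summands of \<open>X\<close> commute up to p, so only the outer terms x^n
  \<otimes> g^n and 1 \<otimes> x^n of the q-binomial expansion remain. After inserting x^n =
  \<alpha>(g^n - 1), the terms 1 \<otimes> g^n cancel.\<close>

lemma X_pow:
  assumes q: "primitive_root_of_unity n p" and xn: "x [^] n = \<alpha> \<odot> (g [^] n \<ominus> \<one>)"
  shows "X [^]\<^bsub>tensor U U\<^esub> n = \<alpha> \<odot>\<^bsub>tensor U U\<^esub> (pure_tensor U U g g [^]\<^bsub>tensor U U\<^esub> n \<ominus>\<^bsub>tensor U U\<^esub> \<one>\<^bsub>tensor U U\<^esub>)"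
proof -
  let ?T = "tensor U U"
  have "X [^]\<^bsub>?T\<^esub> n = pure_tensor U U x g [^]\<^bsub>?T\<^esub> n \<oplus>\<^bsub>?T\<^esub> pure_tensor U U \<one> x [^]\<^bsub>?T\<^esub> n"
    by (rule T.q_binomial_primitive_root[OF q _ _ X_parts_commute]) (use g x in \<open>simp_all add: pure_closed\<close>)
  also have "\<dots> = pure_tensor U U (x [^] n) (g [^] n) \<oplus>\<^bsub>?T\<^esub> pure_tensor U U \<one> (x [^] n)"
    using g x by (simp add: pure_pow[OF kalgebra_axioms kalgebra_axioms])
  also have "pure_tensor U U (x [^] n) (g [^] n) = \<alpha> \<odot>\<^bsub>?T\<^esub> (pure_tensor U U (g [^] n) (g [^] n) \<ominus>\<^bsub>?T\<^esub> pure_tensor U U \<one> (g [^] n))"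
    unfolding xn using g by (simp add: pure_smult_left pure_diff_left)
  also have "pure_tensor U U \<one> (x [^] n) = \<alpha> \<odot>\<^bsub>?T\<^esub> (pure_tensor U U \<one> (g [^] n) \<ominus>\<^bsub>?T\<^esub> pure_tensor U U \<one> \<one>)"
    unfolding xn using g by (simp add: pure_smult_right pure_diff_right)
  also have "\<alpha> \<odot>\<^bsub>?T\<^esub> (pure_tensor U U (g [^] n) (g [^] n) \<ominus>\<^bsub>?T\<^esub> pure_tensor U U \<one> (g [^] n)) \<oplus>\<^bsub>?T\<^esub>
     \<alpha> \<odot>\<^bsub>?T\<^esub> (pure_tensor U U \<one> (g [^] n) \<ominus>\<^bsub>?T\<^esub> pure_tensor U U \<one> \<one>) =
     \<alpha> \<odot>\<^bsub>?T\<^esub> (pure_tensor U U (g [^] n) (g [^] n) \<ominus>\<^bsub>?T\<^esub> pure_tensor U U \<one> \<one>)"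
    using g by (simp add: T.smult_add_right[symmetric] T.add_diff_diff pure_closed)
  finally show ?thesis
    using g by (simp add: pure_pow[OF kalgebra_axioms kalgebra_axioms] pure_one)
qed

end

section \<open>The defining relations\<close>

text \<open>The relations for \<nu> = 1 as a predicate on three elements of any algebra, so that it
  applies alike to the algebra itself, its tensor square, its opposite and the field.\<close>

definition U_relations ::
  "nat \<Rightarrow> nat \<Rightarrow> 'k::field \<Rightarrow> 'k \<Rightarrow> 'k \<Rightarrow> 'k \<Rightarrow> ('k, 'b, 'n) module_scheme \<Rightarrow> 'b \<Rightarrow> 'b \<Rightarrow> 'b \<Rightarrow> bool" where
  "U_relations n N q \<alpha> \<beta> \<gamma> B a x y \<longleftrightarrow>
    a \<in> carrier B \<and> x \<in> carrier B \<and> y \<in> carrier B \<and> a [^]\<^bsub>B\<^esub> N = \<one>\<^bsub>B\<^esub> \<and>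
    x \<otimes>\<^bsub>B\<^esub> a = q \<odot>\<^bsub>B\<^esub> (a \<otimes>\<^bsub>B\<^esub> x) \<and> y \<otimes>\<^bsub>B\<^esub> a = inverse q \<odot>\<^bsub>B\<^esub> (a \<otimes>\<^bsub>B\<^esub> y) \<and>
    y \<otimes>\<^bsub>B\<^esub> x = inverse q \<odot>\<^bsub>B\<^esub> (x \<otimes>\<^bsub>B\<^esub> y) \<oplus>\<^bsub>B\<^esub> \<gamma> \<odot>\<^bsub>B\<^esub> (a [^]\<^bsub>B\<^esub> (2::nat) \<ominus>\<^bsub>B\<^esub> \<one>\<^bsub>B\<^esub>) \<and>
    x [^]\<^bsub>B\<^esub> n = \<alpha> \<odot>\<^bsub>B\<^esub> (a [^]\<^bsub>B\<^esub> n \<ominus>\<^bsub>B\<^esub> \<one>\<^bsub>B\<^esub>) \<and>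
    y [^]\<^bsub>B\<^esub> n = \<beta> \<odot>\<^bsub>B\<^esub> (a [^]\<^bsub>B\<^esub> n \<ominus>\<^bsub>B\<^esub> \<one>\<^bsub>B\<^esub>)"

text \<open>When YX and the multiple of XY are multiplied out, the cross terms y \<otimes> ax and x
  \<otimes> ay agree by the commutation rules with a. What remains is the relation for yx in either
  leg, and its two \<gamma>-terms telescope to a^2 \<otimes> a^2 - 1 \<otimes> 1.\<close>

lemma U_relations_tensor:
  fixes U :: "('k::field, 'a) module"
  assumes k: "kalgebra U" and q: "primitive_root_of_unity n q"
    and R: "U_relations n N q \<alpha> \<beta> \<gamma> U a x y"
  shows "U_relations n N q \<alpha> \<beta> \<gamma> (tensor U U) (pure_tensor U U a a)
    (pure_tensor U U x a \<oplus>\<^bsub>tensor U U\<^esub> pure_tensor U U \<one>\<^bsub>U\<^esub> x)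
    (pure_tensor U U y a \<oplus>\<^bsub>tensor U U\<^esub> pure_tensor U U \<one>\<^bsub>U\<^esub> y)"
proof -
  interpret kalgebra U by fact
  interpret two_algebras U U by (rule two_algebrasI) fact+
  let ?T = "tensor U U" and ?p = "pure_tensor U U"
  have c: "a \<in> carrier U" "x \<in> carrier U" "y \<in> carrier U" and aN: "a [^]\<^bsub>U\<^esub> N = \<one>\<^bsub>U\<^esub>"
    and xa: "x \<otimes>\<^bsub>U\<^esub> a = q \<odot>\<^bsub>U\<^esub> (a \<otimes>\<^bsub>U\<^esub> x)" and ya: "y \<otimes>\<^bsub>U\<^esub> a = inverse q \<odot>\<^bsub>U\<^esub> (a \<otimes>\<^bsub>U\<^esub> y)"
    and yx: "y \<otimes>\<^bsub>U\<^esub> x = inverse q \<odot>\<^bsub>U\<^esub> (x \<otimes>\<^bsub>U\<^esub> y) \<oplus>\<^bsub>U\<^esub> \<gamma> \<odot>\<^bsub>U\<^esub> (a [^]\<^bsub>U\<^esub> (2::nat) \<ominus>\<^bsub>U\<^esub> \<one>\<^bsub>U\<^esub>)"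
    and xn: "x [^]\<^bsub>U\<^esub> n = \<alpha> \<odot>\<^bsub>U\<^esub> (a [^]\<^bsub>U\<^esub> n \<ominus>\<^bsub>U\<^esub> \<one>\<^bsub>U\<^esub>)"
    and yn: "y [^]\<^bsub>U\<^esub> n = \<beta> \<odot>\<^bsub>U\<^esub> (a [^]\<^bsub>U\<^esub> n \<ominus>\<^bsub>U\<^esub> \<one>\<^bsub>U\<^esub>)"
    using R by (auto simp: U_relations_def)
  interpret x: skew_primitive U a x q by unfold_locales (use c xa in auto)
  interpret y: skew_primitive U a y "inverse q" by unfold_locales (use c ya in auto)
  have q0: "q \<noteq> 0" by (rule primitive_root_nonzero[OF q])
  let ?G = "\<gamma> \<odot>\<^bsub>U\<^esub> (a [^]\<^bsub>U\<^esub> (2::nat) \<ominus>\<^bsub>U\<^esub> \<one>\<^bsub>U\<^esub>)"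
  let ?a2 = "a [^]\<^bsub>U\<^esub> (2::nat)"
  have aa: "a \<otimes>\<^bsub>U\<^esub> a = ?a2" using c by (simp add: numeral_2_eq_2)
  have G: "?G \<in> carrier U" using c by simp
  have G2: "?p ?G ?a2 \<oplus>\<^bsub>?T\<^esub> ?p \<one>\<^bsub>U\<^esub> ?G = \<gamma> \<odot>\<^bsub>?T\<^esub> (?p a a [^]\<^bsub>?T\<^esub> (2::nat) \<ominus>\<^bsub>?T\<^esub> \<one>\<^bsub>?T\<^esub>)"
    using c by (simp add: pure_smult_left pure_smult_right pure_diff_left pure_diff_right pure_closed
        T.smult_add_right[symmetric] T.add_diff_diff pure_pow[OF k k] pure_one)
  let ?E1 = "inverse q \<odot>\<^bsub>?T\<^esub> ?p (x \<otimes>\<^bsub>U\<^esub> y) ?a2" and ?E2 = "?p y (a \<otimes>\<^bsub>U\<^esub> x)"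
  let ?E3 = "inverse q \<odot>\<^bsub>?T\<^esub> ?p x (a \<otimes>\<^bsub>U\<^esub> y)" and ?E4 = "inverse q \<odot>\<^bsub>?T\<^esub> ?p \<one>\<^bsub>U\<^esub> (x \<otimes>\<^bsub>U\<^esub> y)"
  have E: "?E1 \<in> carrier ?T" "?E2 \<in> carrier ?T" "?E3 \<in> carrier ?T" "?E4 \<in> carrier ?T"
    "?p ?G ?a2 \<in> carrier ?T" "?p \<one>\<^bsub>U\<^esub> ?G \<in> carrier ?T"
    using c G by (simp_all add: pure_closed)
  have YX: "y.X \<otimes>\<^bsub>?T\<^esub> x.X = ((?E1 \<oplus>\<^bsub>?T\<^esub> ?p ?G ?a2) \<oplus>\<^bsub>?T\<^esub> ?E2) \<oplus>\<^bsub>?T\<^esub> (?E3 \<oplus>\<^bsub>?T\<^esub> (?E4 \<oplus>\<^bsub>?T\<^esub> ?p \<one>\<^bsub>U\<^esub> ?G))"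
  proof -
    have "y.X \<otimes>\<^bsub>?T\<^esub> x.X = (?p (y \<otimes>\<^bsub>U\<^esub> x) (a \<otimes>\<^bsub>U\<^esub> a) \<oplus>\<^bsub>?T\<^esub> ?p y (a \<otimes>\<^bsub>U\<^esub> x)) \<oplus>\<^bsub>?T\<^esub> (?p x (y \<otimes>\<^bsub>U\<^esub> a) \<oplus>\<^bsub>?T\<^esub> ?p \<one>\<^bsub>U\<^esub> (y \<otimes>\<^bsub>U\<^esub> x))"
      using c by (simp add: pure_mult T.l_distr T.r_distr pure_closed T.a_ac)
    then show ?thesis unfolding yx ya aa using c G
      by (simp add: pure_add_left pure_add_right pure_smult_left pure_smult_right)
  qed
  have XY: "inverse q \<odot>\<^bsub>?T\<^esub> (x.X \<otimes>\<^bsub>?T\<^esub> y.X) = (?E1 \<oplus>\<^bsub>?T\<^esub> ?E3) \<oplus>\<^bsub>?T\<^esub> (?E2 \<oplus>\<^bsub>?T\<^esub> ?E4)"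
  proof -
    have "x.X \<otimes>\<^bsub>?T\<^esub> y.X = (?p (x \<otimes>\<^bsub>U\<^esub> y) (a \<otimes>\<^bsub>U\<^esub> a) \<oplus>\<^bsub>?T\<^esub> ?p x (a \<otimes>\<^bsub>U\<^esub> y)) \<oplus>\<^bsub>?T\<^esub> (?p y (x \<otimes>\<^bsub>U\<^esub> a) \<oplus>\<^bsub>?T\<^esub> ?p \<one>\<^bsub>U\<^esub> (x \<otimes>\<^bsub>U\<^esub> y))"
      using c by (simp add: pure_mult T.l_distr T.r_distr pure_closed T.a_ac)
    then show ?thesis unfolding xa aa using c q0
      by (simp add: pure_smult_left pure_smult_right T.smult_add_right pure_closed)
  qed
  have YX': "y.X \<otimes>\<^bsub>?T\<^esub> x.X = inverse q \<odot>\<^bsub>?T\<^esub> (x.X \<otimes>\<^bsub>?T\<^esub> y.X) \<oplus>\<^bsub>?T\<^esub> (?p ?G ?a2 \<oplus>\<^bsub>?T\<^esub> ?p \<one>\<^bsub>U\<^esub> ?G)"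
    unfolding YX XY using E by (simp only: T.a_ac T.a_closed)
  show ?thesis
    unfolding U_relations_def
    using c x.X_closed y.X_closed x.X_commute y.X_commute x.X_pow[OF q xn]
      y.X_pow[OF primitive_root_inverse[OF q] yn] YX'[unfolded G2]
    by (simp add: pure_closed pure_pow[OF k k] aN pure_one)
qed

text \<open>Collecting the inverse b of a on the left turns the relation between the antipodes of x
  and y into b^2 times the relation for yx. The reversed order of multiplication supplies the sign
  needed for b^2 (a^2 - 1) = 1 - b^2.\<close>

lemma U_relations_antipode:
  assumes k: "kalgebra U" and q: "primitive_root_of_unity n q"
    and R: "U_relations n N q \<alpha> \<beta> \<gamma> U a x y"
    and b: "b \<in> carrier U" "b \<otimes>\<^bsub>U\<^esub> a = \<one>\<^bsub>U\<^esub>" "a \<otimes>\<^bsub>U\<^esub> b = \<one>\<^bsub>U\<^esub>"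
  shows "x \<otimes>\<^bsub>U\<^esub> b = inverse q \<odot>\<^bsub>U\<^esub> (b \<otimes>\<^bsub>U\<^esub> x)" "y \<otimes>\<^bsub>U\<^esub> b = q \<odot>\<^bsub>U\<^esub> (b \<otimes>\<^bsub>U\<^esub> y)"
    "U_relations n N q \<alpha> \<beta> \<gamma> (opposite_algebra U) b
      ((- inverse q) \<odot>\<^bsub>U\<^esub> (b \<otimes>\<^bsub>U\<^esub> x)) ((- q) \<odot>\<^bsub>U\<^esub> (b \<otimes>\<^bsub>U\<^esub> y))"
proof -
  interpret kalgebra U by fact
  have c: "a \<in> carrier U" "x \<in> carrier U" "y \<in> carrier U" and aN: "a [^]\<^bsub>U\<^esub> N = \<one>\<^bsub>U\<^esub>"
    and xa: "x \<otimes>\<^bsub>U\<^esub> a = q \<odot>\<^bsub>U\<^esub> (a \<otimes>\<^bsub>U\<^esub> x)" and ya: "y \<otimes>\<^bsub>U\<^esub> a = inverse q \<odot>\<^bsub>U\<^esub> (a \<otimes>\<^bsub>U\<^esub> y)"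
    and yx: "y \<otimes>\<^bsub>U\<^esub> x = inverse q \<odot>\<^bsub>U\<^esub> (x \<otimes>\<^bsub>U\<^esub> y) \<oplus>\<^bsub>U\<^esub> \<gamma> \<odot>\<^bsub>U\<^esub> (a [^]\<^bsub>U\<^esub> (2::nat) \<ominus>\<^bsub>U\<^esub> \<one>\<^bsub>U\<^esub>)"
    and xn: "x [^]\<^bsub>U\<^esub> n = \<alpha> \<odot>\<^bsub>U\<^esub> (a [^]\<^bsub>U\<^esub> n \<ominus>\<^bsub>U\<^esub> \<one>\<^bsub>U\<^esub>)"
    and yn: "y [^]\<^bsub>U\<^esub> n = \<beta> \<odot>\<^bsub>U\<^esub> (a [^]\<^bsub>U\<^esub> n \<ominus>\<^bsub>U\<^esub> \<one>\<^bsub>U\<^esub>)"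
    using R by (auto simp: U_relations_def)
  have q0: "q \<noteq> 0" by (rule primitive_root_nonzero[OF q])
  have comm: "z \<otimes>\<^bsub>U\<^esub> b = inverse p \<odot>\<^bsub>U\<^esub> (b \<otimes>\<^bsub>U\<^esub> z)"
    if z: "z \<in> carrier U" "z \<otimes>\<^bsub>U\<^esub> a = p \<odot>\<^bsub>U\<^esub> (a \<otimes>\<^bsub>U\<^esub> z)" "p \<noteq> 0" for z p
  proof -
    have "b \<otimes>\<^bsub>U\<^esub> z = b \<otimes>\<^bsub>U\<^esub> (z \<otimes>\<^bsub>U\<^esub> a) \<otimes>\<^bsub>U\<^esub> b" using z(1) b c by (simp add: m_assoc)
    also have "\<dots> = p \<odot>\<^bsub>U\<^esub> ((b \<otimes>\<^bsub>U\<^esub> a) \<otimes>\<^bsub>U\<^esub> z \<otimes>\<^bsub>U\<^esub> b)"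
      unfolding z(2) using z(1) b(1) c by (simp add: m_assoc)
    finally have "b \<otimes>\<^bsub>U\<^esub> z = p \<odot>\<^bsub>U\<^esub> (z \<otimes>\<^bsub>U\<^esub> b)" using z(1) b by simp
    then show ?thesis using z b by simp
  qed
  show xb: "x \<otimes>\<^bsub>U\<^esub> b = inverse q \<odot>\<^bsub>U\<^esub> (b \<otimes>\<^bsub>U\<^esub> x)" by (rule comm[OF c(2) xa q0])
  show yb: "y \<otimes>\<^bsub>U\<^esub> b = q \<odot>\<^bsub>U\<^esub> (b \<otimes>\<^bsub>U\<^esub> y)" using comm[OF c(3) ya] q0 by simp
  let ?b2 = "b [^]\<^bsub>U\<^esub> (2::nat)"
  let ?X = "(- inverse q) \<odot>\<^bsub>U\<^esub> (b \<otimes>\<^bsub>U\<^esub> x)" and ?Y = "(- q) \<odot>\<^bsub>U\<^esub> (b \<otimes>\<^bsub>U\<^esub> y)"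
  have b2: "?b2 = b \<otimes>\<^bsub>U\<^esub> b" using b by (simp add: numeral_2_eq_2)
  have b2a2: "?b2 \<otimes>\<^bsub>U\<^esub> a [^]\<^bsub>U\<^esub> (2::nat) = \<one>\<^bsub>U\<^esub>"
  proof -
    have "?b2 \<otimes>\<^bsub>U\<^esub> a [^]\<^bsub>U\<^esub> (2::nat) = b \<otimes>\<^bsub>U\<^esub> ((b \<otimes>\<^bsub>U\<^esub> a) \<otimes>\<^bsub>U\<^esub> a)"
      unfolding b2 using b(1) c by (simp add: numeral_2_eq_2 m_assoc)
    then show ?thesis using b c by simp
  qed
  have XY: "?X \<otimes>\<^bsub>U\<^esub> ?Y = inverse q \<odot>\<^bsub>U\<^esub> (?b2 \<otimes>\<^bsub>U\<^esub> (x \<otimes>\<^bsub>U\<^esub> y))"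
  proof -
    have "?X \<otimes>\<^bsub>U\<^esub> ?Y = (- inverse q * - q) \<odot>\<^bsub>U\<^esub> (b \<otimes>\<^bsub>U\<^esub> (x \<otimes>\<^bsub>U\<^esub> b) \<otimes>\<^bsub>U\<^esub> y)"
      using b(1) c by (simp add: m_assoc mult.commute del: smult_minus)
    then show ?thesis unfolding xb b2 using b(1) c q0 by (simp add: m_assoc)
  qed
  have YX: "inverse q \<odot>\<^bsub>U\<^esub> (?Y \<otimes>\<^bsub>U\<^esub> ?X) = ?b2 \<otimes>\<^bsub>U\<^esub> (y \<otimes>\<^bsub>U\<^esub> x)"
  proof -
    have "?Y \<otimes>\<^bsub>U\<^esub> ?X = (- inverse q * - q) \<odot>\<^bsub>U\<^esub> (b \<otimes>\<^bsub>U\<^esub> (y \<otimes>\<^bsub>U\<^esub> b) \<otimes>\<^bsub>U\<^esub> x)"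
      using b(1) c by (simp add: m_assoc mult.commute del: smult_minus)
    then show ?thesis unfolding yb b2 using b(1) c q0 by (simp add: m_assoc)
  qed
  have YX': "?b2 \<otimes>\<^bsub>U\<^esub> (y \<otimes>\<^bsub>U\<^esub> x) = ?X \<otimes>\<^bsub>U\<^esub> ?Y \<oplus>\<^bsub>U\<^esub> \<gamma> \<odot>\<^bsub>U\<^esub> (\<one>\<^bsub>U\<^esub> \<ominus>\<^bsub>U\<^esub> ?b2)"
  proof -
    have "?b2 \<otimes>\<^bsub>U\<^esub> (a [^]\<^bsub>U\<^esub> (2::nat) \<ominus>\<^bsub>U\<^esub> \<one>\<^bsub>U\<^esub>) = \<one>\<^bsub>U\<^esub> \<ominus>\<^bsub>U\<^esub> ?b2"
      using b c b2a2 by (simp add: minus_eq r_distr r_minus)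
    then show ?thesis unfolding XY yx using b(1) c by (simp add: r_distr)
  qed
  have "\<gamma> \<odot>\<^bsub>U\<^esub> (\<one>\<^bsub>U\<^esub> \<ominus>\<^bsub>U\<^esub> ?b2) \<oplus>\<^bsub>U\<^esub> \<gamma> \<odot>\<^bsub>U\<^esub> (?b2 \<ominus>\<^bsub>U\<^esub> \<one>\<^bsub>U\<^esub>) = \<zero>\<^bsub>U\<^esub>"
    using b(1) by (simp add: smult_add_right[symmetric] add_diff_diff) (simp add: minus_eq r_neg)
  then have rel: "?X \<otimes>\<^bsub>U\<^esub> ?Y = inverse q \<odot>\<^bsub>U\<^esub> (?Y \<otimes>\<^bsub>U\<^esub> ?X) \<oplus>\<^bsub>U\<^esub> \<gamma> \<odot>\<^bsub>U\<^esub> (?b2 \<ominus>\<^bsub>U\<^esub> \<one>\<^bsub>U\<^esub>)"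
    unfolding YX YX' using b(1) c by (simp add: a_assoc del: smult_minus)
  have bN: "b [^]\<^bsub>U\<^esub> N = \<one>\<^bsub>U\<^esub>"
  proof -
    have "b [^]\<^bsub>U\<^esub> N \<otimes>\<^bsub>U\<^esub> a [^]\<^bsub>U\<^esub> N = \<one>\<^bsub>U\<^esub>" by (rule inverse_pow[OF c(1) b(1,2)])
    then show ?thesis using aN b by simp
  qed
  have bX: "b \<otimes>\<^bsub>U\<^esub> ?X = q \<odot>\<^bsub>U\<^esub> (?X \<otimes>\<^bsub>U\<^esub> b)"
    using b(1) c q0 by (simp add: m_assoc xb mult.assoc[symmetric] del: smult_minus)
  have bY: "b \<otimes>\<^bsub>U\<^esub> ?Y = inverse q \<odot>\<^bsub>U\<^esub> (?Y \<otimes>\<^bsub>U\<^esub> b)"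
    using b(1) c q0 by (simp add: m_assoc yb mult.assoc[symmetric] del: smult_minus)
  have Xn: "?X [^]\<^bsub>U\<^esub> n = \<alpha> \<odot>\<^bsub>U\<^esub> (b [^]\<^bsub>U\<^esub> n \<ominus>\<^bsub>U\<^esub> \<one>\<^bsub>U\<^esub>)"
    by (rule antipode_pow[OF primitive_root_inverse[OF q] c(1) b c(2) xb xn])
  have Yn: "?Y [^]\<^bsub>U\<^esub> n = \<beta> \<odot>\<^bsub>U\<^esub> (b [^]\<^bsub>U\<^esub> n \<ominus>\<^bsub>U\<^esub> \<one>\<^bsub>U\<^esub>)"
    by (rule antipode_pow[OF q c(1) b c(3) yb yn])
  have XYc: "?X \<in> carrier U" "?Y \<in> carrier U" using b c by simp_all
  show "U_relations n N q \<alpha> \<beta> \<gamma> (opposite_algebra U) b ?X ?Y"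
    unfolding U_relations_def
    using b(1) XYc bX bY Xn Yn bN rel
    by (simp add: opposite_pow opposite_minus del: smult_minus)
qed

lemma U_relations_counit:
  "primitive_root_of_unity n q \<Longrightarrow> U_relations n N q \<alpha> \<beta> \<gamma> base_algebra 1 0 0"
  by (auto simp: U_relations_def a_minus_def primitive_root_of_unity_def)

section \<open>The Hopf algebra structure\<close>

lemma word_monoid_simps [simp]:
  "carrier word_monoid = UNIV" "u \<otimes>\<^bsub>word_monoid\<^esub> v = u @ v" "\<one>\<^bsub>word_monoid\<^esub> = []"
  by (simp_all add: word_monoid_def)

lemma monoid_word_monoid: "Group.monoid word_monoid"
  by (rule monoidI) simp_all

context kalgebra begin

lemma diff_eq_imp_eq_add: "\<lbrakk>x \<in> carrier A; y \<in> carrier A; x \<ominus> y = z\<rbrakk> \<Longrightarrow> x = y \<oplus> z"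
  using a_lcomm[of y x "\<ominus> y"] by (auto simp: minus_eq r_neg)

lemma word_eval_Nil [simp]: "word_eval A \<phi> [] = \<one>"
  by (simp add: word_eval_def)

lemma word_eval_Cons [simp]: "word_eval A \<phi> (g # w) = \<phi> g \<otimes> word_eval A \<phi> w"
  by (simp add: word_eval_def)

lemma word_eval_closed: "(\<And>g. \<phi> g \<in> carrier A) \<Longrightarrow> word_eval A \<phi> w \<in> carrier A"
  by (induct w) auto

lemma word_eval_append:
  "(\<And>g. \<phi> g \<in> carrier A) \<Longrightarrow> word_eval A \<phi> (u @ v) = word_eval A \<phi> u \<otimes> word_eval A \<phi> v"
  by (induct u) (auto simp: word_eval_closed m_assoc)

lemma word_eval_replicate:
  assumes "\<phi> g \<in> carrier A"
  shows "word_eval A \<phi> (replicate m g) = \<phi> g [^] m"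
proof (induct m)
  case (Suc m)
  then show ?case by (simp only: replicate_Suc word_eval_Cons nat_pow_Suc2[OF assms])
qed simp

end

text \<open>The antipode is defined with \<open>induced U\<close> but evaluates words in the
  opposite algebra. Linear extension uses the additive structure only, so it may be read as a map
  into the opposite algebra.\<close>

lemma lin_ext_opposite: "lin_ext (opposite_algebra A) = lin_ext A"
  by (intro ext) (simp add: lin_ext_def opposite_algebra_def finsum_def)

text \<open>Here \<nu> = 1: then r = n, n and \<nu> are coprime, and n < N prevents N from dividing
  \<nu> n. The last assumption selects the relations x^n = \<alpha>(a^n - 1) and y^n = \<beta>(a^n -
  1).\<close>

locale U_parameters =
  fixes n N :: nat and q \<alpha> \<beta> \<gamma> :: "'k::field"
  assumes n: "2 < n" "n < N" "n dvd N" and q: "primitive_root_of_unity n q"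
    and \<alpha>\<beta>: "\<alpha> \<noteq> 0 \<or> \<beta> \<noteq> 0"
begin

definition "R = U_relators n N 1 q \<alpha> \<beta> \<gamma>"
definition "U = U_algebra n N 1 q \<alpha> \<beta> \<gamma>"
definition "word_class w = pres_class word_monoid R (Poly_Mapping.single w 1)"
definition "ga = word_class [Gen_a]"
definition "gx = word_class [Gen_x]"
definition "gy = word_class [Gen_y]"

lemma R_eq: "R = {Poly_Mapping.single (replicate N Gen_a) 1 - Poly_Mapping.single [] 1,
   Poly_Mapping.single [Gen_x, Gen_a] 1 - Poly_Mapping.single [Gen_a, Gen_x] q,
   Poly_Mapping.single [Gen_y, Gen_a] 1 - Poly_Mapping.single [Gen_a, Gen_y] (inverse q),
   Poly_Mapping.single [Gen_y, Gen_x] 1 - Poly_Mapping.single [Gen_x, Gen_y] (inverse q)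
     - (Poly_Mapping.single (replicate 2 Gen_a) \<gamma> - Poly_Mapping.single [] \<gamma>),
   Poly_Mapping.single (replicate n Gen_x) 1
     - (Poly_Mapping.single (replicate n Gen_a) \<alpha> - Poly_Mapping.single [] \<alpha>),
   Poly_Mapping.single (replicate n Gen_y) 1
     - (Poly_Mapping.single (replicate n Gen_a) \<beta> - Poly_Mapping.single [] \<beta>)}"
proof -
  have "\<not> (\<alpha> = 0 \<and> \<beta> = 0)" using \<alpha>\<beta> by auto
  then show ?thesis
    unfolding R_def U_relators_def Let_def
    by (simp only: if_False power_one_right mult_1 mult_1_right Un_insert_left Un_empty_left)
qed

lemma R_mem:
  "Poly_Mapping.single (replicate N Gen_a) 1 - Poly_Mapping.single [] 1 \<in> R"
  "Poly_Mapping.single [Gen_x, Gen_a] 1 - Poly_Mapping.single [Gen_a, Gen_x] q \<in> R"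
  "Poly_Mapping.single [Gen_y, Gen_a] 1 - Poly_Mapping.single [Gen_a, Gen_y] (inverse q) \<in> R"
  "Poly_Mapping.single [Gen_y, Gen_x] 1 - Poly_Mapping.single [Gen_x, Gen_y] (inverse q)
     - (Poly_Mapping.single (replicate 2 Gen_a) \<gamma> - Poly_Mapping.single [] \<gamma>) \<in> R"
  "Poly_Mapping.single (replicate n Gen_x) 1
     - (Poly_Mapping.single (replicate n Gen_a) \<alpha> - Poly_Mapping.single [] \<alpha>) \<in> R"
  "Poly_Mapping.single (replicate n Gen_y) 1
     - (Poly_Mapping.single (replicate n Gen_a) \<beta> - Poly_Mapping.single [] \<beta>) \<in> R"
  unfolding R_eq by blast+

sublocale pres: presentation word_monoid R
  by (rule presentation.intro[OF monoid_word_monoid]) (unfold_locales, simp)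

lemma U_eq: "U = presented word_monoid R"
  unfolding U_def U_algebra_def U_ideal_def presented_def relator_ideal_def R_def ..

lemma U_gen_eq: "U_gen n N 1 q \<alpha> \<beta> \<gamma> g = word_class [g]"
  unfolding U_gen_def word_class_def pres_class_def relator_ideal_def U_ideal_def R_def ..

sublocale U: kalgebra U unfolding U_eq by (rule pres.P.kalgebra_axioms)

lemma word_class_closed: "word_class w \<in> carrier U"
  unfolding word_class_def U_eq by (rule pres.pres_class_closed) simp

lemma word_class_append: "word_class (u @ v) = word_class u \<otimes>\<^bsub>U\<^esub> word_class v"
  unfolding word_class_def U_eq by (subst pres.pres_class_mult[symmetric]) simp_all

lemma word_class_Nil: "word_class [] = \<one>\<^bsub>U\<^esub>"
  unfolding word_class_def U_eq using pres.pres_class_one by simp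

lemma word_class_Cons: "word_class (g # w) = word_class [g] \<otimes>\<^bsub>U\<^esub> word_class w"
  using word_class_append[of "[g]" w] by simp

lemma word_class_replicate: "word_class (replicate m g) = word_class [g] [^]\<^bsub>U\<^esub> m"
proof (induct m)
  case 0
  then show ?case by (simp add: word_class_Nil)
next
  case (Suc m)
  have "word_class (replicate (Suc m) g) = word_class [g] \<otimes>\<^bsub>U\<^esub> word_class (replicate m g)"
    by (subst word_class_Cons[symmetric]) simp
  then show ?case by (simp only: Suc U.nat_pow_Suc2[OF word_class_closed])
qed

lemma gens_closed [simp]: "ga \<in> carrier U" "gx \<in> carrier U" "gy \<in> carrier U"
  by (simp_all add: ga_def gx_def gy_def word_class_closed)

lemma U_induct [consumes 1, case_names one a x y mult add smult]:
  assumes "z \<in> carrier U" and one: "Q \<one>\<^bsub>U\<^esub>" and gen: "Q ga" "Q gx" "Q gy"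
    and mult: "\<And>y z. y \<in> carrier U \<Longrightarrow> z \<in> carrier U \<Longrightarrow> Q y \<Longrightarrow> Q z \<Longrightarrow> Q (y \<otimes>\<^bsub>U\<^esub> z)"
    and add: "\<And>y z. y \<in> carrier U \<Longrightarrow> z \<in> carrier U \<Longrightarrow> Q y \<Longrightarrow> Q z \<Longrightarrow> Q (y \<oplus>\<^bsub>U\<^esub> z)"
    and smult: "\<And>c z. z \<in> carrier U \<Longrightarrow> Q z \<Longrightarrow> Q (c \<odot>\<^bsub>U\<^esub> z)"
  shows "Q z"
  using assms(1)[unfolded U_eq]
proof (induct z rule: pres.presented_induct)
  case (single w)
  have "Q (word_class w)"
  proof (induct w)
    case Nil
    then show ?case using one by (simp add: word_class_Nil)
  next
    case (Cons g w)
    have "Q (word_class [g])" using gen by (cases g) (simp_all add: ga_def gx_def gy_def)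
    then show ?case by (subst word_class_Cons) (intro mult word_class_closed Cons)
  qed
  then show ?case by (simp add: word_class_def)
qed (use add smult in \<open>simp_all add: U_eq\<close>)

lemma relations: "U_relations n N q \<alpha> \<beta> \<gamma> U ga gx gy"
proof -
  let ?c = "\<lambda>f. pres_class word_monoid R f"
  have s: "?c (Poly_Mapping.single w c) = c \<odot>\<^bsub>U\<^esub> word_class w" for w c
    unfolding U_eq word_class_def by (rule pres.pres_class_single) simp
  have d: "?c (f - g) = ?c f \<ominus>\<^bsub>U\<^esub> ?c g" for f g
    unfolding U_eq by (rule pres.pres_class_diff) simp_all
  have cl: "?c f \<in> carrier U" for f unfolding U_eq by (rule pres.pres_class_closed) simp
  have e: "?c f = ?c g" if "f - g \<in> R" for f g
  proof -
    have "?c f \<ominus>\<^bsub>U\<^esub> ?c g = \<zero>\<^bsub>U\<^esub>"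
      using pres.pres_class_relator[OF that] d[of f g] by (simp add: U_eq)
    then show ?thesis using cl by simp
  qed
  have 1: "ga [^]\<^bsub>U\<^esub> N = \<one>\<^bsub>U\<^esub>"
    using e[OF R_mem(1)] by (simp add: s word_class_Nil word_class_replicate ga_def word_class_closed)
  have 2: "gx \<otimes>\<^bsub>U\<^esub> ga = q \<odot>\<^bsub>U\<^esub> (ga \<otimes>\<^bsub>U\<^esub> gx)"
    using e[OF R_mem(2)] by (simp add: s word_class_Cons[of _ "[_]"] ga_def gx_def word_class_closed)
  have 3: "gy \<otimes>\<^bsub>U\<^esub> ga = inverse q \<odot>\<^bsub>U\<^esub> (ga \<otimes>\<^bsub>U\<^esub> gy)"
    using e[OF R_mem(3)] by (simp add: s word_class_Cons[of _ "[_]"] ga_def gy_def word_class_closed)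
  have pw: "?c (Poly_Mapping.single (replicate m Gen_a) c - Poly_Mapping.single [] c)
      = c \<odot>\<^bsub>U\<^esub> (ga [^]\<^bsub>U\<^esub> m \<ominus>\<^bsub>U\<^esub> \<one>\<^bsub>U\<^esub>)" for m c
    by (simp only: d s word_class_Nil word_class_replicate ga_def[symmetric])
      (simp add: U.smult_diff_right)
  have "?c (Poly_Mapping.single [Gen_y, Gen_x] 1 - Poly_Mapping.single [Gen_x, Gen_y] (inverse q)) =
      \<gamma> \<odot>\<^bsub>U\<^esub> (ga [^]\<^bsub>U\<^esub> (2::nat) \<ominus>\<^bsub>U\<^esub> \<one>\<^bsub>U\<^esub>)"
    unfolding pw[symmetric] by (rule e[OF R_mem(4)])
  then have "gy \<otimes>\<^bsub>U\<^esub> gx \<ominus>\<^bsub>U\<^esub> inverse q \<odot>\<^bsub>U\<^esub> (gx \<otimes>\<^bsub>U\<^esub> gy) = \<gamma> \<odot>\<^bsub>U\<^esub> (ga [^]\<^bsub>U\<^esub> (2::nat) \<ominus>\<^bsub>U\<^esub> \<one>\<^bsub>U\<^esub>)"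
    by (simp add: d s word_class_Cons[of _ "[_]"] gx_def gy_def word_class_closed)
  then have 4: "gy \<otimes>\<^bsub>U\<^esub> gx = inverse q \<odot>\<^bsub>U\<^esub> (gx \<otimes>\<^bsub>U\<^esub> gy) \<oplus>\<^bsub>U\<^esub> \<gamma> \<odot>\<^bsub>U\<^esub> (ga [^]\<^bsub>U\<^esub> (2::nat) \<ominus>\<^bsub>U\<^esub> \<one>\<^bsub>U\<^esub>)"
    using U.diff_eq_imp_eq_add[of "gy \<otimes>\<^bsub>U\<^esub> gx" "inverse q \<odot>\<^bsub>U\<^esub> (gx \<otimes>\<^bsub>U\<^esub> gy)"] by simp
  have 5: "gx [^]\<^bsub>U\<^esub> n = \<alpha> \<odot>\<^bsub>U\<^esub> (ga [^]\<^bsub>U\<^esub> n \<ominus>\<^bsub>U\<^esub> \<one>\<^bsub>U\<^esub>)"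
  proof -
    have "?c (Poly_Mapping.single (replicate n Gen_x) 1) = \<alpha> \<odot>\<^bsub>U\<^esub> (ga [^]\<^bsub>U\<^esub> n \<ominus>\<^bsub>U\<^esub> \<one>\<^bsub>U\<^esub>)"
      unfolding pw[symmetric] by (rule e[OF R_mem(5)])
    then show ?thesis by (simp add: s word_class_replicate gx_def word_class_closed)
  qed
  have 6: "gy [^]\<^bsub>U\<^esub> n = \<beta> \<odot>\<^bsub>U\<^esub> (ga [^]\<^bsub>U\<^esub> n \<ominus>\<^bsub>U\<^esub> \<one>\<^bsub>U\<^esub>)"
  proof -
    have "?c (Poly_Mapping.single (replicate n Gen_y) 1) = \<beta> \<odot>\<^bsub>U\<^esub> (ga [^]\<^bsub>U\<^esub> n \<ominus>\<^bsub>U\<^esub> \<one>\<^bsub>U\<^esub>)"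
      unfolding pw[symmetric] by (rule e[OF R_mem(6)])
    then show ?thesis by (simp add: s word_class_replicate gy_def word_class_closed)
  qed
  show ?thesis unfolding U_relations_def using 1 2 3 4 5 6 by simp
qed

text \<open>The universal property. With the tensor square, the field and the opposite algebra as
  targets it produces \<Delta>, \<epsilon> and S.\<close>

lemma U_hom:
  assumes B: "kalgebra B" and rel: "U_relations n N q \<alpha> \<beta> \<gamma> B a x y"
  shows "induced B (word_eval B (case_gen a x y)) \<in> alg_hom U B"
    "induced B (word_eval B (case_gen a x y)) ga = a"
    "induced B (word_eval B (case_gen a x y)) gx = x"
    "induced B (word_eval B (case_gen a x y)) gy = y"
proof -
  interpret B: kalgebra B by fact
  let ?e = "word_eval B (case_gen a x y)"
  have c: "a \<in> carrier B" "x \<in> carrier B" "y \<in> carrier B" and r: "a [^]\<^bsub>B\<^esub> N = \<one>\<^bsub>B\<^esub>"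
    "x \<otimes>\<^bsub>B\<^esub> a = q \<odot>\<^bsub>B\<^esub> (a \<otimes>\<^bsub>B\<^esub> x)" "y \<otimes>\<^bsub>B\<^esub> a = inverse q \<odot>\<^bsub>B\<^esub> (a \<otimes>\<^bsub>B\<^esub> y)"
    "y \<otimes>\<^bsub>B\<^esub> x = inverse q \<odot>\<^bsub>B\<^esub> (x \<otimes>\<^bsub>B\<^esub> y) \<oplus>\<^bsub>B\<^esub> \<gamma> \<odot>\<^bsub>B\<^esub> (a [^]\<^bsub>B\<^esub> (2::nat) \<ominus>\<^bsub>B\<^esub> \<one>\<^bsub>B\<^esub>)"
    "x [^]\<^bsub>B\<^esub> n = \<alpha> \<odot>\<^bsub>B\<^esub> (a [^]\<^bsub>B\<^esub> n \<ominus>\<^bsub>B\<^esub> \<one>\<^bsub>B\<^esub>)"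
    "y [^]\<^bsub>B\<^esub> n = \<beta> \<odot>\<^bsub>B\<^esub> (a [^]\<^bsub>B\<^esub> n \<ominus>\<^bsub>B\<^esub> \<one>\<^bsub>B\<^esub>)"
    using rel by (auto simp: U_relations_def)
  have g: "case_gen a x y g \<in> carrier B" for g using c by (cases g) auto
  have ec: "?e w \<in> carrier B" for w by (rule B.word_eval_closed) (rule g)
  have e: "?e \<in> UNIV \<rightarrow> carrier B" using ec by auto
  have s: "lin_ext B ?e (Poly_Mapping.single w c) = c \<odot>\<^bsub>B\<^esub> ?e w" for w c
    by (rule B.lin_ext_single) (rule ec)
  have d: "lin_ext B ?e (f - g) = lin_ext B ?e f \<ominus>\<^bsub>B\<^esub> lin_ext B ?e g" for f g
    by (rule B.lin_ext_diff[OF _ _ e]) simp_all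
  have rep: "?e (replicate m Gen_a) = a [^]\<^bsub>B\<^esub> m" "?e (replicate m Gen_x) = x [^]\<^bsub>B\<^esub> m"
    "?e (replicate m Gen_y) = y [^]\<^bsub>B\<^esub> m" for m
    using c by (simp_all add: B.word_eval_replicate)
  have pw: "lin_ext B ?e (Poly_Mapping.single (replicate m Gen_a) c - Poly_Mapping.single [] c)
      = c \<odot>\<^bsub>B\<^esub> (a [^]\<^bsub>B\<^esub> m \<ominus>\<^bsub>B\<^esub> \<one>\<^bsub>B\<^esub>)" for m c
    using \<open>a \<in> carrier B\<close> by (simp add: d s rep B.smult_diff_right)
  have 1: "lin_ext B ?e r = \<zero>\<^bsub>B\<^esub>" if "r \<in> R" for r
    using that unfolding R_eq
    by (elim insertE emptyE; hypsubst; subst d; (subst pw)?; (subst d)?)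
      (use c in \<open>simp_all add: s rep r B.add_minus_minus\<close>)
  have comp: "compatible word_monoid R B ?e"
    by (rule pres.compatibleI_mult[OF B])
      (use e 1 in \<open>simp_all add: B.word_eval_append[OF g]\<close>)
  show "induced B ?e \<in> alg_hom U B"
    unfolding U_eq by (rule pres.induced_alg_hom[OF B comp]) (simp_all add: B.word_eval_append[OF g])
  have "induced B ?e (word_class w) = ?e w" for w
    unfolding word_class_def by (rule pres.induced_single[OF B comp]) simp
  then show "induced B ?e ga = a" "induced B ?e gx = x" "induced B ?e gy = y"
    using c by (simp_all add: ga_def gx_def gy_def)
qed

lemmas relationsD = relations[unfolded U_relations_def]

lemma ga_pow_N: "ga [^]\<^bsub>U\<^esub> N = \<one>\<^bsub>U\<^esub>"
  and gx_ga: "gx \<otimes>\<^bsub>U\<^esub> ga = q \<odot>\<^bsub>U\<^esub> (ga \<otimes>\<^bsub>U\<^esub> gx)"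
  and gy_ga: "gy \<otimes>\<^bsub>U\<^esub> ga = inverse q \<odot>\<^bsub>U\<^esub> (ga \<otimes>\<^bsub>U\<^esub> gy)"
  and gy_gx: "gy \<otimes>\<^bsub>U\<^esub> gx = inverse q \<odot>\<^bsub>U\<^esub> (gx \<otimes>\<^bsub>U\<^esub> gy) \<oplus>\<^bsub>U\<^esub> \<gamma> \<odot>\<^bsub>U\<^esub> (ga [^]\<^bsub>U\<^esub> (2::nat) \<ominus>\<^bsub>U\<^esub> \<one>\<^bsub>U\<^esub>)"
  and gx_pow_n: "gx [^]\<^bsub>U\<^esub> n = \<alpha> \<odot>\<^bsub>U\<^esub> (ga [^]\<^bsub>U\<^esub> n \<ominus>\<^bsub>U\<^esub> \<one>\<^bsub>U\<^esub>)"
  and gy_pow_n: "gy [^]\<^bsub>U\<^esub> n = \<beta> \<odot>\<^bsub>U\<^esub> (ga [^]\<^bsub>U\<^esub> n \<ominus>\<^bsub>U\<^esub> \<one>\<^bsub>U\<^esub>)"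
  using relationsD by blast+

lemma ga_Units: "ga \<in> Units U"
proof -
  have N: "Suc (N - 1) = N" using n by simp
  have "ga [^]\<^bsub>U\<^esub> (N - 1) \<otimes>\<^bsub>U\<^esub> ga = \<one>\<^bsub>U\<^esub>"
    by (simp only: U.nat_pow_Suc[symmetric] N ga_pow_N)
  moreover have "ga \<otimes>\<^bsub>U\<^esub> ga [^]\<^bsub>U\<^esub> (N - 1) = \<one>\<^bsub>U\<^esub>"
    by (simp only: U.nat_pow_Suc2[OF gens_closed(1), symmetric] N ga_pow_N)
  ultimately show ?thesis unfolding Units_def by (auto intro!: bexI[of _ "ga [^]\<^bsub>U\<^esub> (N - 1)"])
qed

abbreviation "gb \<equiv> inv\<^bsub>U\<^esub> ga"

lemma gb: "gb \<in> carrier U" "gb \<otimes>\<^bsub>U\<^esub> ga = \<one>\<^bsub>U\<^esub>" "ga \<otimes>\<^bsub>U\<^esub> gb = \<one>\<^bsub>U\<^esub>"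
  using ga_Units by simp_all

lemmas antipode_relations = U_relations_antipode[OF U.kalgebra_axioms q relations gb]

definition "\<Delta> = induced (tensor U U) (word_eval (tensor U U)
  (case_gen (pure_tensor U U ga ga)
    (pure_tensor U U gx ga \<oplus>\<^bsub>tensor U U\<^esub> pure_tensor U U \<one>\<^bsub>U\<^esub> gx)
    (pure_tensor U U gy ga \<oplus>\<^bsub>tensor U U\<^esub> pure_tensor U U \<one>\<^bsub>U\<^esub> gy)))"

definition "\<epsilon> = induced base_algebra (word_eval base_algebra (case_gen 1 0 0))"

definition "S = induced U (word_eval (opposite_algebra U)
  (case_gen gb ((- inverse q) \<odot>\<^bsub>U\<^esub> (gb \<otimes>\<^bsub>U\<^esub> gx)) ((- q) \<odot>\<^bsub>U\<^esub> (gb \<otimes>\<^bsub>U\<^esub> gy))))"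

lemma ga_pow_one: "ga [^]\<^bsub>U\<^esub> (1::nat) = ga"
  by simp

lemma U_hopf_eq: "U_hopf n N 1 q \<alpha> \<beta> \<gamma> = module.extend U (hopf.fields \<Delta> \<epsilon> S)"
  unfolding U_hopf_def Let_def U_gen_eq U_def[symmetric] ga_def[symmetric] gx_def[symmetric]
    gy_def[symmetric] power_one_right ga_pow_one \<Delta>_def \<epsilon>_def S_def ..

lemmas \<Delta>_hom = U_hom[OF kalgebra_tensor[OF U.kalgebra_axioms U.kalgebra_axioms]
    U_relations_tensor[OF U.kalgebra_axioms q relations], folded \<Delta>_def]
lemmas \<epsilon>_hom = U_hom[OF kalgebra_base U_relations_counit[OF q], folded \<epsilon>_def]

lemma S_hom:
  "S \<in> alg_hom U (opposite_algebra U)" "S ga = gb"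
  "S gx = (- inverse q) \<odot>\<^bsub>U\<^esub> (gb \<otimes>\<^bsub>U\<^esub> gx)" "S gy = (- q) \<odot>\<^bsub>U\<^esub> (gb \<otimes>\<^bsub>U\<^esub> gy)"
proof -
  have i: "induced (opposite_algebra U) = induced U"
    by (intro ext) (simp add: induced_def lin_ext_opposite)
  have eq: "S = induced (opposite_algebra U) (word_eval (opposite_algebra U)
    (case_gen gb ((- inverse q) \<odot>\<^bsub>U\<^esub> (gb \<otimes>\<^bsub>U\<^esub> gx)) ((- q) \<odot>\<^bsub>U\<^esub> (gb \<otimes>\<^bsub>U\<^esub> gy))))"
    unfolding S_def i ..
  note h = U_hom[OF kalgebra_opposite[OF U.kalgebra_axioms] antipode_relations(3), folded eq]
  show "S \<in> alg_hom U (opposite_algebra U)" "S ga = gb"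
    "S gx = (- inverse q) \<odot>\<^bsub>U\<^esub> (gb \<otimes>\<^bsub>U\<^esub> gx)" "S gy = (- q) \<odot>\<^bsub>U\<^esub> (gb \<otimes>\<^bsub>U\<^esub> gy)"
    by (rule h)+
qed

sublocale Hopf: hopf_data U \<Delta> \<epsilon> S
  by unfold_locales (rule \<Delta>_hom \<epsilon>_hom S_hom)+

lemma hopf_at: "h \<in> carrier U \<Longrightarrow> Hopf.hopf_at h"
proof (induct h rule: U_induct)
  case one
  show ?case by (rule Hopf.hopf_at_one)
next
  case a
  show ?case by (rule Hopf.hopf_at_grouplike) (simp_all add: \<Delta>_hom \<epsilon>_hom S_hom gb)
next
  case x
  show ?case
  proof (rule Hopf.hopf_at_skew_primitive[of ga])
    have "gb \<otimes>\<^bsub>U\<^esub> gx \<otimes>\<^bsub>U\<^esub> ga = q \<odot>\<^bsub>U\<^esub> gx"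
      using gb by (simp add: U.m_assoc gx_ga) (simp add: U.m_assoc[symmetric])
    then show "S gx \<otimes>\<^bsub>U\<^esub> ga \<oplus>\<^bsub>U\<^esub> gx = \<zero>\<^bsub>U\<^esub>"
      using gb primitive_root_nonzero[OF q] by (simp add: S_hom U.l_minus U.l_neg)
    show "gx \<otimes>\<^bsub>U\<^esub> S ga \<oplus>\<^bsub>U\<^esub> S gx = \<zero>\<^bsub>U\<^esub>"
      using gb by (simp add: S_hom antipode_relations(1) U.r_neg)
  qed (simp_all add: \<Delta>_hom \<epsilon>_hom)
next
  case y
  show ?case
  proof (rule Hopf.hopf_at_skew_primitive[of ga])
    have "gb \<otimes>\<^bsub>U\<^esub> gy \<otimes>\<^bsub>U\<^esub> ga = inverse q \<odot>\<^bsub>U\<^esub> gy"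
      using gb by (simp add: U.m_assoc gy_ga) (simp add: U.m_assoc[symmetric])
    then show "S gy \<otimes>\<^bsub>U\<^esub> ga \<oplus>\<^bsub>U\<^esub> gy = \<zero>\<^bsub>U\<^esub>"
      using gb primitive_root_nonzero[OF q] by (simp add: S_hom U.l_minus U.l_neg)
    show "gy \<otimes>\<^bsub>U\<^esub> S ga \<oplus>\<^bsub>U\<^esub> S gy = \<zero>\<^bsub>U\<^esub>"
      using gb by (simp add: S_hom antipode_relations(2) U.r_neg)
  qed (simp_all add: \<Delta>_hom \<epsilon>_hom)
qed (simp_all add: Hopf.hopf_at_mult Hopf.hopf_at_add Hopf.hopf_at_smult)

theorem hopf_algebra_U: "hopf_algebra (U_hopf n N 1 q \<alpha> \<beta> \<gamma>)"
  unfolding U_hopf_eq by (rule Hopf.hopf_algebraI) (rule hopf_at)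

end

section \<open>The monomial basis\<close>

lemma dim_by_dual_basis:
  fixes A :: "('k::field, 'a, 'm) module_scheme"
  assumes A: "kalgebra A" and I: "finite I" and b: "\<And>p. p \<in> I \<Longrightarrow> b p \<in> carrier A"
    and c: "\<And>p. p \<in> I \<Longrightarrow> c p \<in> linear_maps A base_algebra"
    and dual: "\<And>p p'. p \<in> I \<Longrightarrow> p' \<in> I \<Longrightarrow> c p (b p') = (if p = p' then 1 else 0)"
    and gen: "\<And>z. z \<in> carrier A \<Longrightarrow> z = (\<Oplus>\<^bsub>A\<^esub>p\<in>I. c p z \<odot>\<^bsub>A\<^esub> b p)"
  shows "vectorspace.fin_dim class_ring A" "vectorspace.dim class_ring A = card I"
proof -
  have am: "abelian_monoid A"
    using A by (simp add: kalgebra_def ring_def abelian_group_def)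
  interpret assoc_algebra A by (rule kalgebra_imp_assoc_algebra) fact
  let ?B = "b ` I"
  have inj: "inj_on b I"
  proof (rule inj_onI)
    fix p p' assume "p \<in> I" "p' \<in> I" "b p = b p'"
    then show "p = p'" using dual[of p p] dual[of p p'] by (simp split: if_splits)
  qed
  have BC: "?B \<subseteq> carrier A" using b by auto
  have lc: "lincomb a ?B = (\<Oplus>\<^bsub>A\<^esub>p\<in>I. a (b p) \<odot>\<^bsub>A\<^esub> b p)" for a
    unfolding lincomb_def
    by (subst abelian_monoid.finsum_reindex[OF am _ inj]) (use b in \<open>auto simp: o_def\<close>)
  have ind: "\<not> lin_dep ?B"
  proof (rule finite_lin_indpt2)
    fix a assume "lincomb a ?B = \<zero>\<^bsub>A\<^esub>"
    then have z: "(\<Oplus>\<^bsub>A\<^esub>p\<in>I. a (b p) \<odot>\<^bsub>A\<^esub> b p) = \<zero>\<^bsub>A\<^esub>" unfolding lc .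
    have "a (b p) = 0" if p: "p \<in> I" for p
    proof -
      have "0 = c p (\<Oplus>\<^bsub>A\<^esub>p\<in>I. a (b p) \<odot>\<^bsub>A\<^esub> b p)"
        unfolding z using linear_maps_zero[OF A kalgebra_base c[OF p]] by simp
      also have "\<dots> = (\<Sum>p'\<in>I. c p (a (b p') \<odot>\<^bsub>A\<^esub> b p'))"
        by (subst linear_maps_finsum[OF A kalgebra_base c[OF p]]) (use b in auto)
      also have "\<dots> = (\<Sum>p'\<in>I. if p = p' then a (b p') else 0)"
        by (rule sum.cong[OF refl]) (use b p in \<open>simp add: linear_mapsD(3)[OF c[OF p]] dual\<close>)
      also have "\<dots> = a (b p)" using p by (subst sum.delta'[OF I]) (rule if_P)
      finally show ?thesis by simp
    qed
    then show "\<forall>v\<in>?B. a v = \<zero>\<^bsub>class_ring\<^esub>" by simp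
  next
    show "finite ?B" using I by simp
  next
    show "?B \<subseteq> carrier A" by (rule BC)
  qed
  have gen: "span ?B = carrier A"
  proof
    show "span ?B \<subseteq> carrier A" by (rule span_is_subset2[OF BC])
    show "carrier A \<subseteq> span ?B"
    proof
      fix z assume z: "z \<in> carrier A"
      \<comment> \<open>\<open>lincomb\<close> takes coefficients indexed by vectors. The map
        \<open>b\<close> is injective by duality, and its inverse converts the expansion over the
        index set.\<close>
      have "lincomb (\<lambda>v. c (the_inv_into I b v) z) ?B = (\<Oplus>\<^bsub>A\<^esub>p\<in>I. c p z \<odot>\<^bsub>A\<^esub> b p)"
        unfolding lc by (rule abelian_monoid.finsum_cong'[OF am]) (use b in \<open>auto simp: the_inv_into_f_f[OF inj]\<close>)
      then have "lincomb (\<lambda>v. c (the_inv_into I b v) z) ?B = z" using gen[OF z] by simp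
      moreover have "finite ?B" using I by simp
      ultimately show "z \<in> span ?B"
        unfolding finite_span[OF \<open>finite ?B\<close> BC] by (intro CollectI exI[of _ "\<lambda>v. c (the_inv_into I b v) z"] conjI) simp_all
    qed
  qed
  have "finite ?B" using I by simp
  then show "vectorspace.fin_dim class_ring A"
    unfolding fin_dim_def using BC gen by blast
  have "basis ?B" unfolding basis_def using ind gen BC by blast
  then show "vectorspace.dim class_ring A = card I"
    using dim_basis[OF \<open>finite ?B\<close>] card_image[OF inj] by simp
qed

section \<open>Straightening: the monomials in the box span\<close>

context U_parameters begin

definition "monomial i j k = ga [^]\<^bsub>U\<^esub> (i::nat) \<otimes>\<^bsub>U\<^esub> gx [^]\<^bsub>U\<^esub> (j::nat) \<otimes>\<^bsub>U\<^esub> gy [^]\<^bsub>U\<^esub> (k::nat)"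

definition "Box = {..<N} \<times> {..<n} \<times> {..<n}"

abbreviation "e \<equiv> \<lambda>(i, j, k). monomial i j k"

lemma finite_Box: "finite Box" by (simp add: Box_def)

lemma card_Box: "card Box = N * n\<^sup>2"
  by (simp add: Box_def card_cartesian_product power2_eq_square)

lemma monomial_closed: "monomial i j k \<in> carrier U"
  by (simp add: monomial_def)

definition "box_span = {\<Oplus>\<^bsub>U\<^esub>p\<in>Box. c p \<odot>\<^bsub>U\<^esub> e p | c. True}"

lemma e_closed: "e p \<in> carrier U" by (cases p) (simp add: monomial_closed)

lemma box_span_closed: "z \<in> box_span \<Longrightarrow> z \<in> carrier U"
proof -
  assume "z \<in> box_span"
  then obtain c where z: "z = (\<Oplus>\<^bsub>U\<^esub>p\<in>Box. c p \<odot>\<^bsub>U\<^esub> e p)" by (auto simp: box_span_def)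
  show ?thesis unfolding z by (rule U.finsum_closed) (use e_closed in blast)
qed

lemma box_span_add: "y \<in> box_span \<Longrightarrow> z \<in> box_span \<Longrightarrow> y \<oplus>\<^bsub>U\<^esub> z \<in> box_span"
proof -
  assume "y \<in> box_span" "z \<in> box_span"
  then obtain c d where y: "y = (\<Oplus>\<^bsub>U\<^esub>p\<in>Box. c p \<odot>\<^bsub>U\<^esub> e p)" and z: "z = (\<Oplus>\<^bsub>U\<^esub>p\<in>Box. d p \<odot>\<^bsub>U\<^esub> e p)"
    by (auto simp: box_span_def)
  have "y \<oplus>\<^bsub>U\<^esub> z = (\<Oplus>\<^bsub>U\<^esub>p\<in>Box. c p \<odot>\<^bsub>U\<^esub> e p \<oplus>\<^bsub>U\<^esub> d p \<odot>\<^bsub>U\<^esub> e p)"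
    unfolding y z by (rule U.finsum_addf[symmetric]) (use e_closed in blast)+
  also have "\<dots> = (\<Oplus>\<^bsub>U\<^esub>p\<in>Box. (c p + d p) \<odot>\<^bsub>U\<^esub> e p)"
    by (rule U.finsum_cong') (use e_closed in \<open>auto simp only: U.smult_add_left U.smult_closed Pi_iff\<close>)
  finally show ?thesis unfolding box_span_def by (auto intro!: exI[of _ "\<lambda>p. c p + d p"])
qed

lemma box_span_smult: "z \<in> box_span \<Longrightarrow> d \<odot>\<^bsub>U\<^esub> z \<in> box_span"
proof -
  assume "z \<in> box_span"
  then obtain c where z: "z = (\<Oplus>\<^bsub>U\<^esub>p\<in>Box. c p \<odot>\<^bsub>U\<^esub> e p)" by (auto simp: box_span_def)
  have "d \<odot>\<^bsub>U\<^esub> z = (\<Oplus>\<^bsub>U\<^esub>p\<in>Box. d \<odot>\<^bsub>U\<^esub> (c p \<odot>\<^bsub>U\<^esub> e p))"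
    unfolding z by (rule U.smult_finsum) (use e_closed in blast)
  also have "\<dots> = (\<Oplus>\<^bsub>U\<^esub>p\<in>Box. (d * c p) \<odot>\<^bsub>U\<^esub> e p)"
    by (rule U.finsum_cong') (use e_closed in \<open>auto simp only: U.smult_smult U.smult_closed Pi_iff\<close>)
  finally show ?thesis unfolding box_span_def by (auto intro!: exI[of _ "\<lambda>p. d * c p"])
qed

lemma box_span_zero: "\<zero>\<^bsub>U\<^esub> \<in> box_span"
proof -
  have "(\<Oplus>\<^bsub>U\<^esub>p\<in>Box. 0 \<odot>\<^bsub>U\<^esub> e p) = \<zero>\<^bsub>U\<^esub>"
    by (rule U.add.finprod_one_eqI) (use e_closed in \<open>simp only: U.smult_0\<close>)
  then show ?thesis unfolding box_span_def by (auto intro!: exI[of _ "\<lambda>_. 0"])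
qed

lemma box_span_diff: "y \<in> box_span \<Longrightarrow> z \<in> box_span \<Longrightarrow> y \<ominus>\<^bsub>U\<^esub> z \<in> box_span"
  unfolding U.minus_eq using box_span_closed[of z] box_span_add[of y "\<ominus>\<^bsub>U\<^esub> z"] box_span_smult[of z "-1"]
  by simp

lemma box_span_finsum: "(\<And>u. u \<in> I \<Longrightarrow> f u \<in> box_span) \<Longrightarrow> finsum U f I \<in> box_span"
proof (induct I rule: infinite_finite_induct)
  case (insert x F)
  then show ?case by (subst U.finsum_insert) (auto intro: box_span_add box_span_closed)
qed (simp_all add: box_span_zero U.finsum_infinite)

lemma box_span_box: "i < N \<Longrightarrow> j < n \<Longrightarrow> k < n \<Longrightarrow> monomial i j k \<in> box_span"
proof -
  assume a: "i < N" "j < n" "k < n"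
  have "(\<Oplus>\<^bsub>U\<^esub>p\<in>Box. (if p = (i, j, k) then 1 else 0) \<odot>\<^bsub>U\<^esub> e p) = (\<Oplus>\<^bsub>U\<^esub>p\<in>{(i, j, k)}. 1 \<odot>\<^bsub>U\<^esub> e p)"
    by (rule U.add.finprod_mono_neutral_cong_right)
      (use a finite_Box monomial_closed in \<open>auto simp: Box_def\<close>)
  also have "\<dots> = monomial i j k" by (simp add: monomial_closed)
  finally show ?thesis unfolding box_span_def by (auto intro!: exI[of _ "\<lambda>p. if p = (i, j, k) then 1 else 0"])
qed

lemma q_pow_n: "q ^ n = 1"
  using q by (simp add: primitive_root_of_unity_def)

lemma gx_pow_ga_pow: "gx [^]\<^bsub>U\<^esub> (j::nat) \<otimes>\<^bsub>U\<^esub> ga [^]\<^bsub>U\<^esub> (i::nat) = q ^ (j * i) \<odot>\<^bsub>U\<^esub> (ga [^]\<^bsub>U\<^esub> i \<otimes>\<^bsub>U\<^esub> gx [^]\<^bsub>U\<^esub> j)"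
  by (rule U.q_commute_pow_pow) (simp_all add: gx_ga)

lemma gy_pow_ga_pow: "gy [^]\<^bsub>U\<^esub> (j::nat) \<otimes>\<^bsub>U\<^esub> ga [^]\<^bsub>U\<^esub> (i::nat) = inverse q ^ (j * i) \<odot>\<^bsub>U\<^esub> (ga [^]\<^bsub>U\<^esub> i \<otimes>\<^bsub>U\<^esub> gy [^]\<^bsub>U\<^esub> j)"
  by (rule U.q_commute_pow_pow) (simp_all add: gy_ga)

lemma ga_pow_mod: "ga [^]\<^bsub>U\<^esub> (i mod N) = ga [^]\<^bsub>U\<^esub> i"
proof -
  have "ga [^]\<^bsub>U\<^esub> i = ga [^]\<^bsub>U\<^esub> (N * (i div N) + i mod N)" by simp
  also have "\<dots> = (ga [^]\<^bsub>U\<^esub> N) [^]\<^bsub>U\<^esub> (i div N) \<otimes>\<^bsub>U\<^esub> ga [^]\<^bsub>U\<^esub> (i mod N)"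
    by (simp only: U.nat_pow_mult[symmetric] U.nat_pow_pow gens_closed)
  finally show ?thesis by (simp add: ga_pow_N)
qed

lemma monomial_mod: "monomial (i mod N) j k = monomial i j k"
  by (simp add: monomial_def ga_pow_mod)

lemma monomial_reduce_x: "monomial i (n + j) k = \<alpha> \<odot>\<^bsub>U\<^esub> (monomial (i + n) j k \<ominus>\<^bsub>U\<^esub> monomial i j k)"
proof -
  have "monomial i (n + j) k = ga [^]\<^bsub>U\<^esub> i \<otimes>\<^bsub>U\<^esub> gx [^]\<^bsub>U\<^esub> n \<otimes>\<^bsub>U\<^esub> (gx [^]\<^bsub>U\<^esub> j \<otimes>\<^bsub>U\<^esub> gy [^]\<^bsub>U\<^esub> k)"
    by (simp add: monomial_def U.nat_pow_mult[symmetric] U.m_assoc)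
  also have "\<dots> = \<alpha> \<odot>\<^bsub>U\<^esub> ((ga [^]\<^bsub>U\<^esub> i \<otimes>\<^bsub>U\<^esub> (ga [^]\<^bsub>U\<^esub> n \<ominus>\<^bsub>U\<^esub> \<one>\<^bsub>U\<^esub>)) \<otimes>\<^bsub>U\<^esub> (gx [^]\<^bsub>U\<^esub> j \<otimes>\<^bsub>U\<^esub> gy [^]\<^bsub>U\<^esub> k))"
    unfolding gx_pow_n by simp
  also have "ga [^]\<^bsub>U\<^esub> i \<otimes>\<^bsub>U\<^esub> (ga [^]\<^bsub>U\<^esub> n \<ominus>\<^bsub>U\<^esub> \<one>\<^bsub>U\<^esub>) = ga [^]\<^bsub>U\<^esub> (i + n) \<ominus>\<^bsub>U\<^esub> ga [^]\<^bsub>U\<^esub> i"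
    by (simp add: U.minus_eq U.r_distr U.r_minus U.nat_pow_mult)
  finally show ?thesis by (simp add: monomial_def U.minus_eq U.l_distr U.l_minus U.m_assoc)
qed

text \<open>Here a^n - 1 arises behind x^j and has to be moved to the front; this is possible
  because q^n = 1 makes a^n commute with x.\<close>

lemma monomial_reduce_y: "monomial i j (n + k) = \<beta> \<odot>\<^bsub>U\<^esub> (monomial (i + n) j k \<ominus>\<^bsub>U\<^esub> monomial i j k)"
proof -
  have "monomial i j (n + k) = ga [^]\<^bsub>U\<^esub> i \<otimes>\<^bsub>U\<^esub> gx [^]\<^bsub>U\<^esub> j \<otimes>\<^bsub>U\<^esub> gy [^]\<^bsub>U\<^esub> n \<otimes>\<^bsub>U\<^esub> gy [^]\<^bsub>U\<^esub> k"
    by (simp add: monomial_def U.nat_pow_mult[symmetric] U.m_assoc)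
  also have "\<dots> = \<beta> \<odot>\<^bsub>U\<^esub> (ga [^]\<^bsub>U\<^esub> i \<otimes>\<^bsub>U\<^esub> (gx [^]\<^bsub>U\<^esub> j \<otimes>\<^bsub>U\<^esub> (ga [^]\<^bsub>U\<^esub> n \<ominus>\<^bsub>U\<^esub> \<one>\<^bsub>U\<^esub>)) \<otimes>\<^bsub>U\<^esub> gy [^]\<^bsub>U\<^esub> k)"
    unfolding gy_pow_n by (simp add: U.m_assoc)
  also have "gx [^]\<^bsub>U\<^esub> j \<otimes>\<^bsub>U\<^esub> (ga [^]\<^bsub>U\<^esub> n \<ominus>\<^bsub>U\<^esub> \<one>\<^bsub>U\<^esub>) = (ga [^]\<^bsub>U\<^esub> n \<ominus>\<^bsub>U\<^esub> \<one>\<^bsub>U\<^esub>) \<otimes>\<^bsub>U\<^esub> gx [^]\<^bsub>U\<^esub> j"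
    by (simp add: U.minus_eq U.r_distr U.l_distr U.r_minus U.l_minus gx_pow_ga_pow)
      (simp add: mult.commute[of _ n] power_mult q_pow_n)
  also have "ga [^]\<^bsub>U\<^esub> i \<otimes>\<^bsub>U\<^esub> ((ga [^]\<^bsub>U\<^esub> n \<ominus>\<^bsub>U\<^esub> \<one>\<^bsub>U\<^esub>) \<otimes>\<^bsub>U\<^esub> gx [^]\<^bsub>U\<^esub> j) = (ga [^]\<^bsub>U\<^esub> (i + n) \<ominus>\<^bsub>U\<^esub> ga [^]\<^bsub>U\<^esub> i) \<otimes>\<^bsub>U\<^esub> gx [^]\<^bsub>U\<^esub> j"
    by (simp add: U.minus_eq U.r_distr U.l_distr U.r_minus U.l_minus U.nat_pow_mult[symmetric] U.m_assoc)
  finally show ?thesis by (simp add: monomial_def U.minus_eq U.l_distr U.l_minus U.m_assoc)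
qed

text \<open>Each reduction lowers j + k by n > 0 at the price of raising the exponent of a, which is
  finally reduced modulo N.\<close>

lemma box_span_mon: "monomial i j k \<in> box_span"
proof (induct "j + k" arbitrary: i j k rule: less_induct)
  case less
  show ?case
  proof (cases "j < n")
    case False
    then obtain j' where j: "j = n + j'" by (metis le_Suc_ex not_le)
    show ?thesis unfolding j monomial_reduce_x using n
      by (intro box_span_smult box_span_diff less) (simp_all add: j)
  next
    case j: True
    show ?thesis
    proof (cases "k < n")
      case False
      then obtain k' where k: "k = n + k'" by (metis le_Suc_ex not_le)
      show ?thesis unfolding k monomial_reduce_y using n
        by (intro box_span_smult box_span_diff less) (simp_all add: k)
    next
      case True
      then show ?thesis using j n box_span_box[of "i mod N" j k] by (simp add: monomial_mod)
    qed
  qed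
qed

lemma box_span_mult:
  assumes z: "z \<in> carrier U" and m: "\<And>i j k. monomial i j k \<otimes>\<^bsub>U\<^esub> z \<in> box_span" and w: "w \<in> box_span"
  shows "w \<otimes>\<^bsub>U\<^esub> z \<in> box_span"
proof -
  obtain c where w: "w = (\<Oplus>\<^bsub>U\<^esub>p\<in>Box. c p \<odot>\<^bsub>U\<^esub> e p)" using w by (auto simp: box_span_def)
  have "w \<otimes>\<^bsub>U\<^esub> z = (\<Oplus>\<^bsub>U\<^esub>p\<in>Box. (c p \<odot>\<^bsub>U\<^esub> e p) \<otimes>\<^bsub>U\<^esub> z)"
    unfolding w by (rule U.finsum_ldistr) (use z finite_Box e_closed in auto)
  also have "\<dots> \<in> box_span"
  proof (rule box_span_finsum)
    fix p :: "nat \<times> nat \<times> nat"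
    obtain i j k where p: "p = (i, j, k)" by (cases p)
    show "c p \<odot>\<^bsub>U\<^esub> e p \<otimes>\<^bsub>U\<^esub> z \<in> box_span"
      using z box_span_smult[OF m[of i j k], of "c p"] by (simp add: p monomial_closed)
  qed
  finally show ?thesis .
qed

lemma monomial_gy: "monomial i j k \<otimes>\<^bsub>U\<^esub> gy = monomial i j (Suc k)"
  by (simp add: monomial_def U.m_assoc)

lemma monomial_ga: "monomial i j k \<otimes>\<^bsub>U\<^esub> ga = (q ^ j * inverse q ^ k) \<odot>\<^bsub>U\<^esub> monomial (Suc i) j k"
proof -
  have "monomial i j k \<otimes>\<^bsub>U\<^esub> ga = ga [^]\<^bsub>U\<^esub> i \<otimes>\<^bsub>U\<^esub> (gx [^]\<^bsub>U\<^esub> j \<otimes>\<^bsub>U\<^esub> (gy [^]\<^bsub>U\<^esub> k \<otimes>\<^bsub>U\<^esub> ga))"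
    by (simp add: monomial_def U.m_assoc)
  also have "gy [^]\<^bsub>U\<^esub> k \<otimes>\<^bsub>U\<^esub> ga = inverse q ^ k \<odot>\<^bsub>U\<^esub> (ga \<otimes>\<^bsub>U\<^esub> gy [^]\<^bsub>U\<^esub> k)"
    using gy_pow_ga_pow[of k 1] by simp
  also have "gx [^]\<^bsub>U\<^esub> j \<otimes>\<^bsub>U\<^esub> (inverse q ^ k \<odot>\<^bsub>U\<^esub> (ga \<otimes>\<^bsub>U\<^esub> gy [^]\<^bsub>U\<^esub> k)) =
      inverse q ^ k \<odot>\<^bsub>U\<^esub> ((gx [^]\<^bsub>U\<^esub> j \<otimes>\<^bsub>U\<^esub> ga) \<otimes>\<^bsub>U\<^esub> gy [^]\<^bsub>U\<^esub> k)"
    by (simp add: U.m_assoc)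
  also have "gx [^]\<^bsub>U\<^esub> j \<otimes>\<^bsub>U\<^esub> ga = q ^ j \<odot>\<^bsub>U\<^esub> (ga \<otimes>\<^bsub>U\<^esub> gx [^]\<^bsub>U\<^esub> j)"
    using gx_pow_ga_pow[of j 1] by simp
  finally show ?thesis by (simp add: monomial_def U.m_assoc mult.commute)
qed

lemma box_span_gy: "w \<in> box_span \<Longrightarrow> w \<otimes>\<^bsub>U\<^esub> gy \<in> box_span"
  by (rule box_span_mult) (simp_all add: monomial_gy box_span_mon)

lemma box_span_ga: "w \<in> box_span \<Longrightarrow> w \<otimes>\<^bsub>U\<^esub> ga \<in> box_span"
  by (rule box_span_mult) (simp_all add: monomial_ga box_span_mon box_span_smult)

text \<open>The y next to x is exchanged with it. Every resulting term has one y less in front of x,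
  or no x to be moved, and is followed only by y or powers of a, for which closure is already
  known.\<close>

lemma box_span_mon_gx: "monomial i j k \<otimes>\<^bsub>U\<^esub> gx \<in> box_span"
proof (induct k)
  case 0
  have "monomial i j 0 \<otimes>\<^bsub>U\<^esub> gx = monomial i (Suc j) 0" by (simp add: monomial_def U.m_assoc)
  then show ?case by (simp add: box_span_mon)
next
  case (Suc k)
  have "monomial i j (Suc k) \<otimes>\<^bsub>U\<^esub> gx = monomial i j k \<otimes>\<^bsub>U\<^esub> (gy \<otimes>\<^bsub>U\<^esub> gx)"
    by (simp add: monomial_gy[symmetric] U.m_assoc monomial_closed)
  also have "\<dots> = inverse q \<odot>\<^bsub>U\<^esub> (monomial i j k \<otimes>\<^bsub>U\<^esub> gx \<otimes>\<^bsub>U\<^esub> gy) \<oplus>\<^bsub>U\<^esub>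
      \<gamma> \<odot>\<^bsub>U\<^esub> (monomial i j k \<otimes>\<^bsub>U\<^esub> ga \<otimes>\<^bsub>U\<^esub> ga \<ominus>\<^bsub>U\<^esub> monomial i j k)"
    unfolding gy_gx by (simp add: U.m_assoc monomial_closed U.r_distr U.r_minus U.minus_eq numeral_2_eq_2)
  finally show ?case
    using Suc by (simp only:) (intro box_span_add box_span_smult box_span_diff box_span_gy box_span_ga box_span_mon; assumption)
qed

lemma box_span_gx: "w \<in> box_span \<Longrightarrow> w \<otimes>\<^bsub>U\<^esub> gx \<in> box_span"
  by (rule box_span_mult) (simp_all add: box_span_mon_gx)

lemma box_span_all: "z \<in> carrier U \<Longrightarrow> z \<in> box_span"
proof -
  assume z: "z \<in> carrier U"
  \<comment> \<open>Stability of the span under right multiplication by z, unlike mere membership of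
    z, passes to products in the induction. Taking w = 1 then gives membership.\<close>
  have "\<forall>w. w \<in> box_span \<longrightarrow> w \<otimes>\<^bsub>U\<^esub> z \<in> box_span"
    using z
  proof (induct z rule: U_induct)
    case (mult y z)
    then show ?case by (simp add: U.m_assoc[symmetric] box_span_closed)
  qed (simp_all add: box_span_closed box_span_ga box_span_gx box_span_gy U.r_distr box_span_add box_span_smult)
  moreover have "\<one>\<^bsub>U\<^esub> \<in> box_span" using box_span_mon[of 0 0 0] by (simp add: monomial_def)
  ultimately show ?thesis using z by force
qed

end

section \<open>The operators of the generators on functionals\<close>

primrec geom_sum :: "'k::field \<Rightarrow> nat \<Rightarrow> 'k" where
  "geom_sum p 0 = 0"
| "geom_sum p (Suc m) = 1 + p * geom_sum p m"

text \<open>With p inverse to q, moving x to the left gives y^k x = p^k x y^k + \<gamma>(T a^2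
  y^(k-1) - G y^(k-1)), where T is this sum and G is \<open>geom_sum\<close>. The summand p^(2m)
  arises when y^m passes a^2. Both sums vanish at k = 0, where k - 1 is truncated.\<close>

primrec twisted_geom_sum :: "'k::field \<Rightarrow> nat \<Rightarrow> 'k" where
  "twisted_geom_sum p 0 = 0"
| "twisted_geom_sum p (Suc m) = p ^ (2 * m) + p * twisted_geom_sum p m"

lemma geom_sum_closed: "(p - 1) * geom_sum p m = p ^ m - 1"
proof (induct m)
  case (Suc m)
  have "(p - 1) * geom_sum p (Suc m) = (p - 1) + p * ((p - 1) * geom_sum p m)"
    by (simp add: algebra_simps)
  then show ?case unfolding Suc by (simp add: algebra_simps)
qed simp

lemma geom_sum_shift: "geom_sum p m + p ^ m = 1 + p * geom_sum p m"
proof -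
  have "p * geom_sum p m - geom_sum p m = p ^ m - 1"
    using geom_sum_closed[of p m] by (simp add: algebra_simps)
  then show ?thesis by (simp add: algebra_simps)
qed

text \<open>The closed form p^(m-1) times the geometric sum, cleared of the exponent m - 1. It
  transfers periodicity from the geometric sum.\<close>

lemma twisted_geom_sum_eq: "p * twisted_geom_sum p m = p ^ m * geom_sum p m"
proof (induct m)
  case (Suc m)
  have "p * twisted_geom_sum p (Suc m) = p * p ^ (2 * m) + p * (p ^ m * geom_sum p m)"
    by (simp add: distrib_left Suc)
  also have "\<dots> = p ^ Suc m * (geom_sum p m + p ^ m)"
    by (simp add: algebra_simps power_add mult_2_right)
  finally show ?case by (simp only: geom_sum_shift geom_sum.simps)
qed simp

text \<open>The closed forms depend on the index only through powers of p, and the factors p - 1 and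
  p can be cancelled. For k = 0 both sums vanish at n, which is why x^n commutes with y.\<close>

lemma geom_sum_add_root:
  assumes "p ^ n = 1" "p \<noteq> 1" "p \<noteq> 0"
  shows "geom_sum p (k + n) = geom_sum p k"
    "twisted_geom_sum p (k + n) = twisted_geom_sum p k"
proof -
  have "(p - 1) * geom_sum p (k + n) = (p - 1) * geom_sum p k"
    unfolding geom_sum_closed using assms by (simp add: power_add)
  then show g: "geom_sum p (k + n) = geom_sum p k" using assms by simp
  have "p * twisted_geom_sum p (k + n) = p * twisted_geom_sum p k"
    unfolding twisted_geom_sum_eq g using assms by (simp add: power_add)
  then show "twisted_geom_sum p (k + n) = twisted_geom_sum p k" using assms by simp
qed

text \<open>A functional \<open>\<psi>\<close> on the algebra is encoded by the function
  \<open>f i j k = \<psi> (a^i x^j y^k)\<close>. The operators below are the left action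
  \<open>(h \<psi>)(u) = \<psi> (u h)\<close> of the generators on functionals, in terms of \<open>f\<close>; \<open>functionals\<close> are the
  functions compatible with the relations for \<open>a^N\<close>, \<open>x^n\<close> and \<open>y^n\<close>.\<close>

context U_parameters begin

abbreviation "p \<equiv> inverse q"

definition opA :: "(nat \<Rightarrow> nat \<Rightarrow> nat \<Rightarrow> 'k) \<Rightarrow> nat \<Rightarrow> nat \<Rightarrow> nat \<Rightarrow> 'k" where
  "opA f i j k = q ^ j * p ^ k * f (Suc i) j k"

definition opX :: "(nat \<Rightarrow> nat \<Rightarrow> nat \<Rightarrow> 'k) \<Rightarrow> nat \<Rightarrow> nat \<Rightarrow> nat \<Rightarrow> 'k" where
  "opX f i j k = p ^ k * f i (Suc j) k + \<gamma> * (twisted_geom_sum p k * q ^ (2 * j) * f (Suc (Suc i)) j (k - 1)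
     - geom_sum p k * f i j (k - 1))"

definition opY :: "(nat \<Rightarrow> nat \<Rightarrow> nat \<Rightarrow> 'k) \<Rightarrow> nat \<Rightarrow> nat \<Rightarrow> nat \<Rightarrow> 'k" where
  "opY f i j k = f i j (Suc k)"

definition functionals :: "(nat \<Rightarrow> nat \<Rightarrow> nat \<Rightarrow> 'k) set" where
  "functionals = {f. \<forall>i j k. f (i + N) j k = f i j k \<and>
     f i (j + n) k = \<alpha> * (f (i + n) j k - f i j k) \<and> f i j (k + n) = \<beta> * (f (i + n) j k - f i j k)}"

lemma functionalsD:
  assumes "f \<in> functionals"
  shows "f (i + N) j k = f i j k" "f i (j + n) k = \<alpha> * (f (i + n) j k - f i j k)"
    "f i j (k + n) = \<beta> * (f (i + n) j k - f i j k)"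
  using assms by (auto simp: functionals_def)

text \<open>Each defining relation equates one word with a combination of at most three others, so
  linearity is stated for three terms; spare slots get the coefficient 0.\<close>

abbreviation "lc3 a f b g c h \<equiv> (\<lambda>i j k. a * f i j k + b * g i j k + c * h i j k :: 'k)"

lemma op_linear:
  "opA (lc3 a f b g c h) = lc3 a (opA f) b (opA g) c (opA h)"
  "opX (lc3 a f b g c h) = lc3 a (opX f) b (opX g) c (opX h)"
  "opY (lc3 a f b g c h) = lc3 a (opY f) b (opY g) c (opY h)"
  by (simp_all add: opA_def opX_def opY_def fun_eq_iff algebra_simps)

lemma op_scale:
  "opA (\<lambda>i j k. c * f i j k) = (\<lambda>i j k. c * opA f i j k)"
  "opX (\<lambda>i j k. c * f i j k) = (\<lambda>i j k. c * opX f i j k)"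
  "opY (\<lambda>i j k. c * f i j k) = (\<lambda>i j k. c * opY f i j k)"
  by (simp_all add: opA_def opX_def opY_def fun_eq_iff algebra_simps)

lemma q0: "q \<noteq> 0" by (rule primitive_root_nonzero[OF q])

lemma q1: "q \<noteq> 1" using primitive_root_power_neq_1[OF q, of 1] n by simp

lemma p_pow_n: "p ^ n = 1" using q_pow_n by (simp add: power_inverse)

lemma opX_opA: "opX (opA f) = (\<lambda>i j k. q * opA (opX f) i j k)"
proof (intro ext)
  fix i j k
  show "opX (opA f) i j k = q * opA (opX f) i j k"
    using q0 by (cases k) (simp_all add: opX_def opA_def field_simps)
qed

lemma opA_opX: "opA (opX f) = (\<lambda>i j k. p * opX (opA f) i j k)"
  unfolding opX_opA using q0 by (simp add: fun_eq_iff)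

lemma opY_opA: "opY (opA f) = (\<lambda>i j k. p * opA (opY f) i j k)"
  by (simp add: opY_def opA_def fun_eq_iff)

lemma opY_opX: "opY (opX f) = lc3 p (opX (opY f)) \<gamma> (opA (opA f)) (- \<gamma>) f"
proof (intro ext)
  fix i j k
  show "opY (opX f) i j k = lc3 p (opX (opY f)) \<gamma> (opA (opA f)) (- \<gamma>) f i j k"
    by (cases k) (simp_all add: opY_def opX_def opA_def algebra_simps power_add mult_2_right)
qed

lemma opA_opX_pow: "opA ((opX ^^ m) f) = (\<lambda>i j k. p ^ m * (opX ^^ m) (opA f) i j k)"
proof (induct m)
  case (Suc m)
  have "opA ((opX ^^ Suc m) f) = (\<lambda>i j k. p * opX (opA ((opX ^^ m) f)) i j k)"
    by (simp add: opA_opX)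
  then show ?case unfolding Suc op_scale by (simp add: mult.assoc)
qed simp

text \<open>The operator form of y x^m = p^m x^m y + \<gamma>(T x^(m-1) a^2 - G x^(m-1)). The same
  two sums T and G appear as in \<open>opX\<close>, since moving a^2 to the right past x^m also
  costs p^(2m).\<close>

lemma opY_opX_pow: "opY ((opX ^^ m) f) = lc3 (p ^ m) ((opX ^^ m) (opY f))
   (\<gamma> * twisted_geom_sum p m) ((opX ^^ (m - 1)) (opA (opA f))) (- \<gamma> * geom_sum p m) ((opX ^^ (m - 1)) f)"
proof (induct m)
  case (Suc m)
  have A: "opA (opA ((opX ^^ m) f)) = (\<lambda>i j k. p ^ (2 * m) * (opX ^^ m) (opA (opA f)) i j k)"
    by (simp add: opA_opX_pow op_scale mult_2 power_add mult.assoc)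
  have s: "opX ((opX ^^ (m - Suc 0)) g) = (opX ^^ m) g" if "0 < m" for g
    using that by (cases m) auto
  have "opY ((opX ^^ Suc m) f) = opY (opX ((opX ^^ m) f))" by simp
  also have "\<dots> = lc3 p (opX (opY ((opX ^^ m) f))) \<gamma> (opA (opA ((opX ^^ m) f))) (- \<gamma>) ((opX ^^ m) f)"
    by (rule opY_opX)
  finally show ?case
    unfolding A Suc op_linear
    by (cases "m = 0") (auto simp: fun_eq_iff s algebra_simps)
qed simp

text \<open>Both sums vanish at n and p^n = 1. Powers of \<open>opX\<close> have no simple formula
  for k > 0; commuting with \<open>opY\<close> makes the nth one accessible from k = 0.\<close>

lemma opX_pow_n_commute: "opY ((opX ^^ n) f) = (opX ^^ n) (opY f)"
proof -
  have p: "p \<noteq> 1" "p \<noteq> 0" using q1 q0 by auto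
  have "geom_sum p n = 0" "twisted_geom_sum p n = 0"
    using geom_sum_add_root[OF p_pow_n p, of 0] by simp_all
  then show ?thesis unfolding opY_opX_pow by (simp add: p_pow_n)
qed

lemma opA_pow: "(opA ^^ m) f i j k = (q ^ j * p ^ k) ^ m * f (i + m) j k"
  by (induct m arbitrary: i) (simp_all add: opA_def)

lemma opY_pow: "(opY ^^ m) f i j k = f i j (k + m)"
  by (induct m arbitrary: k) (simp_all add: opY_def)

lemma opX_pow_0: "(opX ^^ m) f i j 0 = f i (j + m) 0"
  by (induct m arbitrary: j) (simp_all add: opX_def)

lemma q_pow_mult_n: "q ^ (2 * j + 2 * n) = q ^ (2 * j)" "q ^ (j + n) = q ^ j" "p ^ (k + n) = p ^ k"
  using q_pow_n p_pow_n by (simp_all add: power_add distrib_left mult_2)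

lemma functionals_closed:
  assumes f: "f \<in> functionals"
  shows "opA f \<in> functionals" "opX f \<in> functionals" "opY f \<in> functionals"
proof -
  note D = functionalsD[OF f]
  have D': "f (Suc (i + N)) j k = f (Suc i) j k" "f (Suc (Suc (i + N))) j k = f (Suc (Suc i)) j k"
    "f i (Suc (j + n)) k = \<alpha> * (f (i + n) (Suc j) k - f i (Suc j) k)"
    "f i j (Suc (k + n)) = \<beta> * (f (i + n) j (Suc k) - f i j (Suc k))" for i j k
    using D(1)[of "Suc i"] D(1)[of "Suc (Suc i)"] D(2)[of i "Suc j"] D(3)[of i j "Suc k"] by simp_all
  show "opA f \<in> functionals"
    unfolding functionals_def opA_def by (simp add: D D' q_pow_mult_n algebra_simps)
  show "opY f \<in> functionals"
    unfolding functionals_def opY_def by (simp add: D D')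
  have p: "p \<noteq> 1" "p \<noteq> 0" using q1 q0 by auto
  note g = geom_sum_add_root[OF p_pow_n p]
  have z: "geom_sum p n = 0" "twisted_geom_sum p n = 0" using g[of 0] by simp_all
  have "opX f i j (k + n) = \<beta> * (opX f (i + n) j k - opX f i j k)" for i j k
  \<comment> \<open>For k = 0 the truncated k - 1 does not differ from k + n - 1 by n, so the
    recursion of f cannot be used there; instead the coefficients vanish, both sums being 0 at 0 and
    at n.\<close>
  proof (cases k)
    case 0
    then show ?thesis by (simp add: opX_def z p_pow_n D(3)[of _ _ 0, simplified])
  next
    case (Suc k')
    have e: "k + n - 1 = k' + n" "k - 1 = k'" using Suc by simp_all
    show ?thesis unfolding opX_def e
      by (simp add: D D' g q_pow_mult_n Suc[symmetric] algebra_simps)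
  qed
  moreover have "opX f (i + N) j k = opX f i j k" for i j k
    by (simp add: opX_def D D')
  moreover have "opX f i (j + n) k = \<alpha> * (opX f (i + n) j k - opX f i j k)" for i j k
    by (simp add: opX_def D D' q_pow_mult_n) (simp add: algebra_simps)
  ultimately show "opX f \<in> functionals" unfolding functionals_def by blast
qed

text \<open>At k = 0 the operator \<open>opX\<close> just raises j, and the claim is the recursion
  of f in j. A value at k + 1 is a value of \<open>opY\<close> at k, and \<open>opY\<close> commutes
  with the nth power of \<open>opX\<close>.\<close>

lemma opX_pow_n:
  assumes "f \<in> functionals"
  shows "(opX ^^ n) f i j k = \<alpha> * ((opA ^^ n) f i j k - f i j k)"
  using assms
proof (induct k arbitrary: f)
  case 0
  then show ?case
    by (simp add: opX_pow_0 functionalsD opA_pow power_mult[symmetric] mult.commute[of _ n])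
      (simp add: power_mult q_pow_n)
next
  case (Suc k)
  have A: "(q ^ j * p ^ k) ^ n = 1" for k
    by (simp add: power_mult_distrib power_mult[symmetric] mult.commute[of _ n])
      (simp add: power_mult q_pow_n p_pow_n)
  have "(opX ^^ n) f i j (Suc k) = opY ((opX ^^ n) f) i j k" by (simp add: opY_def)
  also have "\<dots> = \<alpha> * ((opA ^^ n) (opY f) i j k - opY f i j k)"
    unfolding opX_pow_n_commute by (rule Suc(1)) (rule functionals_closed(3)[OF Suc(2)])
  finally show ?case by (simp only: opA_pow A opY_def)
qed

lemma opY_pow_n:
  assumes "f \<in> functionals"
  shows "(opY ^^ n) f i j k = \<beta> * ((opA ^^ n) f i j k - f i j k)"
proof -
  have A: "(q ^ j * p ^ k) ^ n = 1"
    by (simp add: power_mult_distrib power_mult[symmetric] mult.commute[of _ n])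
      (simp add: power_mult q_pow_n p_pow_n)
  show ?thesis by (simp add: opY_pow opA_pow A functionalsD[OF assms])
qed

lemma opA_pow_N:
  assumes "f \<in> functionals"
  shows "(opA ^^ N) f = f"
proof -
  obtain d where d: "N = n * d" using n by (auto elim: dvdE)
  have "(q ^ j * p ^ k) ^ N = 1" for j k
  proof -
    have "(q ^ j * p ^ k) ^ n = 1"
      by (simp add: power_mult_distrib power_mult[symmetric] mult.commute[of _ n])
        (simp add: power_mult q_pow_n p_pow_n)
    then show ?thesis unfolding d by (simp only: power_mult power_one)
  qed
  then show ?thesis by (simp add: fun_eq_iff opA_pow functionalsD[OF assms])
qed

fun opg :: "gen \<Rightarrow> (nat \<Rightarrow> nat \<Rightarrow> nat \<Rightarrow> 'k) \<Rightarrow> nat \<Rightarrow> nat \<Rightarrow> nat \<Rightarrow> 'k" where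
  "opg Gen_a = opA" | "opg Gen_x = opX" | "opg Gen_y = opY"

abbreviation "act w f \<equiv> foldr opg w f"

lemma act_functionals: "f \<in> functionals \<Longrightarrow> act w f \<in> functionals"
proof (induct w)
  case (Cons g w)
  then show ?case by (cases g) (simp_all add: functionals_closed)
qed simp

lemma act_linear: "act w (lc3 a f b g c h) = lc3 a (act w f) b (act w g) c (act w h)"
proof (induct w)
  case (Cons g w)
  then show ?case by (cases g) (simp_all add: op_linear)
qed simp

lemma act_replicate: "act (replicate m g) f = (opg g ^^ m) f"
  by (induct m) simp_all

text \<open>For the functional \<psi> encoded by f, \<psi>(w) is the value of w \<psi> at the unit
  monomial; the rightmost letter acts first.\<close>

definition "word_functional f w = act w f 0 0 0"

lemma word_functional_append: "word_functional f (u @ w @ v) = act u (act w (act v f)) 0 0 0"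
  by (simp add: word_functional_def)

text \<open>A relation is needed only at \<open>act v f\<close>, which is again in
  \<open>functionals\<close>; the prefix \<open>u\<close> acts linearly and preserves it. This is
  exactly the two-sided test in \<open>compatible\<close>.\<close>

lemma word_functional_lc3:
  assumes "act w (act v f) = lc3 a (act w1 (act v f)) b (act w2 (act v f)) c (act w3 (act v f))"
  shows "word_functional f (u @ w @ v) = a * word_functional f (u @ w1 @ v)
    + b * word_functional f (u @ w2 @ v) + c * word_functional f (u @ w3 @ v)"
  unfolding word_functional_append assms act_linear ..

lemma word_functional_compatible:
  assumes f: "f \<in> functionals"
  shows "compatible word_monoid R base_algebra (word_functional f)"
proof -
  interpret B: kalgebra base_algebra by (rule kalgebra_base)
  let ?\<phi> = "word_functional f"
  have s: "lin_ext base_algebra ?\<phi> (Poly_Mapping.single w c) = c * ?\<phi> w" for w c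
    by (subst B.lin_ext_single) simp_all
  have d: "lin_ext base_algebra ?\<phi> (g - h) = lin_ext base_algebra ?\<phi> g - lin_ext base_algebra ?\<phi> h" for g h
    by (subst B.lin_ext_diff[of _ UNIV]) (simp_all add: a_minus_def)
  show ?thesis
    unfolding compatible_def
  proof (intro conjI ballI)
    fix r u v assume r: "r \<in> R"
    note V = act_functionals[OF f, of v]
    have rel: "?\<phi> (u @ replicate N Gen_a @ v) = 1 * ?\<phi> (u @ [] @ v) + 0 * ?\<phi> (u @ [] @ v) + 0 * ?\<phi> (u @ [] @ v)"
      "?\<phi> (u @ [Gen_x, Gen_a] @ v) = q * ?\<phi> (u @ [Gen_a, Gen_x] @ v) + 0 * ?\<phi> (u @ [] @ v) + 0 * ?\<phi> (u @ [] @ v)"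
      "?\<phi> (u @ [Gen_y, Gen_a] @ v) = p * ?\<phi> (u @ [Gen_a, Gen_y] @ v) + 0 * ?\<phi> (u @ [] @ v) + 0 * ?\<phi> (u @ [] @ v)"
      "?\<phi> (u @ [Gen_y, Gen_x] @ v) = p * ?\<phi> (u @ [Gen_x, Gen_y] @ v) + \<gamma> * ?\<phi> (u @ replicate 2 Gen_a @ v)
         + (- \<gamma>) * ?\<phi> (u @ [] @ v)"
      "?\<phi> (u @ replicate n Gen_x @ v) = \<alpha> * ?\<phi> (u @ replicate n Gen_a @ v) + (- \<alpha>) * ?\<phi> (u @ [] @ v) + 0 * ?\<phi> (u @ [] @ v)"
      "?\<phi> (u @ replicate n Gen_y @ v) = \<beta> * ?\<phi> (u @ replicate n Gen_a @ v) + (- \<beta>) * ?\<phi> (u @ [] @ v) + 0 * ?\<phi> (u @ [] @ v)"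
      by (rule word_functional_lc3, simp add: act_replicate opA_pow_N[OF V] opX_opA opY_opA opY_opX
          opX_pow_n[OF V] opY_pow_n[OF V] fun_eq_iff numeral_2_eq_2 right_diff_distrib)+
    show "lin_ext base_algebra ?\<phi> (Poly_Mapping.single u 1 \<otimes>\<^bsub>monoid_algebra word_monoid\<^esub> r
        \<otimes>\<^bsub>monoid_algebra word_monoid\<^esub> Poly_Mapping.single v 1) = \<zero>\<^bsub>base_algebra\<^esub>"
      using r unfolding R_eq
      by (elim insertE emptyE; hypsubst;
          simp only: monoid_algebra_l_diff monoid_algebra_r_diff monoid_algebra_mult_single d s
            word_monoid_simps append_assoc mult_1 mult_1_right rel base_algebra_simps;
          simp add: algebra_simps)
  qed simp
qed

section \<open>Functionals on the algebra and the dual basis\<close>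

definition "functional f = induced base_algebra (word_functional f)"

lemma functional_linear: "f \<in> functionals \<Longrightarrow> functional f \<in> linear_maps U base_algebra"
  unfolding functional_def U_eq
  by (rule pres.induced_linear[OF kalgebra_base word_functional_compatible])

lemma monomial_eq: "monomial i j k = word_class (replicate i Gen_a @ replicate j Gen_x @ replicate k Gen_y)"
  by (simp add: monomial_def word_class_append word_class_replicate ga_def gx_def gy_def U.m_assoc word_class_closed)

lemma functional_mono3:
  assumes "f \<in> functionals"
  shows "functional f (monomial i j k) = f i j k"
proof -
  have "functional f (word_class w) = word_functional f w" for w
    unfolding functional_def word_class_def
    by (rule pres.induced_single[OF kalgebra_base word_functional_compatible[OF assms]]) simp
  then show ?thesis
    by (simp add: monomial_eq word_functional_def act_replicate opA_pow opX_pow_0 opY_pow)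
qed

definition "shift_diff g i = (g (i + n) - g i :: 'k)"

text \<open>The coefficient of a^i x^j y^k at the basis monomial b: reduction replaces every x^n by
  \<alpha>(a^n - 1) and every y^n by \<beta>(a^n - 1), and \<open>shift_diff\<close> is
  multiplication by a^n - 1 seen on functions of the exponent of a.\<close>

definition "dual_fun b i j k = (case b of (i0, j0, k0) \<Rightarrow>
   if j mod n = j0 \<and> k mod n = k0
   then \<alpha> ^ (j div n) * \<beta> ^ (k div n) *
     (shift_diff ^^ (j div n + k div n)) (\<lambda>i. if i mod N = i0 then 1 else 0) i
   else 0)"

lemma shift_diff_periodic:
  "(\<And>i. g (i + N) = g i) \<Longrightarrow> (shift_diff ^^ m) g (i + N) = (shift_diff ^^ m) g i"
proof (induct m arbitrary: i)
  case (Suc m)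
  have e: "(shift_diff ^^ Suc m) g i = (shift_diff ^^ m) g (i + n) - (shift_diff ^^ m) g i" for i
    by (simp add: shift_diff_def[of "(shift_diff ^^ m) g"])
  have "i + N + n = i + n + N" by simp
  then show ?case unfolding e using Suc by (simp only:)
qed simp

lemma dual_fun_functional: "dual_fun b \<in> functionals"
proof -
  obtain i0 j0 k0 where b: "b = (i0, j0, k0)" by (cases b)
  have n0: "n \<noteq> 0" using n by simp
  show ?thesis
    unfolding functionals_def b dual_fun_def
    using n0 by (auto simp: shift_diff_periodic shift_diff_def algebra_simps)
qed

definition "coord b = functional (dual_fun b)"

lemma coord_linear: "coord b \<in> linear_maps U base_algebra"
  unfolding coord_def by (rule functional_linear) (rule dual_fun_functional)

lemmas coordD = linear_mapsD[OF coord_linear, simplified]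

lemma coord_mono3:
  "\<lbrakk>j < n; k < n\<rbrakk> \<Longrightarrow> coord (i0, j0, k0) (monomial i j k) = (if i mod N = i0 \<and> j = j0 \<and> k = k0 then 1 else 0)"
  unfolding coord_def by (auto simp: functional_mono3[OF dual_fun_functional] dual_fun_def)

lemma coord_e: "\<lbrakk>b \<in> Box; b' \<in> Box\<rbrakk> \<Longrightarrow> coord b (e b') = (if b = b' then 1 else 0)"
  by (cases b; cases b') (auto simp: Box_def coord_mono3 split: if_splits)

lemma coord_finsum:
  assumes "b \<in> Box"
  shows "coord b (\<Oplus>\<^bsub>U\<^esub>b'\<in>Box. c b' \<odot>\<^bsub>U\<^esub> e b') = c b"
proof -
  have "coord b (\<Oplus>\<^bsub>U\<^esub>b'\<in>Box. c b' \<odot>\<^bsub>U\<^esub> e b') = (\<Sum>b'\<in>Box. coord b (c b' \<odot>\<^bsub>U\<^esub> e b'))"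
    by (subst linear_maps_finsum[OF U.kalgebra_axioms kalgebra_base coord_linear])
      (use e_closed in auto)
  also have "\<dots> = (\<Sum>b'\<in>Box. if b = b' then c b' else 0)"
    by (rule sum.cong[OF refl]) (use assms e_closed in \<open>simp only: coordD coord_e; simp\<close>)
  also have "\<dots> = c b" using assms by (subst sum.delta'[OF finite_Box]) (rule if_P)
  finally show ?thesis .
qed

lemma expansion:
  assumes "z \<in> carrier U"
  shows "z = (\<Oplus>\<^bsub>U\<^esub>b\<in>Box. coord b z \<odot>\<^bsub>U\<^esub> e b)"
proof -
  obtain c where c: "z = (\<Oplus>\<^bsub>U\<^esub>b\<in>Box. c b \<odot>\<^bsub>U\<^esub> e b)"
    using box_span_all[OF assms] by (auto simp: box_span_def)
  also have "\<dots> = (\<Oplus>\<^bsub>U\<^esub>b\<in>Box. coord b z \<odot>\<^bsub>U\<^esub> e b)"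
    by (rule U.finsum_cong') (use e_closed in \<open>auto simp only: c coord_finsum U.smult_closed Pi_iff\<close>)
  finally show ?thesis .
qed

theorem dim_U:
  "vectorspace.fin_dim class_ring (U_hopf n N 1 q \<alpha> \<beta> \<gamma>)"
  "vectorspace.dim class_ring (U_hopf n N 1 q \<alpha> \<beta> \<gamma>) = N * n\<^sup>2"
proof -
  let ?H = "module.extend U (hopf.fields \<Delta> \<epsilon> S)"
  have H: "z = (\<Oplus>\<^bsub>?H\<^esub>b\<in>Box. coord b z \<odot>\<^bsub>?H\<^esub> e b)" if "z \<in> carrier ?H" for z
    using expansion[of z] that by (simp only: finsum_extend module_extend_simps)
  note d = dim_by_dual_basis[OF kalgebra_extend[OF U.kalgebra_axioms, of "hopf.fields \<Delta> \<epsilon> S"]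
      finite_Box, of e coord]
  show "vectorspace.fin_dim class_ring (U_hopf n N 1 q \<alpha> \<beta> \<gamma>)"
    "vectorspace.dim class_ring (U_hopf n N 1 q \<alpha> \<beta> \<gamma>) = N * n\<^sup>2"
    unfolding U_hopf_eq card_Box[symmetric]
    by (rule d; (rule H)?; simp only: module_extend_simps linear_maps_extend e_closed coord_linear coord_e)+
qed

end

section \<open>Group-like and skew primitive elements\<close>

context U_parameters begin

abbreviation "pt \<equiv> pure_tensor U U"

text \<open>The functional f \<otimes> g. With coordinates for f and g it reads off a coefficient of
  a tensor.\<close>

definition "tensor_functional f g = induced base_algebra (\<lambda>(a, b). f a * g b :: 'k)"

lemma tensor_functional:
  assumes "f \<in> linear_maps U base_algebra" "g \<in> linear_maps U base_algebra"
  shows "tensor_functional f g \<in> linear_maps (tensor U U) base_algebra"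
    "\<lbrakk>a \<in> carrier U; b \<in> carrier U\<rbrakk> \<Longrightarrow> tensor_functional f g (pt a b) = f a * g b"
proof -
  have b: "bilinear_map U U base_algebra (\<lambda>a b. f a * g b)"
    using bilinear_map_comp[OF bilinear_map_mult[OF kalgebra_base] assms] by simp
  show "tensor_functional f g \<in> linear_maps (tensor U U) base_algebra"
    "\<lbrakk>a \<in> carrier U; b \<in> carrier U\<rbrakk> \<Longrightarrow> tensor_functional f g (pt a b) = f a * g b"
    unfolding tensor_functional_def
    by (rule Hopf.UU.induced_bilinear[OF kalgebra_base b]; assumption)+
qed

text \<open>\<Delta>(x)^j and \<Delta>(y)^k are expanded by the q-binomial theorem with parameters q
  and its inverse. The remaining power of q comes from moving x^(j-s) past a^t in the second
  leg.\<close>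

lemma comult_mono3:
  "\<Delta> (monomial i j k) = (\<Oplus>\<^bsub>tensor U U\<^esub>s\<in>{..j}. \<Oplus>\<^bsub>tensor U U\<^esub>t\<in>{..k}.
     (qbinom q j s * qbinom p k t * q ^ ((j - s) * t)) \<odot>\<^bsub>tensor U U\<^esub>
       pt (monomial i s t) (monomial (i + s + t) (j - s) (k - t)))"
proof -
  let ?T = "tensor U U"
  note k = U.kalgebra_axioms
  note pp = pure_pow[OF k k]
  note cl = Hopf.UU.pure_closed
  interpret x: skew_primitive U ga gx q by unfold_locales (simp_all add: gx_ga)
  interpret y: skew_primitive U ga gy p by unfold_locales (simp_all add: gy_ga)
  have pw: "\<Delta> (z [^]\<^bsub>U\<^esub> m) = \<Delta> z [^]\<^bsub>?T\<^esub> m" if "z \<in> carrier U" for z and m :: nat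
    by (rule alg_hom_pow[OF k Hopf.UU.T.kalgebra_axioms \<Delta>_hom(1) that])
  let ?X = "\<lambda>s. qbinom q j s \<odot>\<^bsub>?T\<^esub> pt (gx [^]\<^bsub>U\<^esub> s) (ga [^]\<^bsub>U\<^esub> s \<otimes>\<^bsub>U\<^esub> gx [^]\<^bsub>U\<^esub> (j - s))"
  let ?Y = "\<lambda>t. qbinom p k t \<odot>\<^bsub>?T\<^esub> pt (gy [^]\<^bsub>U\<^esub> t) (ga [^]\<^bsub>U\<^esub> t \<otimes>\<^bsub>U\<^esub> gy [^]\<^bsub>U\<^esub> (k - t))"
  have Xc: "?X s \<in> carrier ?T" and Yc: "?Y s \<in> carrier ?T" for s by (simp_all add: cl)
  have X: "\<Delta> gx [^]\<^bsub>?T\<^esub> j = (\<Oplus>\<^bsub>?T\<^esub>s\<in>{..j}. ?X s)"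
    unfolding \<Delta>_hom
    by (subst Hopf.UU.T.q_binomial[OF _ _ x.X_parts_commute])
      (simp_all add: cl pp Hopf.UU.pure_mult cong: Hopf.UU.T.finsum_cong)
  have Y: "\<Delta> gy [^]\<^bsub>?T\<^esub> k = (\<Oplus>\<^bsub>?T\<^esub>t\<in>{..k}. ?Y t)"
    unfolding \<Delta>_hom
    by (subst Hopf.UU.T.q_binomial[OF _ _ y.X_parts_commute])
      (simp_all add: cl pp Hopf.UU.pure_mult cong: Hopf.UU.T.finsum_cong)
  let ?A = "pt (ga [^]\<^bsub>U\<^esub> i) (ga [^]\<^bsub>U\<^esub> i)"
  let ?R = "\<lambda>s t. (qbinom q j s * qbinom p k t * q ^ ((j - s) * t)) \<odot>\<^bsub>?T\<^esub>
       pt (monomial i s t) (monomial (i + s + t) (j - s) (k - t))"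
  have Ac: "?A \<in> carrier ?T" by (simp add: cl)
  have Rc: "?R s t \<in> carrier ?T" for s t by (simp add: cl monomial_closed)
  have R: "?A \<otimes>\<^bsub>?T\<^esub> ?X s \<otimes>\<^bsub>?T\<^esub> ?Y t = ?R s t" for s t
  proof -
    have "?A \<otimes>\<^bsub>?T\<^esub> ?X s \<otimes>\<^bsub>?T\<^esub> ?Y t = (qbinom q j s * qbinom p k t) \<odot>\<^bsub>?T\<^esub>
      pt (monomial i s t) (ga [^]\<^bsub>U\<^esub> i \<otimes>\<^bsub>U\<^esub> ga [^]\<^bsub>U\<^esub> s \<otimes>\<^bsub>U\<^esub> (gx [^]\<^bsub>U\<^esub> (j - s) \<otimes>\<^bsub>U\<^esub> ga [^]\<^bsub>U\<^esub> t) \<otimes>\<^bsub>U\<^esub> gy [^]\<^bsub>U\<^esub> (k - t))"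
      by (simp add: cl Hopf.UU.pure_mult monomial_def U.m_assoc mult.commute)
    also have "\<dots> = ?R s t"
      unfolding gx_pow_ga_pow
      by (simp add: cl Hopf.UU.pure_smult_right monomial_def U.m_assoc U.nat_pow_mult[symmetric] mult.assoc)
    finally show ?thesis .
  qed
  have "\<Delta> (monomial i j k) = ?A \<otimes>\<^bsub>?T\<^esub> (\<Oplus>\<^bsub>?T\<^esub>s\<in>{..j}. ?X s) \<otimes>\<^bsub>?T\<^esub> (\<Oplus>\<^bsub>?T\<^esub>t\<in>{..k}. ?Y t)"
    unfolding monomial_def X[symmetric] Y[symmetric]
    by (simp add: alg_homD[OF \<Delta>_hom(1)] pw \<Delta>_hom(2) pp)
  also have "?A \<otimes>\<^bsub>?T\<^esub> (\<Oplus>\<^bsub>?T\<^esub>s\<in>{..j}. ?X s) = (\<Oplus>\<^bsub>?T\<^esub>s\<in>{..j}. ?A \<otimes>\<^bsub>?T\<^esub> ?X s)"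
    by (rule Hopf.UU.T.finsum_rdistr) (use Ac Xc in auto)
  also have "\<dots> \<otimes>\<^bsub>?T\<^esub> (\<Oplus>\<^bsub>?T\<^esub>t\<in>{..k}. ?Y t) = (\<Oplus>\<^bsub>?T\<^esub>s\<in>{..j}. ?A \<otimes>\<^bsub>?T\<^esub> ?X s \<otimes>\<^bsub>?T\<^esub> (\<Oplus>\<^bsub>?T\<^esub>t\<in>{..k}. ?Y t))"
    by (rule Hopf.UU.T.finsum_ldistr) (use Ac Xc Yc in \<open>auto intro!: Hopf.UU.T.finsum_closed\<close>)
  also have "\<dots> = (\<Oplus>\<^bsub>?T\<^esub>s\<in>{..j}. \<Oplus>\<^bsub>?T\<^esub>t\<in>{..k}. ?R s t)"
  proof (rule Hopf.UU.T.finsum_cong')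
    fix s
    have "?A \<otimes>\<^bsub>?T\<^esub> ?X s \<otimes>\<^bsub>?T\<^esub> (\<Oplus>\<^bsub>?T\<^esub>t\<in>{..k}. ?Y t) = (\<Oplus>\<^bsub>?T\<^esub>t\<in>{..k}. ?A \<otimes>\<^bsub>?T\<^esub> ?X s \<otimes>\<^bsub>?T\<^esub> ?Y t)"
      by (rule Hopf.UU.T.finsum_rdistr) (use Ac Xc Yc in \<open>auto intro!: Hopf.UU.T.m_closed\<close>)
    also have "\<dots> = (\<Oplus>\<^bsub>?T\<^esub>t\<in>{..k}. ?R s t)" by (simp only: R)
    finally show "?A \<otimes>\<^bsub>?T\<^esub> ?X s \<otimes>\<^bsub>?T\<^esub> (\<Oplus>\<^bsub>?T\<^esub>t\<in>{..k}. ?Y t) = (\<Oplus>\<^bsub>?T\<^esub>t\<in>{..k}. ?R s t)" .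
  qed (use Rc in \<open>auto intro!: Hopf.UU.T.finsum_closed\<close>)
  finally show ?thesis .
qed

lemma tensor_functional_comult_mono3:
  assumes f: "f \<in> linear_maps U base_algebra" and g: "g \<in> linear_maps U base_algebra"
  shows "tensor_functional f g (\<Delta> (monomial i j k)) = (\<Sum>s\<le>j. \<Sum>t\<le>k.
     qbinom q j s * qbinom p k t * q ^ ((j - s) * t) * f (monomial i s t) * g (monomial (i + s + t) (j - s) (k - t)))"
proof -
  note tf = tensor_functional[OF f g]
  note fs = linear_maps_finsum[OF Hopf.UU.T.kalgebra_axioms kalgebra_base tf(1)]
  have c: "c \<odot>\<^bsub>tensor U U\<^esub> pt (monomial i s t) (monomial i' s' t') \<in> carrier (tensor U U)" for c i s t i' s' t'
    by (simp add: Hopf.UU.pure_closed monomial_closed)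
  show ?thesis
    unfolding comult_mono3
    by (subst fs, use c in \<open>auto intro!: Hopf.UU.T.finsum_closed\<close>, rule sum.cong[OF refl],
        subst fs, use c in \<open>auto intro!: Hopf.UU.T.finsum_closed\<close>, rule sum.cong[OF refl],
        simp add: linear_mapsD(3)[OF tf(1)] tf(2) Hopf.UU.pure_closed monomial_closed)
qed

lemma sum_single: "finite A \<Longrightarrow> (\<And>x. x \<in> A \<Longrightarrow> x \<noteq> a \<Longrightarrow> h x = 0) \<Longrightarrow> sum h A = (if a \<in> A then h a else (0::'k))"
  by (cases "a \<in> A") (auto simp: sum.remove intro!: sum.neutral)

text \<open>For j, k < n all exponents of x and y in the expansion stay below n, so its monomials
  are basis monomials up to the reduction of the exponent of a, and exactly one term can
  match.\<close>

lemma coord_comult_mono3: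
  assumes "j < n" "k < n"
  shows "tensor_functional (coord (i1, s1, t1)) (coord (i2, s2, t2)) (\<Delta> (monomial i j k)) =
    (if i mod N = i1 \<and> j = s1 + s2 \<and> k = t1 + t2 \<and> (i + s1 + t1) mod N = i2
     then qbinom q j s1 * qbinom p k t1 * q ^ (s2 * t1) else 0)"
proof -
  let ?h = "\<lambda>s t. qbinom q j s * qbinom p k t * q ^ ((j - s) * t) * coord (i1, s1, t1) (monomial i s t) *
    coord (i2, s2, t2) (monomial (i + s + t) (j - s) (k - t))"
  have "(\<Sum>s\<le>j. \<Sum>t\<le>k. ?h s t) = (\<Sum>s\<le>j. if t1 \<le> k then ?h s t1 else 0)"
    by (rule sum.cong[OF refl], subst sum_single[where a = t1])
      (use assms in \<open>auto simp: coord_mono3\<close>)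
  also have "\<dots> = (if s1 \<le> j then if t1 \<le> k then ?h s1 t1 else 0 else 0)"
    by (subst sum_single[where a = s1]) (use assms in \<open>auto simp: coord_mono3\<close>)
  also have "\<dots> = (if i mod N = i1 \<and> j = s1 + s2 \<and> k = t1 + t2 \<and> (i + s1 + t1) mod N = i2
     then qbinom q j s1 * qbinom p k t1 * q ^ (s2 * t1) else 0)"
    using assms by (auto simp: coord_mono3)
  finally show ?thesis
    unfolding tensor_functional_comult_mono3[OF coord_linear coord_linear] .
qed

text \<open>The comultiplication has the same structure constants for all \<open>\<alpha>\<close>, \<open>\<beta>\<close>, \<open>\<gamma>\<close>.\<close>

lemma coord_comult:
  assumes z: "z \<in> carrier U" and i1: "i1 < N"
  shows "tensor_functional (coord (i1, s1, t1)) (coord (i2, s2, t2)) (\<Delta> z) =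
    (if s1 + s2 < n \<and> t1 + t2 < n \<and> (i1 + s1 + t1) mod N = i2
     then coord (i1, s1 + s2, t1 + t2) z * (qbinom q (s1 + s2) s1 * qbinom p (t1 + t2) t1 * q ^ (s2 * t1))
     else 0)"
proof -
  let ?tf = "tensor_functional (coord (i1, s1, t1)) (coord (i2, s2, t2))"
  note tf = tensor_functional[OF coord_linear[of "(i1, s1, t1)"] coord_linear[of "(i2, s2, t2)"]]
  have lin: "(\<lambda>z. ?tf (\<Delta> z)) \<in> linear_maps U base_algebra"
    by (rule linear_maps_comp[OF alg_homD(1)[OF \<Delta>_hom(1)] tf(1)])
  let ?c = "\<lambda>(i, j, k). if i mod N = i1 \<and> j = s1 + s2 \<and> k = t1 + t2 \<and> (i + s1 + t1) mod N = i2
     then qbinom q j s1 * qbinom p k t1 * q ^ (s2 * t1) else 0"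
  have "?tf (\<Delta> z) = ?tf (\<Delta> (\<Oplus>\<^bsub>U\<^esub>b\<in>Box. coord b z \<odot>\<^bsub>U\<^esub> e b))"
    using expansion[OF z] by simp
  also have "\<dots> = (\<Sum>b\<in>Box. ?tf (\<Delta> (coord b z \<odot>\<^bsub>U\<^esub> e b)))"
    by (subst linear_maps_finsum[OF U.kalgebra_axioms kalgebra_base lin]) (use e_closed in auto)
  also have "\<dots> = (\<Sum>b\<in>Box. coord b z * ?c b)"
  proof (rule sum.cong[OF refl])
    fix b assume "b \<in> Box"
    then obtain i j k where b: "b = (i, j, k)" "j < n" "k < n" by (auto simp: Box_def)
    show "?tf (\<Delta> (coord b z \<odot>\<^bsub>U\<^esub> e b)) = coord b z * ?c b"
      using linear_mapsD(3)[OF lin, of "e b"] e_closed[of b] b(2,3)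
      by (simp add: b(1) coord_comult_mono3)
  qed
  also have "\<dots> = (if (i1, s1 + s2, t1 + t2) \<in> Box then coord (i1, s1 + s2, t1 + t2) z * ?c (i1, s1 + s2, t1 + t2) else 0)"
    by (rule sum_single[OF finite_Box]) (auto simp: Box_def split: if_splits)
  also have "\<dots> = (if s1 + s2 < n \<and> t1 + t2 < n \<and> (i1 + s1 + t1) mod N = i2
     then coord (i1, s1 + s2, t1 + t2) z * (qbinom q (s1 + s2) s1 * qbinom p (t1 + t2) t1 * q ^ (s2 * t1))
     else 0)"
    using i1 by (auto simp: Box_def)
  finally show ?thesis .
qed

lemma coord_eqI:
  assumes "z \<in> carrier U" "w \<in> carrier U"
    "\<And>i j k. \<lbrakk>i < N; j < n; k < n\<rbrakk> \<Longrightarrow> coord (i, j, k) z = coord (i, j, k) w"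
  shows "z = w"
proof -
  have "(\<Oplus>\<^bsub>U\<^esub>b\<in>Box. coord b z \<odot>\<^bsub>U\<^esub> e b) = (\<Oplus>\<^bsub>U\<^esub>b\<in>Box. coord b w \<odot>\<^bsub>U\<^esub> e b)"
    by (rule U.finsum_cong') (use assms(3) e_closed in \<open>auto simp: Box_def monomial_closed\<close>)
  then show ?thesis using expansion[OF assms(1)] expansion[OF assms(2)] by simp
qed

lemma monomial_simps: "\<one>\<^bsub>U\<^esub> = monomial 0 0 0" "ga [^]\<^bsub>U\<^esub> (m::nat) = monomial m 0 0" "gx = monomial 0 1 0" "gy = monomial 0 0 1"
  "ga = monomial 1 0 0" "ga \<otimes>\<^bsub>U\<^esub> gx = monomial 1 1 0" "ga \<otimes>\<^bsub>U\<^esub> gy = monomial 1 0 1" "gx \<otimes>\<^bsub>U\<^esub> gy = monomial 0 1 1"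
  by (simp_all add: monomial_def)

lemma coord_basis:
  "coord (i, j, k) \<one>\<^bsub>U\<^esub> = (if (i, j, k) = (0, 0, 0) then 1 else 0)"
  "coord (i, j, k) (ga [^]\<^bsub>U\<^esub> (m::nat)) = (if (i, j, k) = (m mod N, 0, 0) then 1 else 0)"
  "coord (i, j, k) ga = (if (i, j, k) = (1, 0, 0) then 1 else 0)"
  "coord (i, j, k) gx = (if (i, j, k) = (0, 1, 0) then 1 else 0)"
  "coord (i, j, k) gy = (if (i, j, k) = (0, 0, 1) then 1 else 0)"
  "coord (i, j, k) (ga \<otimes>\<^bsub>U\<^esub> gx) = (if (i, j, k) = (1, 1, 0) then 1 else 0)"
  "coord (i, j, k) (ga \<otimes>\<^bsub>U\<^esub> gy) = (if (i, j, k) = (1, 0, 1) then 1 else 0)"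
  "coord (i, j, k) (gx \<otimes>\<^bsub>U\<^esub> gy) = (if (i, j, k) = (0, 1, 1) then 1 else 0)"
proof -
  have m: "coord (i, j, k) (monomial i0 j0 k0) = (if (i, j, k) = (i0 mod N, j0, k0) then 1 else 0)"
    if "j0 < n" "k0 < n" for i0 j0 k0
    using that by (auto simp: coord_mono3)
  show "coord (i, j, k) \<one>\<^bsub>U\<^esub> = (if (i, j, k) = (0, 0, 0) then 1 else 0)"
    unfolding monomial_simps(1) by (subst m) (use n in auto)
  show "coord (i, j, k) (ga [^]\<^bsub>U\<^esub> (m::nat)) = (if (i, j, k) = (m mod N, 0, 0) then 1 else 0)"
    unfolding monomial_simps(2) by (subst m) (use n in auto)
  show "coord (i, j, k) ga = (if (i, j, k) = (1, 0, 0) then 1 else 0)"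
    unfolding monomial_simps(5) by (subst m) (use n in auto)
  show "coord (i, j, k) gx = (if (i, j, k) = (0, 1, 0) then 1 else 0)"
    unfolding monomial_simps(3) by (subst m) (use n in auto)
  show "coord (i, j, k) gy = (if (i, j, k) = (0, 0, 1) then 1 else 0)"
    unfolding monomial_simps(4) by (subst m) (use n in auto)
  show "coord (i, j, k) (ga \<otimes>\<^bsub>U\<^esub> gx) = (if (i, j, k) = (1, 1, 0) then 1 else 0)"
    unfolding monomial_simps(6) by (subst m) (use n in auto)
  show "coord (i, j, k) (ga \<otimes>\<^bsub>U\<^esub> gy) = (if (i, j, k) = (1, 0, 1) then 1 else 0)"
    unfolding monomial_simps(7) by (subst m) (use n in auto)
  show "coord (i, j, k) (gx \<otimes>\<^bsub>U\<^esub> gy) = (if (i, j, k) = (0, 1, 1) then 1 else 0)"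
    unfolding monomial_simps(8) by (subst m) (use n in auto)
qed

lemma coord_minus: "\<lbrakk>z \<in> carrier U; w \<in> carrier U\<rbrakk> \<Longrightarrow> coord b (z \<ominus>\<^bsub>U\<^esub> w) = coord b z - coord b w"
  using linear_maps_minus[OF U.kalgebra_axioms kalgebra_base coord_linear[of b], of z w]
  by (simp add: a_minus_def)

text \<open>At a monomial of degree (j, k) \<noteq> (0, 0), paired with itself, the equation
  \<Delta>(g) = g \<otimes> g equates the square of the coordinate to 0 or to a multiple of the one
  at (2j, 2k); downward induction on the degree makes it vanish. The coordinates at the powers of a
  are then orthogonal idempotents, and \<epsilon>(g) = 1 excludes g = 0.\<close>

lemma grouplike_power:
  assumes g: "g \<in> carrier U" "\<Delta> g = pt g g" "\<epsilon> g = 1"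
  obtains m where "m < N" "g = ga [^]\<^bsub>U\<^esub> m"
proof -
  have mult: "coord (i1, s1, t1) g * coord (i2, s2, t2) g =
    (if s1 + s2 < n \<and> t1 + t2 < n \<and> (i1 + s1 + t1) mod N = i2
     then coord (i1, s1 + s2, t1 + t2) g * (qbinom q (s1 + s2) s1 * qbinom p (t1 + t2) t1 * q ^ (s2 * t1))
     else 0)" if "i1 < N" for i1 s1 t1 i2 s2 t2
    using coord_comult[OF g(1) that, of s1 t1 i2 s2 t2] tensor_functional(2)[OF coord_linear coord_linear g(1) g(1)]
    unfolding g(2) by simp
  have 0: "coord (i, j, k) g = 0" if "i < N" "j < n" "k < n" "0 < j + k" for i j k
    using that
  proof (induct "2 * n - (j + k)" arbitrary: i j k rule: less_induct)
    case less
    have "coord (i, j, k) g * coord (i, j, k) g = 0"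
    proof (cases "j + j < n \<and> k + k < n")
      case True
      then have "coord (i, j + j, k + k) g = 0"
        using less.prems by (intro less.hyps) auto
      then show ?thesis using mult[OF less.prems(1), of j k i j k] by simp
    next
      case False
      then show ?thesis using mult[OF less.prems(1), of j k i j k] by auto
    qed
    then show ?case by simp
  qed
  have "\<exists>m<N. coord (m, 0, 0) g \<noteq> 0"
  proof (rule ccontr)
    assume c: "\<not> (\<exists>m<N. coord (m, 0, 0) g \<noteq> 0)"
    have "g = \<zero>\<^bsub>U\<^esub>"
    proof (rule coord_eqI)
      fix i j k assume a: "i < N" "j < n" "k < n"
      have "coord (i, j, k) \<zero>\<^bsub>U\<^esub> = 0"
        using linear_maps_zero[OF U.kalgebra_axioms kalgebra_base coord_linear] by simp
      then show "coord (i, j, k) g = coord (i, j, k) \<zero>\<^bsub>U\<^esub>"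
        using a c 0[OF a] by (cases "j + k = 0") auto
    qed (use g in auto)
    then show False
      using g(3) linear_maps_zero[OF U.kalgebra_axioms kalgebra_base alg_homD(1)[OF \<epsilon>_hom(1)]] by simp
  qed
  then obtain m where m: "m < N" "coord (m, 0, 0) g \<noteq> 0" by blast
  have n0: "0 < n" using n by simp
  have m1: "coord (m, 0, 0) g = 1" using mult[OF m(1), of 0 0 m 0 0] m n0 by simp
  have m2: "coord (i, 0, 0) g = 0" if "i \<noteq> m" "i < N" for i
    using mult[OF m(1), of 0 0 i 0 0] m that m1 n0 by simp
  have "g = ga [^]\<^bsub>U\<^esub> m"
  proof (rule coord_eqI)
    fix i j k assume a: "i < N" "j < n" "k < n"
    show "coord (i, j, k) g = coord (i, j, k) (ga [^]\<^bsub>U\<^esub> m)"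
      using a 0[OF a] m m1 m2[of i] by (cases "j + k = 0") (auto simp: coord_basis)
  qed (use g in auto)
  with m show ?thesis by (intro that)
qed

text \<open>The coordinates of \<Delta>(z) are compared at pairs of basis monomials. If both have
  positive degree in x and y, z \<otimes> a^m + 1 \<otimes> z contributes nothing, which kills
  degree at least 2. Pairs with a factor of degree 0 settle degrees 0 and 1; the term x \<otimes> a
  of \<Delta>(x) is what forces m = 1.\<close>

lemma skew_primitive_form:
  assumes z: "z \<in> carrier U" "\<Delta> z = pt z (ga [^]\<^bsub>U\<^esub> m) \<oplus>\<^bsub>tensor U U\<^esub> pt \<one>\<^bsub>U\<^esub> z" and m: "m < N"
  obtains l u w where "z = l \<odot>\<^bsub>U\<^esub> (\<one>\<^bsub>U\<^esub> \<ominus>\<^bsub>U\<^esub> ga [^]\<^bsub>U\<^esub> m) \<oplus>\<^bsub>U\<^esub> (u \<odot>\<^bsub>U\<^esub> gx \<oplus>\<^bsub>U\<^esub> w \<odot>\<^bsub>U\<^esub> gy)"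
    "m \<noteq> 1 \<Longrightarrow> u = 0 \<and> w = 0"
proof -
  let ?c = "\<lambda>i j k. coord (i, j, k) z"
  have N: "1 < N" "N \<noteq> 0" using n by auto
  have n2: "2 < n" using n by simp
  have mult: "?c i1 s1 t1 * (if (i2, s2, t2) = (m, 0, 0) then 1 else 0)
      + (if (i1, s1, t1) = (0, 0, 0) then 1 else 0) * ?c i2 s2 t2 =
    (if s1 + s2 < n \<and> t1 + t2 < n \<and> (i1 + s1 + t1) mod N = i2
     then ?c i1 (s1 + s2) (t1 + t2) * (qbinom q (s1 + s2) s1 * qbinom p (t1 + t2) t1 * q ^ (s2 * t1))
     else 0)" if "i1 < N" for i1 s1 t1 i2 s2 t2
    using coord_comult[OF z(1) that, of s1 t1 i2 s2 t2] m
    unfolding z(2)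
    by (simp add: linear_mapsD(2)[OF tensor_functional(1)[OF coord_linear coord_linear]]
        tensor_functional(2)[OF coord_linear coord_linear] z Hopf.UU.pure_closed coord_basis)
  have p: "primitive_root_of_unity n p" by (rule primitive_root_inverse[OF q])
  \<comment> \<open>A single x is split off, or a single y if there is no x; the structure constant
    of this splitting is nonzero for exponents below n.\<close>
  have deg2: "?c i j k = 0" if a: "i < N" "j < n" "k < n" "2 \<le> j + k" for i j k
  proof (cases j)
    case (Suc j')
    have "?c i (1 + j') (0 + k) * (qbinom q (1 + j') 1 * qbinom p (0 + k) 0 * q ^ (j' * 0)) = 0"
      using mult[OF a(1), of 1 0 "(i + 1) mod N" j' k] a Suc by (auto split: if_splits)
    moreover have "qbinom q (1 + j') 1 \<noteq> 0" by (rule qbinom_nonzero[OF q]) (use a Suc in auto)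
    ultimately show ?thesis using Suc by simp
  next
    case 0
    then obtain k' where k: "k = Suc k'" "0 < k'" using a by (cases k) auto
    have "?c i (0 + 0) (1 + k') * (qbinom q (0 + 0) 0 * qbinom p (1 + k') 1 * q ^ (0 * 1)) = 0"
      using mult[OF a(1), of 0 1 "(i + 1) mod N" 0 k'] a 0 k by (auto split: if_splits)
    moreover have "qbinom p (1 + k') 1 \<noteq> 0" by (rule qbinom_nonzero[OF p]) (use a k in auto)
    ultimately show ?thesis using k 0 by simp
  qed
  have x: "?c i 1 0 = 0" "?c i 0 1 = 0" if "i < N" "i \<noteq> 0" for i
    using mult[OF that(1), of 0 0 i 1 0] mult[OF that(1), of 0 0 i 0 1] that n2 by simp_all
  have x1: "?c 0 1 0 = 0" "?c 0 0 1 = 0" if "m \<noteq> 1"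
    using mult[of 0 1 0 1 0 0] mult[of 0 0 1 1 0 0] that n2 N by simp_all
  have d0: "?c i 0 0 = ?c 0 0 0 * ((if i = 0 then 1 else 0) - (if i = m then 1 else 0))" if i: "i < N" for i
  proof (cases "m = 0")
    case True
    \<comment> \<open>For m = 0 the comparison at the unit reads 2c = c, so c = 0 in every
      characteristic, in accordance with 1 - a^m = 0.\<close>
    have "(2::'k) \<noteq> 1"
      unfolding one_add_one[symmetric] using add_cancel_left_left[of 1 "1::'k"] zero_neq_one by (metis add_cancel_right_right)
    then have "?c 0 0 0 = 0" using mult[of 0 0 0 0 0 0] True N n2 by simp
    moreover have "?c i 0 0 = 0" if "i \<noteq> 0" using mult[OF i, of 0 0 i 0 0] that True i n2 by simp
    ultimately show ?thesis using True by auto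
  next
    case False
    have "?c 0 0 0 + ?c m 0 0 = 0" using mult[of 0 0 0 m 0 0] False N n2 by simp
    then have "?c m 0 0 = - ?c 0 0 0" by (simp add: add_eq_0_iff)
    moreover have "?c i 0 0 = 0" if "i \<noteq> 0" "i \<noteq> m" using mult[OF i, of 0 0 i 0 0] that i n2 by simp
    ultimately show ?thesis using False by auto
  qed
  have "z = ?c 0 0 0 \<odot>\<^bsub>U\<^esub> (\<one>\<^bsub>U\<^esub> \<ominus>\<^bsub>U\<^esub> ga [^]\<^bsub>U\<^esub> m) \<oplus>\<^bsub>U\<^esub> (?c 0 1 0 \<odot>\<^bsub>U\<^esub> gx \<oplus>\<^bsub>U\<^esub> ?c 0 0 1 \<odot>\<^bsub>U\<^esub> gy)"
    (is "z = ?w")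
  proof (rule coord_eqI)
    fix i j k assume a: "i < N" "j < n" "k < n"
    have w: "coord (i, j, k) ?w = ?c 0 0 0 * ((if (i, j, k) = (0, 0, 0) then 1 else 0) - (if (i, j, k) = (m, 0, 0) then 1 else 0))
      + (?c 0 1 0 * (if (i, j, k) = (0, 1, 0) then 1 else 0) + ?c 0 0 1 * (if (i, j, k) = (0, 0, 1) then 1 else 0))"
      using m by (simp add: coordD coord_minus coord_basis)
    consider "2 \<le> j + k" | "j = 1 \<and> k = 0" | "j = 0 \<and> k = 1" | "j = 0 \<and> k = 0" by linarith
    then show "?c i j k = coord (i, j, k) ?w"
      unfolding w
    proof cases
      case 1
      then show "?c i j k = ?c 0 0 0 * ((if (i, j, k) = (0, 0, 0) then 1 else 0) - (if (i, j, k) = (m, 0, 0) then 1 else 0))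
      + (?c 0 1 0 * (if (i, j, k) = (0, 1, 0) then 1 else 0) + ?c 0 0 1 * (if (i, j, k) = (0, 0, 1) then 1 else 0))"
        using deg2[OF a 1] by auto
    qed (use a x[of i] d0[of i] in auto)
  qed (use z in auto)
  then show ?thesis by (rule that) (use x1 in simp)
qed

text \<open>Passing a from right to left multiplies 1 - a, x and y by 1, q and the inverse of q.
  Comparing coordinates at a, ax and ay separates these eigenvalues.\<close>

lemma skew_primitive_commute:
  assumes z: "z = l \<odot>\<^bsub>U\<^esub> (\<one>\<^bsub>U\<^esub> \<ominus>\<^bsub>U\<^esub> ga) \<oplus>\<^bsub>U\<^esub> (u \<odot>\<^bsub>U\<^esub> gx \<oplus>\<^bsub>U\<^esub> w \<odot>\<^bsub>U\<^esub> gy)"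
    and c: "z \<otimes>\<^bsub>U\<^esub> ga = c \<odot>\<^bsub>U\<^esub> (ga \<otimes>\<^bsub>U\<^esub> z)" "c \<noteq> 1"
  shows "l = 0" "u * q = c * u" "w * p = c * w"
proof -
  have aa: "ga \<otimes>\<^bsub>U\<^esub> ga = ga [^]\<^bsub>U\<^esub> (2::nat)" by (simp add: numeral_2_eq_2)
  have N: "2 < N" using n by simp
  have 1: "z \<otimes>\<^bsub>U\<^esub> ga = l \<odot>\<^bsub>U\<^esub> (ga \<ominus>\<^bsub>U\<^esub> ga [^]\<^bsub>U\<^esub> (2::nat)) \<oplus>\<^bsub>U\<^esub> ((u * q) \<odot>\<^bsub>U\<^esub> (ga \<otimes>\<^bsub>U\<^esub> gx) \<oplus>\<^bsub>U\<^esub> (w * p) \<odot>\<^bsub>U\<^esub> (ga \<otimes>\<^bsub>U\<^esub> gy))"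
    unfolding z aa[symmetric] by (simp add: U.l_distr U.minus_eq U.l_minus gx_ga gy_ga)
  have 2: "ga \<otimes>\<^bsub>U\<^esub> z = l \<odot>\<^bsub>U\<^esub> (ga \<ominus>\<^bsub>U\<^esub> ga [^]\<^bsub>U\<^esub> (2::nat)) \<oplus>\<^bsub>U\<^esub> (u \<odot>\<^bsub>U\<^esub> (ga \<otimes>\<^bsub>U\<^esub> gx) \<oplus>\<^bsub>U\<^esub> w \<odot>\<^bsub>U\<^esub> (ga \<otimes>\<^bsub>U\<^esub> gy))"
    unfolding z aa[symmetric] by (simp add: U.r_distr U.minus_eq U.r_minus)
  have co: "coord b (z \<otimes>\<^bsub>U\<^esub> ga) = c * coord b (ga \<otimes>\<^bsub>U\<^esub> z)" for b
    unfolding c(1) using z by (simp add: coordD)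
  have "l = c * l" using co[of "(1, 0, 0)"] N unfolding 1 2
    by (simp add: coordD coord_minus coord_basis)
  then show "l = 0" using c(2) by simp
  show "u * q = c * u" using co[of "(1, 1, 0)"] unfolding 1 2
    by (simp add: coordD coord_minus coord_basis)
  show "w * p = c * w" using co[of "(1, 0, 1)"] unfolding 1 2
    by (simp add: coordD coord_minus coord_basis)
qed

lemma p_neq_q: "p \<noteq> q"
proof
  assume "p = q"
  then have "q ^ 2 = 1" using q0 by (simp add: power2_eq_square field_simps)
  then show False using primitive_root_power_neq_1[OF q, of 2] n by simp
qed

lemma hopf_isomorphic_refl: "hopf_isomorphic (U_hopf n N 1 q \<alpha> \<beta> \<gamma>) (U_hopf n N 1 q \<alpha> \<beta> \<gamma>)"
proof -
  have t: "tensor_map U U (\<lambda>x. x) (\<lambda>x. x) t = t" if "t \<in> carrier (tensor U U)" for t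
  proof (rule Hopf.UU.tensor_linear_eqI[OF _ linear_maps_id _ that])
    note k = U.kalgebra_axioms
    show "tensor_map U U (\<lambda>x. x) (\<lambda>x. x) \<in> linear_maps (tensor U U) (tensor U U)"
      "\<And>a b. a \<in> carrier U \<Longrightarrow> b \<in> carrier U \<Longrightarrow> tensor_map U U (\<lambda>x. x) (\<lambda>x. x) (pt a b) = pt a b"
      using tensor_map_linear[OF k k k k linear_maps_id linear_maps_id] by auto
  qed
  have "(\<lambda>x. x) \<in> hopf_hom (U_hopf n N 1 q \<alpha> \<beta> \<gamma>) (U_hopf n N 1 q \<alpha> \<beta> \<gamma>)"
    unfolding hopf_hom_def U_hopf_eq
    using t by (simp add: alg_hom_id alg_homD(4)[OF \<Delta>_hom(1)])
  moreover have "bij_betw (\<lambda>x. x) A A" for A :: "'z set" by (simp add: bij_betw_def)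
  ultimately show ?thesis unfolding hopf_isomorphic_def by blast
qed

end

section \<open>Isomorphisms between members of the family\<close>

theorem hopf_isomorphic_parameters:
  assumes A: "U_parameters n N q \<alpha> \<beta>" and B: "U_parameters n N q \<alpha>' \<beta>'"
    and iso: "hopf_isomorphic (U_hopf n N 1 q \<alpha> \<beta> \<gamma>) (U_hopf n N 1 q \<alpha>' \<beta>' \<gamma>')"
  obtains u w where "\<alpha> = u ^ n * \<alpha>'" "\<beta> = w ^ n * \<beta>'" "\<gamma> = u * w * \<gamma>'"
proof -
  interpret A: U_parameters n N q \<alpha> \<beta> \<gamma> by fact
  interpret B: U_parameters n N q \<alpha>' \<beta>' \<gamma>' by fact
  note kA = A.U.kalgebra_axioms and kB = B.U.kalgebra_axioms
  obtain \<phi> where h: "\<phi> \<in> hopf_hom (U_hopf n N 1 q \<alpha> \<beta> \<gamma>) (U_hopf n N 1 q \<alpha>' \<beta>' \<gamma>')"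
    and bij: "bij_betw \<phi> (carrier (U_hopf n N 1 q \<alpha> \<beta> \<gamma>)) (carrier (U_hopf n N 1 q \<alpha>' \<beta>' \<gamma>'))"
    using iso unfolding hopf_isomorphic_def by blast
  have hom: "\<phi> \<in> alg_hom A.U B.U"
    and com: "\<And>h. h \<in> carrier A.U \<Longrightarrow> B.\<Delta> (\<phi> h) = tensor_map B.U B.U \<phi> \<phi> (A.\<Delta> h)"
    and cou: "\<And>h. h \<in> carrier A.U \<Longrightarrow> B.\<epsilon> (\<phi> h) = A.\<epsilon> h"
    using h unfolding hopf_hom_def A.U_hopf_eq B.U_hopf_eq by auto
  have inj: "inj_on \<phi> (carrier A.U)"
    using bij unfolding A.U_hopf_eq B.U_hopf_eq by (auto simp: bij_betw_def)
  note \<phi> = alg_homD[OF hom]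
  note minus = linear_maps_minus[OF kA kB \<phi>(1)]
  note pow = alg_hom_pow[OF kA kB hom]
  note tm = tensor_map_linear[OF kA kA kB kB \<phi>(1) \<phi>(1)]
  obtain m where m: "m < N" "\<phi> A.ga = B.ga [^]\<^bsub>B.U\<^esub> m"
    by (rule B.grouplike_power[of "\<phi> A.ga"])
      (simp_all add: \<phi> com cou A.\<Delta>_hom A.\<epsilon>_hom tm)
  have skew: "B.\<Delta> (\<phi> z) = B.pt (\<phi> z) (B.ga [^]\<^bsub>B.U\<^esub> m) \<oplus>\<^bsub>tensor B.U B.U\<^esub> B.pt \<one>\<^bsub>B.U\<^esub> (\<phi> z)"
    if "z \<in> carrier A.U" "A.\<Delta> z = A.pt z A.ga \<oplus>\<^bsub>tensor A.U A.U\<^esub> A.pt \<one>\<^bsub>A.U\<^esub> z" for z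
    using that by (simp add: com tm linear_mapsD(2)[OF tm(1)] A.Hopf.UU.pure_closed \<phi> m(2)[symmetric])
  obtain l u w where x: "\<phi> A.gx = l \<odot>\<^bsub>B.U\<^esub> (\<one>\<^bsub>B.U\<^esub> \<ominus>\<^bsub>B.U\<^esub> B.ga [^]\<^bsub>B.U\<^esub> m) \<oplus>\<^bsub>B.U\<^esub> (u \<odot>\<^bsub>B.U\<^esub> B.gx \<oplus>\<^bsub>B.U\<^esub> w \<odot>\<^bsub>B.U\<^esub> B.gy)"
    and x1: "m \<noteq> 1 \<Longrightarrow> u = 0 \<and> w = 0"
    by (rule B.skew_primitive_form[OF _ skew[of A.gx] m(1)]) (simp_all add: \<phi> A.\<Delta>_hom)
  obtain l' u' w' where y: "\<phi> A.gy = l' \<odot>\<^bsub>B.U\<^esub> (\<one>\<^bsub>B.U\<^esub> \<ominus>\<^bsub>B.U\<^esub> B.ga [^]\<^bsub>B.U\<^esub> m) \<oplus>\<^bsub>B.U\<^esub> (u' \<odot>\<^bsub>B.U\<^esub> B.gx \<oplus>\<^bsub>B.U\<^esub> w' \<odot>\<^bsub>B.U\<^esub> B.gy)"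
    by (rule B.skew_primitive_form[OF _ skew[of A.gy] m(1)]) (simp_all add: \<phi> A.\<Delta>_hom)
  \<comment> \<open>For m \<noteq> 1 the image of x is a multiple of 1 - a^m, which is itself the
    image of 1 - a; injectivity would make x a multiple of 1 - a.\<close>
  have m1: "m = 1"
  proof (rule ccontr)
    assume "m \<noteq> 1"
    then have "\<phi> A.gx = l \<odot>\<^bsub>B.U\<^esub> (\<one>\<^bsub>B.U\<^esub> \<ominus>\<^bsub>B.U\<^esub> \<phi> A.ga)" using x x1 m(2) by simp
    also have "\<dots> = \<phi> (l \<odot>\<^bsub>A.U\<^esub> (\<one>\<^bsub>A.U\<^esub> \<ominus>\<^bsub>A.U\<^esub> A.ga))" by (simp add: \<phi> minus)
    finally have "A.gx = l \<odot>\<^bsub>A.U\<^esub> (\<one>\<^bsub>A.U\<^esub> \<ominus>\<^bsub>A.U\<^esub> A.ga)"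
      by (rule inj_onD[OF inj]) simp_all
    then have "A.coord (0, 1, 0) A.gx = A.coord (0, 1, 0) (l \<odot>\<^bsub>A.U\<^esub> (\<one>\<^bsub>A.U\<^esub> \<ominus>\<^bsub>A.U\<^esub> A.ga))" by simp
    then show False by (simp add: A.coordD A.coord_minus A.coord_basis)
  qed
  have ga: "\<phi> A.ga = B.ga" using m m1 by simp
  have one: "B.ga [^]\<^bsub>B.U\<^esub> m = B.ga" using m1 by simp
  note x = x[unfolded one] and y = y[unfolded one]
  have cx: "\<phi> A.gx \<otimes>\<^bsub>B.U\<^esub> B.ga = q \<odot>\<^bsub>B.U\<^esub> (B.ga \<otimes>\<^bsub>B.U\<^esub> \<phi> A.gx)"
    using arg_cong[OF A.gx_ga, of \<phi>] by (simp add: \<phi> ga)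
  have cy: "\<phi> A.gy \<otimes>\<^bsub>B.U\<^esub> B.ga = inverse q \<odot>\<^bsub>B.U\<^esub> (B.ga \<otimes>\<^bsub>B.U\<^esub> \<phi> A.gy)"
    using arg_cong[OF A.gy_ga, of \<phi>] by (simp add: \<phi> ga)
  have q1: "inverse q \<noteq> 1" using A.q1 by simp
  have "l = 0" "w = 0"
    using B.skew_primitive_commute[OF x cx A.q1] A.p_neq_q by auto
  then have X: "\<phi> A.gx = u \<odot>\<^bsub>B.U\<^esub> B.gx" using x by simp
  have "l' = 0" "u' = 0"
    using B.skew_primitive_commute[OF y cy q1] A.p_neq_q by auto
  then have Y: "\<phi> A.gy = w' \<odot>\<^bsub>B.U\<^esub> B.gy" using y by simp
  have an: "\<phi> (c \<odot>\<^bsub>A.U\<^esub> (A.ga [^]\<^bsub>A.U\<^esub> (r::nat) \<ominus>\<^bsub>A.U\<^esub> \<one>\<^bsub>A.U\<^esub>)) = c \<odot>\<^bsub>B.U\<^esub> (B.ga [^]\<^bsub>B.U\<^esub> r \<ominus>\<^bsub>B.U\<^esub> \<one>\<^bsub>B.U\<^esub>)" for c r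
    by (simp add: \<phi> minus pow ga)
  \<comment> \<open>For 0 < r < N the elements a^r and 1 are distinct basis monomials, so the scalar
    is a coordinate. It is applied with r = n.\<close>
  have co: "B.coord (r, 0, 0) (c \<odot>\<^bsub>B.U\<^esub> (B.ga [^]\<^bsub>B.U\<^esub> r \<ominus>\<^bsub>B.U\<^esub> \<one>\<^bsub>B.U\<^esub>)) = c" if "0 < r" "r < N" for c r
    using that by (simp add: B.coordD B.coord_minus B.coord_basis)
  have nn: "0 < n" "n < N" "2 < N" using A.n by auto
  have "(u ^ n * \<alpha>') \<odot>\<^bsub>B.U\<^esub> (B.ga [^]\<^bsub>B.U\<^esub> n \<ominus>\<^bsub>B.U\<^esub> \<one>\<^bsub>B.U\<^esub>) = \<alpha> \<odot>\<^bsub>B.U\<^esub> (B.ga [^]\<^bsub>B.U\<^esub> n \<ominus>\<^bsub>B.U\<^esub> \<one>\<^bsub>B.U\<^esub>)"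
    using arg_cong[OF A.gx_pow_n, of \<phi>] by (simp add: an pow X B.U.smult_pow B.gx_pow_n)
  then have \<alpha>: "\<alpha> = u ^ n * \<alpha>'" using co[OF nn(1,2)] by metis
  have "(w' ^ n * \<beta>') \<odot>\<^bsub>B.U\<^esub> (B.ga [^]\<^bsub>B.U\<^esub> n \<ominus>\<^bsub>B.U\<^esub> \<one>\<^bsub>B.U\<^esub>) = \<beta> \<odot>\<^bsub>B.U\<^esub> (B.ga [^]\<^bsub>B.U\<^esub> n \<ominus>\<^bsub>B.U\<^esub> \<one>\<^bsub>B.U\<^esub>)"
    using arg_cong[OF A.gy_pow_n, of \<phi>] by (simp add: an pow Y B.U.smult_pow B.gy_pow_n)
  then have \<beta>: "\<beta> = w' ^ n * \<beta>'" using co[OF nn(1,2)] by metis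
  have "\<phi> A.gy \<otimes>\<^bsub>B.U\<^esub> \<phi> A.gx = inverse q \<odot>\<^bsub>B.U\<^esub> (\<phi> A.gx \<otimes>\<^bsub>B.U\<^esub> \<phi> A.gy) \<oplus>\<^bsub>B.U\<^esub> \<gamma> \<odot>\<^bsub>B.U\<^esub> (B.ga [^]\<^bsub>B.U\<^esub> (2::nat) \<ominus>\<^bsub>B.U\<^esub> \<one>\<^bsub>B.U\<^esub>)"
    using arg_cong[OF A.gy_gx, of \<phi>] by (simp add: \<phi> an)
  then have "(w' * u) \<odot>\<^bsub>B.U\<^esub> (B.gy \<otimes>\<^bsub>B.U\<^esub> B.gx) = (inverse q * (u * w')) \<odot>\<^bsub>B.U\<^esub> (B.gx \<otimes>\<^bsub>B.U\<^esub> B.gy) \<oplus>\<^bsub>B.U\<^esub> \<gamma> \<odot>\<^bsub>B.U\<^esub> (B.ga [^]\<^bsub>B.U\<^esub> (2::nat) \<ominus>\<^bsub>B.U\<^esub> \<one>\<^bsub>B.U\<^esub>)"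
    by (simp add: X Y mult.commute)
  \<comment> \<open>After straightening, yx contributes to a^2 only through \<gamma>', and xy does
    not contribute; 2 < N keeps a^2 apart from 1.\<close>
  then have "B.coord (2, 0, 0) ((w' * u) \<odot>\<^bsub>B.U\<^esub> (B.gy \<otimes>\<^bsub>B.U\<^esub> B.gx)) =
     B.coord (2, 0, 0) ((inverse q * (u * w')) \<odot>\<^bsub>B.U\<^esub> (B.gx \<otimes>\<^bsub>B.U\<^esub> B.gy) \<oplus>\<^bsub>B.U\<^esub> \<gamma> \<odot>\<^bsub>B.U\<^esub> (B.ga [^]\<^bsub>B.U\<^esub> (2::nat) \<ominus>\<^bsub>B.U\<^esub> \<one>\<^bsub>B.U\<^esub>))"
    by (rule arg_cong)
  then have "w' * u * \<gamma>' = \<gamma>"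
    using nn(3) unfolding B.gy_gx by (simp add: B.coordD B.coord_minus B.coord_basis)
  then have \<gamma>: "\<gamma> = u * w' * \<gamma>'" by (simp add: mult.commute)
  show ?thesis by (rule that[OF \<alpha> \<beta> \<gamma>])
qed

section \<open>The infinite family\<close>

theorem mainTheorem11:
  fixes n N :: nat
  assumes "2 < n" and "n < N" and "n dvd N"
    and "infinite (UNIV :: 'k::field set)"
    and "\<exists>q :: 'k. primitive_root_of_unity n q"
  shows "\<exists>F \<subseteq> (U_family n N :: ('k, (gen list \<Rightarrow>\<^sub>0 'k) set) hopf set).
    infinite F \<and>
    (\<forall>H \<in> F. hopf_algebra H \<and> vectorspace.fin_dim class_ring H \<and>
      vectorspace.dim class_ring H = N * n\<^sup>2) \<and>
    pairwise (\<lambda>H L. \<not> hopf_isomorphic H L) F"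
proof -
  obtain q :: 'k where q: "primitive_root_of_unity n q" using assms(5) by blast
  let ?H = "\<lambda>\<beta>. U_hopf n N 1 q 1 \<beta> 1"
  have P: "U_parameters n N q 1 \<beta>" for \<beta>
    by unfold_locales (use assms q in auto)
  have iso: "\<beta> = \<beta>'" if h: "hopf_isomorphic (?H \<beta>) (?H \<beta>')" for \<beta> \<beta>'
  proof -
    obtain u w where u: "1 = u ^ n * 1" and w: "\<beta> = w ^ n * \<beta>'" and uw: "1 = u * w * 1"
      by (rule hopf_isomorphic_parameters[OF P P h])
    \<comment> \<open>The equation for \<alpha> gives u^n = 1, and the one for \<gamma> makes w the
      inverse of u; hence w^n = 1, and \<beta> is an invariant.\<close>
    have "u ^ n * w ^ n = 1" using uw by (simp only: power_mult_distrib[symmetric] mult_1_right power_one)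
    then show ?thesis using u w by simp
  qed
  have adm: "U_admissible n N 1 q 1 \<beta> 1" for \<beta>
    using assms(1-3) q by (auto simp: U_admissible_def dest: dvd_imp_le)
  \<comment> \<open>The family is a set of records, so its infinity requires different \<beta> to
    give different records; equal records are isomorphic by the identity.\<close>
  have "inj ?H"
  proof (rule injI)
    fix \<beta> \<beta>' assume "?H \<beta> = ?H \<beta>'"
    then have "hopf_isomorphic (?H \<beta>) (?H \<beta>')"
      using U_parameters.hopf_isomorphic_refl[OF P[of \<beta>], where \<gamma> = 1] by simp
    then show "\<beta> = \<beta>'" by (rule iso)
  qed
  then have "infinite (range ?H)" using assms(4) finite_imageD by blast
  moreover have "range ?H \<subseteq> U_family n N" unfolding U_family_def using adm by blast
  moreover have "pairwise (\<lambda>H L. \<not> hopf_isomorphic H L) (range ?H)"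
    unfolding pairwise_def using iso by blast
  moreover have "\<forall>H \<in> range ?H. hopf_algebra H \<and> vectorspace.fin_dim class_ring H \<and>
      vectorspace.dim class_ring H = N * n\<^sup>2"
    using U_parameters.hopf_algebra_U[OF P] U_parameters.dim_U[OF P] by blast
  ultimately show ?thesis by blast
qed

end
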